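(* Let $X_1,\dots,X_n$ be i.i.d. $N_p(\mu,\Sigma)$ and let $1\le k=o\big(n^{1/2}(\log p)^{-3/2}\big)$. The minimax risk of estimating the precision matrix $\Omega=\Sigma^{-1}$ over the class $\mathcal{G}_0(k,M_{n,p})$ based on the random sample $\{X_1,\dots,X_n\}$ satisfies $$\inf_{\hat\Omega}\sup_{\mathcal{G}_0(k,M_{n,p})}\mathbb{E}\|\hat\Omega-\Omega\|_w^2\asymp M_{n,p}^2k^2\frac{\log p}{n}$$ for all $1\le w\le\infty$.
   Context: The matrix $\ell_w$ norm is $\|A\|_w=\sup_{|x|_w\le 1}|Ax|_w$ for $1\le w\le\infty$, where $|\cdot|_w$ is the vector $\ell_w$ norm. $\mathcal{G}_0(k,M_{n,p})$ is the set of symmetric positive definite $p\times p$ matrices $\Omega=(\omega_{ij})$ such that each row/column of $\Omega$ has at most $k$ nonzero entries, $\|\Omega\|_1\le M_{n,p}$ (matrix $\ell_1$ norm), and $\lambda_{\max}(\Omega)/\lambda_{\min}(\Omega)\le M_1$, where $\lambda_{\max}(\Omega),\lambda_{\min}(\Omega)$ are the largest and smallest eigenvalues of $\Omega$, and $M_1>0$ is a given constant. Here $M_{n,p}$ and $k$ (which may depend on $n$ and $p$) are positive and bounded away from $0$, and $c_1n^\beta\le p\le\exp(\gamma n)$ for some constants $\beta>1$, $c_1>0$ and $\gamma>0$. The infimum is over all estimators $\hat\Omega$ based on $X_1,\dots,X_n$; the supremum is over $\Omega$ in the class, with $X_i\sim N_p(\mu,\Omega^{-1})$. For two sequences of positive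 numbers $a_n$ and $b_n$, $a_n\asymp b_n$ means that there exist positive constants $c$ and $C$ independent of $n$ such that $c\le a_n/b_n\le C$.
   Formalization: The constant M_1 is taken greater than 1 instead of M_1 > 0, since for M_1 < 1 the class is empty and for M_1 = 1 it has only multiples of the identity, so the rate fails; the comparison is over n with p ≥ 2, as log p = 0 at p = 1. *)

theory Defs
  imports
    "HOL-Probability.Probability"
    "HOL-Library.Landau_Symbols"
    "Jordan_Normal_Form.Determinant"
    "Jordan_Normal_Form.Gauss_Jordan_Elimination"
    "Jordan_Normal_Form.Spectral_Radius"
begin

unbundle no vec_syntax
unbundle no inner_syntax

text \<open>Since the dimension varies with the sample size, vectors and matrices are those of
  \<open>Jordan_Normal_Form\<close>, whose dimensions are values rather than types.\<close>

definition lw_norm :: "ereal \<Rightarrow> real vec \<Rightarrow> real" where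
  "lw_norm w v =
    (if w = \<infinity> then Max ((\<lambda>i. \<bar>v $ i\<bar>) ` {..<dim_vec v})
     else (\<Sum>i<dim_vec v. \<bar>v $ i\<bar> powr real_of_ereal w) powr (1 / real_of_ereal w))"

definition lw_mat_norm :: "ereal \<Rightarrow> real mat \<Rightarrow> real" where
  "lw_mat_norm w A =
    (SUP v\<in>{v \<in> carrier_vec (dim_col A). lw_norm w v \<le> 1}. lw_norm w (A *\<^sub>v v))"

definition symmetric_pos_def :: "nat \<Rightarrow> real mat \<Rightarrow> bool" where
  "symmetric_pos_def p A \<longleftrightarrow>
    A \<in> carrier_mat p p \<and> transpose_mat A = A \<and>
    (\<forall>v\<in>carrier_vec p. v \<noteq> 0\<^sub>v p \<longrightarrow> 0 < v \<bullet> (A *\<^sub>v v))"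

definition lambda_max :: "real mat \<Rightarrow> real" where
  "lambda_max A = Max (spectrum A)"

definition lambda_min :: "real mat \<Rightarrow> real" where
  "lambda_min A = Min (spectrum A)"

text \<open>\<open>M1\<close> bounds the condition number, \<open>M\<close> the matrix \<open>\<ell>\<close>-1 norm. The sparsity bound \<open>k\<close> is
  allowed to be any real number.\<close>

definition G0 :: "nat \<Rightarrow> real \<Rightarrow> real \<Rightarrow> real \<Rightarrow> real mat set" where
  "G0 p M1 k M = {\<Omega>. symmetric_pos_def p \<Omega> \<and>
     (\<forall>i<p. real (card {j. j < p \<and> \<Omega> $$ (i, j) \<noteq> 0}) \<le> k) \<and>
     (\<forall>j<p. real (card {i. i < p \<and> \<Omega> $$ (i, j) \<noteq> 0}) \<le> k) \<and>
     lw_mat_norm 1 \<Omega> \<le> M \<and>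
     lambda_max \<Omega> / lambda_min \<Omega> \<le> M1}"

text \<open>The inverse of an invertible square matrix; \<open>mat_inverse\<close> is \<open>None\<close> on all other matrices.\<close>

definition mat_inv :: "real mat \<Rightarrow> real mat" where
  "mat_inv A = the (mat_inverse A)"

text \<open>The normal distribution with mean \<open>\<mu>\<close> and positive definite covariance matrix \<open>\<Sigma>\<close>, as a
  measure on the extensional functions on \<open>{..<p}\<close>.\<close>

definition mvn_density :: "nat \<Rightarrow> real vec \<Rightarrow> real mat \<Rightarrow> (nat \<Rightarrow> real) \<Rightarrow> real" where
  "mvn_density p \<mu> \<Sigma> x =
    exp (- (1/2) * ((vec p x - \<mu>) \<bullet> (mat_inv \<Sigma> *\<^sub>v (vec p x - \<mu>)))) /
      sqrt ((2 * pi) ^ p * Determinant.det \<Sigma>)"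

definition mvn :: "nat \<Rightarrow> real vec \<Rightarrow> real mat \<Rightarrow> (nat \<Rightarrow> real) measure" where
  "mvn p \<mu> \<Sigma> =
    density (\<Pi>\<^sub>M i\<in>{..<p}. lborel) (\<lambda>x. ennreal (mvn_density p \<mu> \<Sigma> x))"

text \<open>The joint law of \<open>n\<close> independent observations; the indices \<open>1,\<dots>,n\<close> are shifted to
  \<open>0,\<dots>,n-1\<close>.\<close>

definition sample_law :: "nat \<Rightarrow> nat \<Rightarrow> real vec \<Rightarrow> real mat \<Rightarrow> (nat \<Rightarrow> nat \<Rightarrow> real) measure" where
  "sample_law n p \<mu> \<Sigma> = (\<Pi>\<^sub>M l\<in>{..<n}. mvn p \<mu> \<Sigma>)"

text \<open>Estimators are the Borel measurable functions of the sample with values in the real \<open>p\<close> by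
  \<open>p\<close> matrices; neither symmetry nor membership in the parameter class is required of them.\<close>

definition estimators :: "nat \<Rightarrow> nat \<Rightarrow> ((nat \<Rightarrow> nat \<Rightarrow> real) \<Rightarrow> real mat) set" where
  "estimators n p = {T.
     (\<forall>X. T X \<in> carrier_mat p p) \<and>
     (\<forall>i<p. \<forall>j<p. (\<lambda>X. T X $$ (i, j)) \<in>
        borel_measurable (\<Pi>\<^sub>M l\<in>{..<n}. \<Pi>\<^sub>M i\<in>{..<p}. borel))}"

text \<open>The expected loss is a nonnegative, possibly infinite, Lebesgue integral.\<close>

definition risk :: "ereal \<Rightarrow> nat \<Rightarrow> nat \<Rightarrow> real vec \<Rightarrow>
    ((nat \<Rightarrow> nat \<Rightarrow> real) \<Rightarrow> real mat) \<Rightarrow> real mat \<Rightarrow> ennreal" where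
  "risk w n p \<mu> T \<Omega> =
    (\<integral>\<^sup>+ X. ennreal ((lw_mat_norm w (T X - \<Omega>))\<^sup>2) \<partial>sample_law n p \<mu> (mat_inv \<Omega>))"

definition minimax_risk :: "ereal \<Rightarrow> nat \<Rightarrow> nat \<Rightarrow> real vec \<Rightarrow> real mat set \<Rightarrow> ennreal" where
  "minimax_risk w n p \<mu> G = (INF T\<in>estimators n p. SUP \<Omega>\<in>G. risk w n p \<mu> T \<Omega>)"

text \<open>The bounds on the ratio also force \<open>a\<close> to be positive and finite on \<open>N\<close>.\<close>

definition same_order_on :: "nat set \<Rightarrow> (nat \<Rightarrow> ennreal) \<Rightarrow> (nat \<Rightarrow> real) \<Rightarrow> bool" where
  "same_order_on N a b \<longleftrightarrow>
    (\<forall>n\<in>N. 0 < b n) \<and>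
    (\<exists>c C::real. 0 < c \<and> 0 < C \<and>
      (\<forall>n\<in>N. ennreal c \<le> a n / ennreal (b n) \<and> a n / ennreal (b n) \<le> ennreal C))"

end

theory Submission
  imports Defs
begin

text \<open>Upper bound: since \<open>\<mu>\<close> is known, the empirical covariance \<open>S\<close> has the right mean, and with high
  probability all entries of \<open>S \<Omega> - 1\<close> are of order \<open>r = sqrt (ln p / n)\<close>; this scale does not depend on \<open>\<Omega>\<close> because
  the condition number is bounded. Any two matrices of the class with that property differ entrywise by \<open>O(M r)\<close>,
  so by sparsity in every \<open>\<ell>\<close>-\<open>w\<close> norm by \<open>O(k M r)\<close>; the estimator picks one of them.

  Lower bound: for bounded \<open>k\<close> it suffices to perturb one unknown diagonal entry of a multiple of the identity.
  In general, every row \<open>i < r\<close> of a multiple of the identity is either left alone or gets about \<open>k\<close> entries of size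
  \<open>sqrt (ln p / n)\<close> at unknown columns. Even if all other rows are known, the two cases cannot be told
  apart, by a chi-square bound. So the row sums of the estimation error are of order \<open>k M sqrt (ln p / n)\<close> in a positive fraction of
  the rows, and testing with a constant vector bounds all \<open>\<ell>\<close>-\<open>w\<close> norms from below at the same time.\<close>

section \<open>Positive definite matrices\<close>

text \<open>Column sparsity shapes the lower bound: a column may be met by at most \<open>q\<close>
  perturbed rows, so the rows cannot be drawn independently. Given the others, one row is uniform
  over the supports that avoid saturated columns, and these leave at least half of every group free.
  The power 3/2 of the logarithm comes from this coupling: the other rows distort the overlap of two
  candidate supports by entries of size up to \<open>2 e q\<close>, the overlap has weight
  \<open>2 n e^2\<close> in the chi-square exponent, and \<open>n e^3 q\<close> is bounded when
  \<open>k^2 (ln p)^3 / n\<close> is. Growth of \<open>p\<close> beyond \<open>n\<close> pays for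
  the columns: with \<open>e = c sqrt (ln p / n)\<close> a coincidence of two supports costs a
  factor of order \<open>p powr (2 c^2)\<close>, so that order of \<open>q^2 p powr (2 c^2)\<close>
  columns is needed, while \<open>q^2 \<le> n\<close>. In the upper bound the condition number
  enters through products of a diagonal entry of the covariance and one of the precision matrix. The
  order is asserted for every \<open>n\<close> with \<open>p n \<ge> 2\<close>. Outside the
  asymptotic regime the zero estimator gives the upper bound and the diagonal perturbation the lower
  one; the latter also serves \<open>k < 2\<close>, where a row has no room off the
  diagonal.\<close>

lemma spdD:
  assumes "symmetric_pos_def p A"
  shows "A \<in> carrier_mat p p" "transpose_mat A = A"
    "\<And>v. v \<in> carrier_vec p \<Longrightarrow> v \<noteq> 0\<^sub>v p \<Longrightarrow> 0 < v \<bullet> (A *\<^sub>v v)"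
  using assms by (auto simp: symmetric_pos_def_def)

lemma spd_nonneg:
  assumes "symmetric_pos_def p A" "v \<in> carrier_vec p"
  shows "0 \<le> v \<bullet> (A *\<^sub>v v)"
  using spdD[OF assms(1)] assms(2) by (cases "v = 0\<^sub>v p") (auto intro: less_imp_le)

lemma spd_det_nonzero:
  assumes "symmetric_pos_def p A"
  shows "Determinant.det A \<noteq> 0"
proof
  assume "Determinant.det A = 0"
  then obtain v where v: "v \<in> carrier_vec p" "v \<noteq> 0\<^sub>v p" "A *\<^sub>v v = 0\<^sub>v p"
    using det_0_iff_vec_prod_zero_field[OF spdD(1)[OF assms]] by auto
  then show False using spdD(3)[OF assms v(1,2)] by simp
qed

lemma mat_inv:
  assumes "A \<in> carrier_mat p p" "Determinant.det A \<noteq> 0"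
  shows "mat_inv A \<in> carrier_mat p p" "A * mat_inv A = 1\<^sub>m p" "mat_inv A * A = 1\<^sub>m p"
proof -
  have "A \<in> Units (ring_mat TYPE(real) p ())"
    using det_non_zero_imp_unit[OF assms] .
  then obtain B where B: "mat_inverse A = Some B"
    using mat_inverse(1)[OF assms(1), of "()"] by (cases "mat_inverse A") auto
  then have "mat_inv A = B" by (simp add: mat_inv_def)
  then show "mat_inv A \<in> carrier_mat p p" "A * mat_inv A = 1\<^sub>m p" "mat_inv A * A = 1\<^sub>m p"
    using mat_inverse(2)[OF assms(1) B] by auto
qed

lemma det_mat_inv:
  assumes "A \<in> carrier_mat p p" "Determinant.det A \<noteq> 0"
  shows "Determinant.det (mat_inv A) = 1 / Determinant.det A"
proof -
  have "Determinant.det A * Determinant.det (mat_inv A) = 1"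
    using det_mult[OF assms(1) mat_inv(1)[OF assms]] mat_inv(2)[OF assms] by simp
  then show ?thesis using assms by (simp add: field_simps)
qed

lemma mat_inv_mat_inv:
  assumes "A \<in> carrier_mat p p" "Determinant.det A \<noteq> 0"
  shows "mat_inv (mat_inv A) = A"
proof -
  let ?K = "mat_inv A"
  note K = mat_inv[OF assms]
  have "Determinant.det ?K \<noteq> 0" using det_mat_inv[OF assms] assms by simp
  note L = mat_inv[OF K(1) this]
  have "mat_inv ?K = (A * ?K) * mat_inv ?K" using K(2) L by simp
  also have "\<dots> = A * (?K * mat_inv ?K)" using assms K L by (intro assoc_mult_mat) auto
  also have "\<dots> = A" using assms L by simp
  finally show ?thesis .
qed

lemma spd_mult_inv_vec:
  assumes "symmetric_pos_def p A" "v \<in> carrier_vec p"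
  shows "A *\<^sub>v (mat_inv A *\<^sub>v v) = v" "mat_inv A *\<^sub>v (A *\<^sub>v v) = v"
    "mat_inv A *\<^sub>v v \<in> carrier_vec p"
proof -
  note A = spdD[OF assms(1)]
  note K = mat_inv[OF A(1) spd_det_nonzero[OF assms(1)]]
  show "A *\<^sub>v (mat_inv A *\<^sub>v v) = v"
    using assoc_mult_mat_vec[OF A(1) K(1) assms(2)] K(2) assms(2) by simp
  show "mat_inv A *\<^sub>v (A *\<^sub>v v) = v"
    using assoc_mult_mat_vec[OF K(1) A(1) assms(2)] K(3) assms(2) by simp
  show "mat_inv A *\<^sub>v v \<in> carrier_vec p" using K(1) assms(2) by simp
qed

lemma symmetric_bilinear:
  assumes "A \<in> carrier_mat p p" "transpose_mat A = A" "x \<in> carrier_vec p" "y \<in> carrier_vec p"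
  shows "x \<bullet> (A *\<^sub>v y) = y \<bullet> (A *\<^sub>v (x::real vec))"
proof -
  have "x \<bullet> (A *\<^sub>v y) = (A *\<^sub>v x) \<bullet> y"
    using transpose_vec_mult_scalar[OF assms(1,4,3)] assms(2) by simp
  also have "\<dots> = y \<bullet> (A *\<^sub>v x)"
    using assms by (intro comm_scalar_prod) auto
  finally show ?thesis .
qed

text \<open>With \<open>K\<close> the inverse, \<open>K^T = K^T A K = (A K)^T K = K\<close>, and the
  form of \<open>K\<close> at \<open>v\<close> is the form of \<open>A\<close> at
  \<open>K v\<close>.\<close>

lemma spd_mat_inv:
  assumes "symmetric_pos_def p A"
  shows "symmetric_pos_def p (mat_inv A)"
proof -
  note A = spdD[OF assms]
  note K = mat_inv[OF A(1) spd_det_nonzero[OF assms]]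
  let ?K = "mat_inv A"
  have "transpose_mat ?K = transpose_mat ?K * (A * ?K)" using K by simp
  also have "\<dots> = (transpose_mat ?K * A) * ?K" using K A by (intro assoc_mult_mat[symmetric]) auto
  also have "transpose_mat ?K * A = transpose_mat (A * ?K)"
    using transpose_mult[OF A(1) K(1)] A(2) by simp
  also have "\<dots> = 1\<^sub>m p" using K(2) by simp
  finally have s: "transpose_mat ?K = ?K" using K by simp
  {
    fix v :: "real vec" assume v: "v \<in> carrier_vec p" "v \<noteq> 0\<^sub>v p"
    let ?w = "?K *\<^sub>v v"
    note w = spd_mult_inv_vec[OF assms v(1)]
    have "?w \<noteq> 0\<^sub>v p"
    proof
      assume "?w = 0\<^sub>v p"
      then have "A *\<^sub>v ?w = 0\<^sub>v p" using A(1) by (auto intro!: eq_vecI)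
      then show False using w v by simp
    qed
    then have "0 < ?w \<bullet> (A *\<^sub>v ?w)" using A(3) w(3) by blast
    also have "\<dots> = v \<bullet> ?w" using w v comm_scalar_prod[of ?w p v] by simp
    finally have "0 < v \<bullet> ?w" .
  }
  then show ?thesis using K s by (simp add: symmetric_pos_def_def)
qed

text \<open>Cauchy-Schwarz for the inner product of \<open>A\<close>, applied to \<open>x\<close> and \<open>mat_inv A *\<^sub>v u\<close>.\<close>

lemma spd_cauchy_schwarz:
  assumes A: "symmetric_pos_def p A" and u: "u \<in> carrier_vec p" and x: "x \<in> carrier_vec p"
  shows "(u \<bullet> x)\<^sup>2 \<le> (u \<bullet> (mat_inv A *\<^sub>v u)) * (x \<bullet> (A *\<^sub>v x))"
proof (cases "u = 0\<^sub>v p")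
  case True
  then show ?thesis using x spdD[OF spd_mat_inv[OF A]] by simp
next
  case False
  let ?w = "mat_inv A *\<^sub>v u"
  note w = spd_mult_inv_vec[OF A u]
  note Ac = spdD(1)[OF A]
  let ?s = "u \<bullet> ?w"
  have s: "0 < ?s" using spdD(3)[OF spd_mat_inv[OF A] u False] .
  \<comment> \<open>In the inner product of \<open>A\<close>, \<open>u \<bullet> x\<close> is the
    product of \<open>?w\<close> and \<open>x\<close>, and \<open>?s\<close> is the square of
    \<open>?w\<close>. So \<open>c\<close> times \<open>?w\<close> is the projection of
    \<open>x\<close>, and nonnegativity of the form at the remainder is the claim.\<close>
  define c where "c = u \<bullet> x / ?s"
  let ?z = "x - c \<cdot>\<^sub>v ?w"
  have "0 \<le> ?z \<bullet> (A *\<^sub>v ?z)" using x w by (intro spd_nonneg[OF A]) auto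
  also have "A *\<^sub>v ?z = A *\<^sub>v x - c \<cdot>\<^sub>v u"
    using x w u Ac by (simp add: mult_minus_distrib_mat_vec[of _ p p] mult_mat_vec[of _ p p])
  also have "?z \<bullet> (A *\<^sub>v x - c \<cdot>\<^sub>v u) =
     x \<bullet> (A *\<^sub>v x) - c * (x \<bullet> u) - c * (?w \<bullet> (A *\<^sub>v x)) + c * c * (?w \<bullet> u)"
  proof -
    have Ax: "A *\<^sub>v x \<in> carrier_vec p" using Ac x by simp
    have "?z \<bullet> (A *\<^sub>v x - c \<cdot>\<^sub>v u) = x \<bullet> (A *\<^sub>v x - c \<cdot>\<^sub>v u) - (c \<cdot>\<^sub>v ?w) \<bullet> (A *\<^sub>v x - c \<cdot>\<^sub>v u)"
      using x w(3) u Ax by (intro minus_scalar_prod_distrib) auto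
    also have "x \<bullet> (A *\<^sub>v x - c \<cdot>\<^sub>v u) = x \<bullet> (A *\<^sub>v x) - x \<bullet> (c \<cdot>\<^sub>v u)"
      using x u Ax by (intro scalar_prod_minus_distrib) auto
    also have "(c \<cdot>\<^sub>v ?w) \<bullet> (A *\<^sub>v x - c \<cdot>\<^sub>v u) = (c \<cdot>\<^sub>v ?w) \<bullet> (A *\<^sub>v x) - (c \<cdot>\<^sub>v ?w) \<bullet> (c \<cdot>\<^sub>v u)"
      using w(3) u Ax by (intro scalar_prod_minus_distrib) auto
    finally show ?thesis using x u w(3) Ax by (simp add: right_diff_distrib)
  qed
  also have "?w \<bullet> (A *\<^sub>v x) = x \<bullet> u"
    using symmetric_bilinear[OF Ac spdD(2)[OF A] _ x, of ?w] w x by simp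
  also have "x \<bullet> u = u \<bullet> x" using x u by (rule comm_scalar_prod)
  also have "?w \<bullet> u = ?s" using w(3) u by (rule comm_scalar_prod)
  finally have "0 \<le> x \<bullet> (A *\<^sub>v x) - (u \<bullet> x)\<^sup>2 / ?s"
    using s by (simp add: c_def field_simps power2_eq_square)
  then show ?thesis using s by (simp add: field_simps)
qed

text \<open>The matrix determinant lemma, with \<open>K\<close> the inverse of \<open>A\<close>. In
  \<open>four_block_mat A (- U) W 1\<close>, column elimination isolates \<open>A + U W\<close> and
  row elimination isolates the \<open>m\<close> by \<open>m\<close> Schur complement; both
  operations have determinant one.\<close>

lemma det_add_mult:
  fixes A :: "'a :: field mat"
  assumes A: "A \<in> carrier_mat n n" and K: "K \<in> carrier_mat n n" and AK: "K * A = 1\<^sub>m n"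
    and U: "U \<in> carrier_mat n m" and W: "W \<in> carrier_mat m n"
  shows "Determinant.det (A + U * W) = Determinant.det A * Determinant.det (1\<^sub>m m + W * (K * U))"
proof -
  let ?M = "four_block_mat A (- U) W (1\<^sub>m m)"
  have M: "?M \<in> carrier_mat (n + m) (n + m)" using A U W by auto
  let ?L = "four_block_mat (1\<^sub>m n) (0\<^sub>m n m) (- W) (1\<^sub>m m)"
  have L: "?L \<in> carrier_mat (n + m) (n + m)" using W by auto
  have "?M * ?L = four_block_mat (A * 1\<^sub>m n + (- U) * (- W)) (A * 0\<^sub>m n m + (- U) * 1\<^sub>m m)
     (W * 1\<^sub>m n + 1\<^sub>m m * (- W)) (W * 0\<^sub>m n m + 1\<^sub>m m * 1\<^sub>m m)"
    by (rule mult_four_block_mat[where ?nr1.0=n and ?n1.0=n and ?n2.0=m and ?nr2.0=m and ?nc1.0=n and ?nc2.0=m]) (use A U W in auto)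
  also have "\<dots> = four_block_mat (A + U * W) (- U) (0\<^sub>m m n) (1\<^sub>m m)"
    using A U W by (intro cong_four_block_mat) auto
  finally have eML: "?M * ?L = four_block_mat (A + U * W) (- U) (0\<^sub>m m n) (1\<^sub>m m)" .
  have "Determinant.det (?M * ?L) = Determinant.det (A + U * W)"
    using A U W unfolding eML by (subst det_four_block_mat_lower_left_zero[of _ n _ m]) auto
  moreover have "Determinant.det ?L = 1"
    using W by (subst det_four_block_mat_upper_right_zero[of _ n _ m]) auto
  ultimately have 1: "Determinant.det ?M = Determinant.det (A + U * W)"
    using det_mult[OF M L] by simp
  let ?N = "four_block_mat (1\<^sub>m n) (0\<^sub>m n m) (- (W * K)) (1\<^sub>m m)"
  have N: "?N \<in> carrier_mat (n + m) (n + m)" using W K by auto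
  have "?N * ?M = four_block_mat (1\<^sub>m n * A + 0\<^sub>m n m * W) (1\<^sub>m n * (- U) + 0\<^sub>m n m * 1\<^sub>m m)
     (- (W * K) * A + 1\<^sub>m m * W) (- (W * K) * (- U) + 1\<^sub>m m * 1\<^sub>m m)"
    by (rule mult_four_block_mat[where ?nr1.0=n and ?n1.0=n and ?n2.0=m and ?nr2.0=m and ?nc1.0=n and ?nc2.0=m]) (use A U W K in auto)
  also have "\<dots> = four_block_mat A (- U) (0\<^sub>m m n) (1\<^sub>m m + W * (K * U))"
  proof (intro cong_four_block_mat)
    have "- (W * K) * A = - (W * (K * A))"
      using W K A by (simp add: assoc_mult_mat[of _ m n _ n _ n])
    then show "- (W * K) * A + 1\<^sub>m m * W = 0\<^sub>m m n" using W AK by auto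
    have "- (W * K) * (- U) = W * (K * U)"
      using W K U by (simp add: assoc_mult_mat[of _ m n _ n _ m])
    then show "- (W * K) * (- U) + 1\<^sub>m m * 1\<^sub>m m = 1\<^sub>m m + W * (K * U)" 
      using W K U by (simp add: comm_add_mat[of _ m m])
  qed (use A U W in auto)
  finally have NM: "?N * ?M = four_block_mat A (- U) (0\<^sub>m m n) (1\<^sub>m m + W * (K * U))" .
  have "Determinant.det (?N * ?M) = Determinant.det A * Determinant.det (1\<^sub>m m + W * (K * U))"
    using A U W K unfolding NM by (subst det_four_block_mat_lower_left_zero[of _ n _ m]) auto
  moreover have "Determinant.det ?N = 1"
    using W K by (subst det_four_block_mat_upper_right_zero[of _ n _ m]) auto
  ultimately show ?thesis using det_mult[OF N M] 1 by simp
qed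

lemma det_2_by_2:
  fixes A :: "'a :: idom mat"
  assumes A: "A \<in> carrier_mat 2 2"
  shows "Determinant.det A = A $$ (0,0) * A $$ (1,1) - A $$ (0,1) * A $$ (1,0)"
proof -
  let ?m = "\<lambda>c. mat 1 1 (\<lambda>_. c)"
  have 1: "A = four_block_mat (?m (A $$ (0,0))) (?m (A $$ (0,1))) (?m (A $$ (1,0))) (?m (A $$ (1,1)))"
    (is "_ = ?F")
  proof (rule eq_matI)
    fix i j assume "i < dim_row ?F" "j < dim_col ?F"
    then have "i = 0 \<or> i = 1" "j = 0 \<or> j = 1" by auto
    then show "A $$ (i, j) = ?F $$ (i, j)" by auto
  qed (use A in auto)
  have mm: "?m a * ?m b = ?m (a * b)" for a b :: 'a
    by (rule eq_matI) (simp_all add: scalar_prod_def)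
  have ms: "?m a - ?m b = ?m (a - b)" for a b :: 'a
    by (rule eq_matI) simp_all
  have md: "Determinant.det (?m a) = a" for a :: 'a
    using det_single[of "?m a"] by simp
  have 2: "Determinant.det ?F = Determinant.det (?m (A $$ (0,0)) * ?m (A $$ (1,1)) - ?m (A $$ (0,1)) * ?m (A $$ (1,0)))"
    by (rule det_four_block_mat[of _ 1]) (simp_all only: mm mat_carrier mult.commute)
  show ?thesis using 2 unfolding 1[symmetric] mm ms md .
qed

text \<open>Stands for \<open>A + c (u w^T + w u^T)\<close>. Tilting a Gaussian density by an entry
  of the residual and replacing one row and column of a precision matrix are both of this kind, so
  one determinant formula serves the upper and the lower bound.\<close>

definition sym_update :: "nat \<Rightarrow> real mat \<Rightarrow> real \<Rightarrow> real vec \<Rightarrow> real vec \<Rightarrow> real mat" where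
  "sym_update p A c u w = mat p p (\<lambda>(i, j). A $$ (i, j) + c * (u $ i * w $ j + w $ i * u $ j))"

lemma sym_update_carrier [simp]: "sym_update p A c u w \<in> carrier_mat p p"
  by (simp add: sym_update_def)

lemma transpose_sym_update:
  assumes "A \<in> carrier_mat p p" "transpose_mat A = A"
  shows "transpose_mat (sym_update p A c u w) = sym_update p A c u w"
proof -
  have "A $$ (j, i) = A $$ (i, j)" if "i < p" "j < p" for i j
    using assms that by (metis carrier_matD index_transpose_mat(1))
  then show ?thesis by (intro eq_matI) (auto simp: sym_update_def algebra_simps)
qed

lemma quadratic_form_sum:
  fixes A :: "real mat"
  assumes "A \<in> carrier_mat p p" "v \<in> carrier_vec p" "x \<in> carrier_vec p"
  shows "x \<bullet> (A *\<^sub>v v) = (\<Sum>i<p. \<Sum>j<p. A $$ (i, j) * x $ i * v $ j)"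
  using assms
  by (auto simp: scalar_prod_def sum_distrib_left atLeast0LessThan mult_ac intro!: sum.cong)

lemma quadratic_form_sym_update:
  assumes "A \<in> carrier_mat p p" "u \<in> carrier_vec p" "w \<in> carrier_vec p" "x \<in> carrier_vec p"
  shows "x \<bullet> (sym_update p A c u w *\<^sub>v x) = x \<bullet> (A *\<^sub>v x) + 2 * c * (u \<bullet> x) * (w \<bullet> x)"
proof -
  have *: "(\<Sum>i<p. \<Sum>j<p. a $ i * b $ j * x $ i * x $ j) = (a \<bullet> x) * (b \<bullet> x)" for a b :: "real vec"
    using assms(4) by (simp add: scalar_prod_def sum_product atLeast0LessThan mult_ac)
  have "x \<bullet> (sym_update p A c u w *\<^sub>v x) = 
     (\<Sum>i<p. \<Sum>j<p. A $$ (i, j) * x $ i * x $ j) + c * ((\<Sum>i<p. \<Sum>j<p. (u $ i * w $ j) * x $ i * x $ j) + (\<Sum>i<p. \<Sum>j<p. (w $ i * u $ j) * x $ i * x $ j))"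
    using assms unfolding quadratic_form_sum[OF sym_update_carrier assms(4,4)] sum_distrib_left sum.distrib[symmetric]
    by (auto simp: sym_update_def algebra_simps intro!: sum.cong)
  also have "\<dots> = x \<bullet> (A *\<^sub>v x) + 2 * c * (u \<bullet> x) * (w \<bullet> x)"
    using assms by (simp add: * quadratic_form_sum)
  finally show ?thesis .
qed

text \<open>The update is a product \<open>U W\<close>, where \<open>U\<close> has the columns
  \<open>u\<close>, \<open>w\<close> and \<open>W\<close> has the rows \<open>c w\<close>,
  \<open>c u\<close>; the matrix determinant lemma leaves a 2 by 2 determinant.\<close>

lemma det_sym_update:
  assumes A: "symmetric_pos_def p A" and u: "u \<in> carrier_vec p" and w: "w \<in> carrier_vec p"
  shows "Determinant.det (sym_update p A c u w) = Determinant.det A *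
    ((1 + c * (u \<bullet> (mat_inv A *\<^sub>v w)))\<^sup>2 - c\<^sup>2 * (u \<bullet> (mat_inv A *\<^sub>v u)) * (w \<bullet> (mat_inv A *\<^sub>v w)))"
proof -
  let ?K = "mat_inv A"
  note Ac = spdD[OF A]
  note K = mat_inv[OF Ac(1) spd_det_nonzero[OF A]]
  define U where "U = mat p 2 (\<lambda>(i, j). if j = 0 then u $ i else w $ i)"
  define W where "W = mat 2 p (\<lambda>(i, j). c * (if i = 0 then w $ j else u $ j))"
  have U: "U \<in> carrier_mat p 2" and W: "W \<in> carrier_mat 2 p" by (auto simp: U_def W_def)
  have 1: "sym_update p A c u w = A + U * W"
    using Ac(1) by (intro eq_matI) (auto simp: sym_update_def U_def W_def scalar_prod_def numeral_2_eq_2 algebra_simps)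
  have KU: "W * (?K * U) \<in> carrier_mat 2 2" using K U W by auto
  have colU: "col U 0 = u" "col U (Suc 0) = w" using u w by (auto simp: U_def)
  have rowW: "row W 0 = c \<cdot>\<^sub>v w" "row W (Suc 0) = c \<cdot>\<^sub>v u" using u w by (auto simp: W_def)
  have e: "(W * (?K * U)) $$ (i, j) = row W i \<bullet> (?K *\<^sub>v col U j)" if "i < 2" "j < 2" for i j
    using that K U W by (subst index_mult_mat(1)) (auto simp: mult_mat_vec_def col_mult2[of _ p p])
  have s: "w \<bullet> (?K *\<^sub>v u) = u \<bullet> (?K *\<^sub>v w)"
    using symmetric_bilinear[OF K(1) spdD(2)[OF spd_mat_inv[OF A]] w u] .
  have cv: "?K *\<^sub>v u \<in> carrier_vec p" "?K *\<^sub>v w \<in> carrier_vec p" using K u w by auto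
  let ?M = "1\<^sub>m 2 + W * (?K * U)"
  have "?M $$ (i, j) = (if i = j then 1 else 0) + row W i \<bullet> (?K *\<^sub>v col U j)" if "i < 2" "j < 2" for i j
  proof -
    have "?M $$ (i, j) = 1\<^sub>m 2 $$ (i, j) + (W * (?K * U)) $$ (i, j)"
      using KU that by (intro index_add_mat(1)) auto
    then show ?thesis unfolding e[OF that] using that by simp
  qed
  from this[of 0 0] this[of 0 1] this[of 1 0] this[of 1 1]
  have "?M $$ (0, 0) = 1 + c * (u \<bullet> (?K *\<^sub>v w))" "?M $$ (0, 1) = c * (w \<bullet> (?K *\<^sub>v w))"
     "?M $$ (1, 0) = c * (u \<bullet> (?K *\<^sub>v u))" "?M $$ (1, 1) = 1 + c * (u \<bullet> (?K *\<^sub>v w))"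
    using u w cv s by (simp_all add: colU rowW)
  then have "Determinant.det ?M = 
    (1 + c * (u \<bullet> (?K *\<^sub>v w)))\<^sup>2 - c\<^sup>2 * (u \<bullet> (?K *\<^sub>v u)) * (w \<bullet> (?K *\<^sub>v w))"
    using KU det_2_by_2[of ?M] by (simp only: add_carrier_mat) (simp add: power2_eq_square)
  then show ?thesis using det_add_mult[OF Ac(1) K(1) K(3) U W] 1 by simp
qed

lemma abs_less_of_power2_less:
  fixes t q :: real
  assumes "t\<^sup>2 < q\<^sup>2" "0 < q"
  shows "\<bar>t\<bar> < q"
  using assms power2_less_imp_less[of "\<bar>t\<bar>" q] by simp

text \<open>Cauchy-Schwarz in the inner product of \<open>A\<close> bounds the square of the added
  form \<open>2 c (u \<bullet> x) (w \<bullet> x)\<close> by the left side of the hypothesis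
  \<open>c\<close> times the square of the form of \<open>A\<close>, so the update cannot cancel
  that form.\<close>

lemma spd_sym_update:
  assumes A: "symmetric_pos_def p A" and u: "u \<in> carrier_vec p" and w: "w \<in> carrier_vec p"
    and c: "4 * c\<^sup>2 * ((u \<bullet> (mat_inv A *\<^sub>v u)) * (w \<bullet> (mat_inv A *\<^sub>v w))) < 1"
  shows "symmetric_pos_def p (sym_update p A c u w)"
proof -
  note Ac = spdD[OF A]
  {
    fix x :: "real vec" assume x: "x \<in> carrier_vec p" "x \<noteq> 0\<^sub>v p"
    let ?q = "x \<bullet> (A *\<^sub>v x)"
    have q: "0 < ?q" using Ac(3) x by simp
    have a: "(u \<bullet> x)\<^sup>2 \<le> (u \<bullet> (mat_inv A *\<^sub>v u)) * ?q" using spd_cauchy_schwarz[OF A u x(1)] .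
    have b: "(w \<bullet> x)\<^sup>2 \<le> (w \<bullet> (mat_inv A *\<^sub>v w)) * ?q" using spd_cauchy_schwarz[OF A w x(1)] .
    have "(2 * c * (u \<bullet> x) * (w \<bullet> x))\<^sup>2 = 4 * c\<^sup>2 * ((u \<bullet> x)\<^sup>2 * (w \<bullet> x)\<^sup>2)"
      by (simp add: power_mult_distrib)
    also have "\<dots> \<le> 4 * c\<^sup>2 * (((u \<bullet> (mat_inv A *\<^sub>v u)) * ?q) * ((w \<bullet> (mat_inv A *\<^sub>v w)) * ?q))"
      using a b q spd_nonneg[OF spd_mat_inv[OF A] u] by (intro mult_left_mono mult_mono) auto
    also have "\<dots> = 4 * c\<^sup>2 * ((u \<bullet> (mat_inv A *\<^sub>v u)) * (w \<bullet> (mat_inv A *\<^sub>v w))) * ?q\<^sup>2"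
      by (simp add: power2_eq_square)
    also have "\<dots> < 1 * ?q\<^sup>2" using c q by (intro mult_strict_right_mono) auto
    finally have "(2 * c * (u \<bullet> x) * (w \<bullet> x))\<^sup>2 < ?q\<^sup>2" by simp
    from abs_less_of_power2_less[OF this q] have "0 < x \<bullet> (sym_update p A c u w *\<^sub>v x)"
      unfolding quadratic_form_sym_update[OF Ac(1) u w x(1)] by linarith
  }
  then show ?thesis using transpose_sym_update[OF Ac(1,2)] by (auto simp: symmetric_pos_def_def)
qed

text \<open>Column operations clear the last row. The recursion is the one that a Gaussian integral
  obeys when its last variable is integrated out.\<close>

lemma det_schur_last:
  fixes A :: "'a :: field mat"
  assumes A: "A \<in> carrier_mat (Suc n) (Suc n)" and a: "A $$ (n, n) \<noteq> 0"
  shows "Determinant.det A = A $$ (n, n) *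
    Determinant.det (mat n n (\<lambda>(i, j). A $$ (i, j) - A $$ (i, n) * A $$ (n, j) / A $$ (n, n)))"
proof -
  let ?a = "A $$ (n, n)"
  let ?A1 = "mat n n (\<lambda>(i, j). A $$ (i, j))" and ?A2 = "mat n 1 (\<lambda>(i, j). A $$ (i, n))"
  let ?A3 = "mat 1 n (\<lambda>(i, j). A $$ (n, j))" and ?A4 = "mat 1 1 (\<lambda>(i, j). ?a)"
  let ?L3 = "mat 1 n (\<lambda>(i, j). - A $$ (n, j) / ?a)"
  let ?S = "mat n n (\<lambda>(i, j). A $$ (i, j) - A $$ (i, n) * A $$ (n, j) / ?a)"
  let ?L = "four_block_mat (1\<^sub>m n) (0\<^sub>m n 1) ?L3 (1\<^sub>m 1)"
  have "?L \<in> carrier_mat (n + 1) (n + 1)" by (rule four_block_carrier_mat) auto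
  then have L: "?L \<in> carrier_mat (Suc n) (Suc n)" by simp
  have "A = four_block_mat ?A1 ?A2 ?A3 ?A4"
    using A by (intro eq_matI) (auto simp: less_Suc_eq)
  then have "A * ?L = four_block_mat ?A1 ?A2 ?A3 ?A4 * ?L" by simp
  also have "\<dots> = four_block_mat (?A1 * 1\<^sub>m n + ?A2 * ?L3) (?A1 * 0\<^sub>m n 1 + ?A2 * 1\<^sub>m 1)
     (?A3 * 1\<^sub>m n + ?A4 * ?L3) (?A3 * 0\<^sub>m n 1 + ?A4 * 1\<^sub>m 1)"
    by (rule mult_four_block_mat) auto
  also have "\<dots> = four_block_mat ?S ?A2 (0\<^sub>m 1 n) ?A4"
    using a by (intro cong_four_block_mat) (auto intro!: eq_matI simp: scalar_prod_def)
  finally have "Determinant.det (A * ?L) = Determinant.det ?S * Determinant.det ?A4"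
    by (simp add: det_four_block_mat_lower_left_zero[of _ n _ 1])
  moreover have "Determinant.det ?L = 1"
    by (subst det_four_block_mat_upper_right_zero[of _ n _ 1]) auto
  moreover have "Determinant.det ?A4 = ?a" by (subst det_single) auto
  ultimately have "Determinant.det A = Determinant.det ?S * ?a"
    using det_mult[OF A L] by (simp only: mult_1_right)
  then show ?thesis by (simp only: mult.commute)
qed

section \<open>Gaussian densities\<close>

text \<open>Acts on functions, like the points of the product measure, so that single coordinates
  can be split off and updated.\<close>

definition gen_quad :: "nat \<Rightarrow> (nat \<Rightarrow> nat \<Rightarrow> real) \<Rightarrow> (nat \<Rightarrow> real) \<Rightarrow> real" where
  "gen_quad p a d = (\<Sum>i<p. \<Sum>j<p. a i j * d i * d j)"

lemma gen_quad_cong: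
  "(\<And>i. i < p \<Longrightarrow> d i = d' i) \<Longrightarrow> gen_quad p a d = gen_quad p a d'"
  by (auto simp: gen_quad_def intro!: sum.cong)

text \<open>Completes the square in the last coordinate; the remaining coefficients form the Schur
  complement of \<open>a p p\<close>.\<close>

lemma gen_quad_Suc:
  assumes "\<And>i. i < p \<Longrightarrow> a p i = a i p" and "a p p \<noteq> 0"
  shows "gen_quad (Suc p) a d =
    gen_quad p (\<lambda>i j. a i j - a i p * a p j / a p p) d +
    a p p * (d p + (\<Sum>i<p. a i p * d i) / a p p)\<^sup>2"
proof -
  let ?c = "\<Sum>i<p. a i p * d i"
  have c: "(\<Sum>i<p. a p i * d i) = ?c" using assms(1) by (auto intro!: sum.cong)
  have 1: "gen_quad (Suc p) a d = (\<Sum>i<p. \<Sum>j<p. a i j * d i * d j) + d p * ?c + d p * (\<Sum>j<p. a p j * d j) + a p p * d p * d p"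
    by (simp add: gen_quad_def sum.distrib sum_distrib_left algebra_simps)
  have "(\<Sum>i<p. \<Sum>j<p. (a i p * a p j / a p p) * d i * d j) = (\<Sum>i<p. a i p * d i) * (\<Sum>j<p. a p j * d j) / a p p"
    by (simp add: sum_product sum_divide_distrib algebra_simps)
  then have 2: "gen_quad p (\<lambda>i j. a i j - a i p * a p j / a p p) d = (\<Sum>i<p. \<Sum>j<p. a i j * d i * d j) - ?c * ?c / a p p"
    by (simp add: gen_quad_def left_diff_distrib sum_subtractf c)
  show ?thesis unfolding 1 2 c using assms(2) by (simp add: power2_eq_square field_simps)
qed

lemma nn_integral_gaussian_shift:
  fixes a c :: real
  assumes "0 < a"
  shows "(\<integral>\<^sup>+y. ennreal (exp (- (1/2) * (a * (y - c)\<^sup>2))) \<partial>lborel) = ennreal (sqrt (2 * pi / a))"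
proof -
  define s where "s = 1 / sqrt a"
  have s: "0 < s" "s\<^sup>2 = 1 / a" using assms by (auto simp: s_def power_divide)
  have "exp (- (1/2) * (a * (y - c)\<^sup>2)) = sqrt (2 * pi / a) * normal_density c s y" for y
  proof -
    have "- (y - c)\<^sup>2 / (2 * s\<^sup>2) = - (1/2) * (a * (y - c)\<^sup>2)" using assms by (simp add: s)
    moreover have "sqrt (2 * pi / a) * (1 / sqrt (2 * pi * s\<^sup>2)) = 1" using assms by (simp add: s)
    ultimately show ?thesis unfolding normal_density_def by (metis mult.assoc mult_1)
  qed
  then have "(\<integral>\<^sup>+y. ennreal (exp (- (1/2) * (a * (y - c)\<^sup>2))) \<partial>lborel) =
     (\<integral>\<^sup>+y. ennreal (sqrt (2 * pi / a)) * ennreal (normal_density c s y) \<partial>lborel)"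
    using assms by (simp add: ennreal_mult)
  also have "\<dots> = ennreal (sqrt (2 * pi / a)) * (\<integral>\<^sup>+y. ennreal (normal_density c s y) \<partial>lborel)"
    by (rule nn_integral_cmult) simp
  also have "(\<integral>\<^sup>+y. ennreal (normal_density c s y) \<partial>lborel) = emeasure (density lborel (normal_density c s)) UNIV"
    by (simp add: emeasure_density)
  also have "\<dots> = 1"
    using prob_space.emeasure_space_1[OF prob_space_normal_density[OF s(1), of c]] by simp
  finally show ?thesis by simp
qed

text \<open>Induction on the dimension, with \<open>a\<close> arbitrary because the step passes to
  the Schur complement. Fubini and a completed square give the factor
  \<open>sqrt (2 * pi / a p p)\<close>, in agreement with \<open>det_schur_last\<close>. Positivity
  of the determinant is carried along.\<close>

lemma nn_integral_gaussian_gen_quad: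
  fixes a :: "nat \<Rightarrow> nat \<Rightarrow> real"
  assumes "\<And>i j. i < p \<Longrightarrow> j < p \<Longrightarrow> a i j = a j i"
    and "\<And>d. (\<exists>i<p. d i \<noteq> 0) \<Longrightarrow> 0 < gen_quad p a d"
  shows "0 < Determinant.det (mat p p (\<lambda>(i, j). a i j)) \<and>
    (\<integral>\<^sup>+x. ennreal (exp (- (1/2) * gen_quad p a (\<lambda>i. x i - m i))) \<partial>(\<Pi>\<^sub>M i\<in>{..<p}. lborel)) =
     ennreal (sqrt ((2 * pi) ^ p / Determinant.det (mat p p (\<lambda>(i, j). a i j))))"
  using assms
proof (induction p arbitrary: a)
  case 0
  have "Determinant.det (mat 0 0 (\<lambda>(i, j). a i j)) = 1" by (rule det_dim_zero) simp
  then show ?case by (simp add: gen_quad_def PiM_empty nn_integral_count_space_finite)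
next
  case (Suc p)
  interpret product_sigma_finite "\<lambda>_::nat. lborel :: real measure" by standard
  let ?s = "\<lambda>i j. a i j - a i p * a p j / a p p"
  let ?c = "\<lambda>d. \<Sum>i<p. a i p * d i"
  let ?dA = "Determinant.det (mat (Suc p) (Suc p) (\<lambda>(i, j). a i j))"
  let ?dS = "Determinant.det (mat p p (\<lambda>(i, j). ?s i j))"
  let ?e = "\<lambda>i. if i = p then 1 else 0 :: real"
  have e: "0 < gen_quad (Suc p) a ?e"
    by (rule Suc.prems(2)) auto
  have "(\<Sum>i<p. \<Sum>j<Suc p. a i j * ?e i * ?e j) = 0" by (intro sum.neutral ballI) auto
  moreover have "(\<Sum>j<p. a p j * ?e p * ?e j) = 0" by (intro sum.neutral ballI) auto
  ultimately have "gen_quad (Suc p) a ?e = a p p"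
    unfolding gen_quad_def sum.lessThan_Suc[of _ p] by simp
  then have app: "0 < a p p" using e by simp
  have split: "gen_quad (Suc p) a d = gen_quad p ?s d + a p p * (d p + ?c d / a p p)\<^sup>2" for d
    using app Suc.prems(1) by (intro gen_quad_Suc) auto
  have pos: "0 < gen_quad p ?s d" if nz: "\<exists>i<p. d i \<noteq> 0" for d
  proof -
    \<comment> \<open>The last coordinate makes the completed square vanish, so the whole form at
      \<open>?d\<close> equals the form of the Schur complement at \<open>d\<close>.\<close>
    let ?d = "d(p := - ?c d / a p p)"
    have "0 < gen_quad (Suc p) a ?d"
    proof (rule Suc.prems(2))
      obtain i where "i < p" "d i \<noteq> 0" using nz by blast
      then show "\<exists>i<Suc p. ?d i \<noteq> 0" by (intro exI[of _ i]) auto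
    qed
    also have "gen_quad (Suc p) a ?d = gen_quad p ?s ?d" unfolding split using app by simp
    also have "\<dots> = gen_quad p ?s d" by (rule gen_quad_cong) auto
    finally show ?thesis .
  qed
  have "0 < ?dS \<and> (\<integral>\<^sup>+x. ennreal (exp (- (1/2) * gen_quad p ?s (\<lambda>i. x i - m i))) \<partial>(\<Pi>\<^sub>M i\<in>{..<p}. lborel)) =
     ennreal (sqrt ((2 * pi) ^ p / ?dS))"
    using pos by (intro Suc.IH) (use Suc.prems(1) in \<open>auto simp: mult.commute\<close>)
  then have dS: "0 < ?dS" and IH: "(\<integral>\<^sup>+x. ennreal (exp (- (1/2) * gen_quad p ?s (\<lambda>i. x i - m i))) \<partial>(\<Pi>\<^sub>M i\<in>{..<p}. lborel)) =
     ennreal (sqrt ((2 * pi) ^ p / ?dS))" by auto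
  have "mat p p (\<lambda>(i, j). mat (Suc p) (Suc p) (\<lambda>(i, j). a i j) $$ (i, j) -
     mat (Suc p) (Suc p) (\<lambda>(i, j). a i j) $$ (i, p) * mat (Suc p) (Suc p) (\<lambda>(i, j). a i j) $$ (p, j) /
     mat (Suc p) (Suc p) (\<lambda>(i, j). a i j) $$ (p, p)) = mat p p (\<lambda>(i, j). ?s i j)"
    by (rule eq_matI) auto
  then have det: "?dA = a p p * ?dS"
    using det_schur_last[of "mat (Suc p) (Suc p) (\<lambda>(i, j). a i j)" p] app by simp
  have "(\<integral>\<^sup>+x. ennreal (exp (- (1/2) * gen_quad (Suc p) a (\<lambda>i. x i - m i))) \<partial>(\<Pi>\<^sub>M i\<in>{..<Suc p}. lborel)) =
    (\<integral>\<^sup>+x. (\<integral>\<^sup>+y. ennreal (exp (- (1/2) * gen_quad (Suc p) a (\<lambda>i. (x(p := y)) i - m i))) \<partial>lborel) \<partial>(\<Pi>\<^sub>M i\<in>{..<p}. lborel))"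
    unfolding lessThan_Suc by (rule product_nn_integral_insert) (simp_all add: gen_quad_def)
  also have "\<dots> = (\<integral>\<^sup>+x. ennreal (exp (- (1/2) * gen_quad p ?s (\<lambda>i. x i - m i))) * ennreal (sqrt (2 * pi / a p p)) \<partial>(\<Pi>\<^sub>M i\<in>{..<p}. lborel))"
  proof (rule nn_integral_cong)
    fix x :: "nat \<Rightarrow> real"
    let ?q = "gen_quad p ?s (\<lambda>i. x i - m i)" and ?k = "?c (\<lambda>i. x i - m i) / a p p"
    have "gen_quad (Suc p) a (\<lambda>i. (x(p := y)) i - m i) = ?q + a p p * (y - (m p - ?k))\<^sup>2" for y
    proof -
      have "gen_quad p ?s (\<lambda>i. (x(p := y)) i - m i) = ?q" by (rule gen_quad_cong) auto
      moreover have "?c (\<lambda>i. (x(p := y)) i - m i) = ?c (\<lambda>i. x i - m i)" by (rule sum.cong) auto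
      ultimately show ?thesis unfolding split by (simp add: algebra_simps)
    qed
    then have "(\<integral>\<^sup>+y. ennreal (exp (- (1/2) * gen_quad (Suc p) a (\<lambda>i. (x(p := y)) i - m i))) \<partial>lborel) =
      (\<integral>\<^sup>+y. ennreal (exp (- (1/2) * ?q)) * ennreal (exp (- (1/2) * (a p p * (y - (m p - ?k))\<^sup>2))) \<partial>lborel)"
      by (simp add: ennreal_mult[symmetric] exp_add[symmetric] algebra_simps)
    also have "\<dots> = ennreal (exp (- (1/2) * ?q)) * ennreal (sqrt (2 * pi / a p p))"
      using nn_integral_gaussian_shift[OF app, of "m p - ?k"] by (subst nn_integral_cmult) auto
    finally show "(\<integral>\<^sup>+y. ennreal (exp (- (1/2) * gen_quad (Suc p) a (\<lambda>i. (x(p := y)) i - m i))) \<partial>lborel) =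
      ennreal (exp (- (1/2) * ?q)) * ennreal (sqrt (2 * pi / a p p))" .
  qed
  also have "\<dots> = ennreal (sqrt ((2 * pi) ^ p / ?dS)) * ennreal (sqrt (2 * pi / a p p))"
    unfolding IH[symmetric] by (rule nn_integral_multc) (simp add: gen_quad_def)
  also have "\<dots> = ennreal (sqrt ((2 * pi) ^ Suc p / ?dA))"
    using dS app by (simp add: ennreal_mult[symmetric] real_sqrt_mult[symmetric] det field_simps)
  finally show ?case using det dS app by simp
qed

section \<open>Gaussian densities indexed by the precision matrix\<close>

lemma quad_vec:
  fixes A :: "real mat"
  assumes "A \<in> carrier_mat p p" "\<mu> \<in> carrier_vec p"
  shows "(vec p x - \<mu>) \<bullet> (A *\<^sub>v (vec p x - \<mu>)) = gen_quad p (\<lambda>i j. A $$ (i, j)) (\<lambda>i. x i - \<mu> $ i)"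
proof -
  have "vec p x - \<mu> \<in> carrier_vec p" using assms by auto
  from quadratic_form_sum[OF assms(1) this this] show ?thesis
    using assms by (auto simp: gen_quad_def intro!: sum.cong)
qed

lemma spd_gen_quad:
  assumes A: "symmetric_pos_def p A"
  shows "mat p p (\<lambda>(i, j). A $$ (i, j)) = A" "\<And>i j. i < p \<Longrightarrow> j < p \<Longrightarrow> A $$ (i, j) = A $$ (j, i)"
    "\<And>d. (\<exists>i<p. d i \<noteq> 0) \<Longrightarrow> 0 < gen_quad p (\<lambda>i j. A $$ (i, j)) d"
proof -
  note Ac = spdD[OF A]
  show "mat p p (\<lambda>(i, j). A $$ (i, j)) = A" using Ac(1) by (intro eq_matI) auto
  show "A $$ (i, j) = A $$ (j, i)" if "i < p" "j < p" for i j
    using Ac(1,2) that by (metis carrier_matD index_transpose_mat(1))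
  fix d :: "nat \<Rightarrow> real" assume "\<exists>i<p. d i \<noteq> 0"
  then have "vec p d \<noteq> 0\<^sub>v p" by (metis index_vec index_zero_vec(1))
  then have "0 < vec p d \<bullet> (A *\<^sub>v vec p d)" using Ac(3) by simp
  then show "0 < gen_quad p (\<lambda>i j. A $$ (i, j)) d"
    unfolding quadratic_form_sum[OF Ac(1) vec_carrier vec_carrier] gen_quad_def by simp
qed

lemma spd_det_pos:
  assumes "symmetric_pos_def p A"
  shows "0 < Determinant.det A"
  using nn_integral_gaussian_gen_quad[of p "\<lambda>i j. A $$ (i, j)"] spd_gen_quad[OF assms] by simp

lemma nn_integral_gaussian_spd:
  assumes A: "symmetric_pos_def p A" and m: "\<mu> \<in> carrier_vec p"
  shows "(\<integral>\<^sup>+x. ennreal (exp (- (1/2) * ((vec p x - \<mu>) \<bullet> (A *\<^sub>v (vec p x - \<mu>))))) \<partial>(\<Pi>\<^sub>M i\<in>{..<p}. lborel)) =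
     ennreal (sqrt ((2 * pi) ^ p / Determinant.det A))"
  unfolding quad_vec[OF spdD(1)[OF A] m]
  using nn_integral_gaussian_gen_quad[of p "\<lambda>i j. A $$ (i, j)" "\<lambda>i. \<mu> $ i"] spd_gen_quad[OF A] by simp

text \<open>Parametrised by the precision matrix, which enters the exponent linearly: products and
  quotients of densities correspond to sums and differences of matrices.\<close>

definition gauss_density :: "nat \<Rightarrow> real vec \<Rightarrow> real mat \<Rightarrow> (nat \<Rightarrow> real) \<Rightarrow> real" where
  "gauss_density p \<mu> A x =
    sqrt (Determinant.det A / (2 * pi) ^ p) * exp (- (1/2) * ((vec p x - \<mu>) \<bullet> (A *\<^sub>v (vec p x - \<mu>))))"

lemma gauss_density_pos: "symmetric_pos_def p A \<Longrightarrow> 0 < gauss_density p \<mu> A x"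
  using spd_det_pos[of p A] by (simp add: gauss_density_def)

lemma measurable_gauss_density [measurable]:
  assumes "A \<in> carrier_mat p p" "\<mu> \<in> carrier_vec p"
  shows "gauss_density p \<mu> A \<in> borel_measurable (\<Pi>\<^sub>M i\<in>{..<p}. lborel)"
  unfolding gauss_density_def quad_vec[OF assms] gen_quad_def by measurable

lemma mvn_mat_inv:
  assumes A: "symmetric_pos_def p A"
  shows "mvn p \<mu> (mat_inv A) = density (\<Pi>\<^sub>M i\<in>{..<p}. lborel) (\<lambda>x. ennreal (gauss_density p \<mu> A x))"
proof -
  note Ac = spdD(1)[OF A] and d = spd_det_nonzero[OF A]
  have "mvn_density p \<mu> (mat_inv A) = gauss_density p \<mu> A"
    using spd_det_pos[OF A]
    by (auto simp: mvn_density_def gauss_density_def mat_inv_mat_inv[OF Ac d] det_mat_inv[OF Ac d] real_sqrt_divide real_sqrt_mult field_simps)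
  then show ?thesis by (simp add: mvn_def)
qed

text \<open>Normalisation, exponential moments and chi-square integrals all lead to an integrand of
  this form, each with its own \<open>B\<close> and \<open>c\<close>.\<close>

lemma nn_integral_gauss_ratio:
  assumes A: "symmetric_pos_def p A" and B: "symmetric_pos_def p B" and m: "\<mu> \<in> carrier_vec p"
    and c: "0 \<le> c"
  shows "(\<integral>\<^sup>+x. ennreal (c / sqrt ((2 * pi) ^ p) * exp (- (1/2) * ((vec p x - \<mu>) \<bullet> (B *\<^sub>v (vec p x - \<mu>))))) \<partial>(\<Pi>\<^sub>M i\<in>{..<p}. lborel)) =
     ennreal (c / sqrt (Determinant.det B))"
proof -
  have "(\<integral>\<^sup>+x. ennreal (c / sqrt ((2 * pi) ^ p) * exp (- (1/2) * ((vec p x - \<mu>) \<bullet> (B *\<^sub>v (vec p x - \<mu>))))) \<partial>(\<Pi>\<^sub>M i\<in>{..<p}. lborel)) =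
    (\<integral>\<^sup>+x. ennreal (c / sqrt ((2 * pi) ^ p)) * ennreal (exp (- (1/2) * ((vec p x - \<mu>) \<bullet> (B *\<^sub>v (vec p x - \<mu>))))) \<partial>(\<Pi>\<^sub>M i\<in>{..<p}. lborel))"
    using c by (intro nn_integral_cong ennreal_mult) auto
  also have "\<dots> = ennreal (c / sqrt ((2 * pi) ^ p)) * ennreal (sqrt ((2 * pi) ^ p / Determinant.det B))"
    unfolding nn_integral_gaussian_spd[OF B m, symmetric]
    by (rule nn_integral_cmult) (use quad_vec[OF spdD(1)[OF B] m] in \<open>simp add: gen_quad_def\<close>)
  also have "\<dots> = ennreal (c / sqrt (Determinant.det B))"
    using c spd_det_pos[OF B] by (simp add: ennreal_mult[symmetric] real_sqrt_divide)
  finally show ?thesis .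
qed

lemma nn_integral_gauss_density:
  assumes A: "symmetric_pos_def p A" and m: "\<mu> \<in> carrier_vec p"
  shows "(\<integral>\<^sup>+x. ennreal (gauss_density p \<mu> A x) \<partial>(\<Pi>\<^sub>M i\<in>{..<p}. lborel)) = 1"
  using nn_integral_gauss_ratio[OF A A m, of "sqrt (Determinant.det A)"] spd_det_pos[OF A]
  by (simp add: gauss_density_def real_sqrt_divide)

lemma prob_space_mvn:
  assumes "symmetric_pos_def p A" "\<mu> \<in> carrier_vec p"
  shows "prob_space (mvn p \<mu> (mat_inv A))"
proof
  show "emeasure (mvn p \<mu> (mat_inv A)) (space (mvn p \<mu> (mat_inv A))) = 1"
    using nn_integral_gauss_density[OF assms] measurable_gauss_density[OF spdD(1)[OF assms(1)] assms(2)]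
    by (simp add: mvn_mat_inv[OF assms(1)] emeasure_density cong: nn_integral_cong)
qed

section \<open>Joint laws of the sample\<close>

lemma sigma_finite_PiM_lborel: "sigma_finite_measure (\<Pi>\<^sub>M i\<in>{..<p::nat}. (lborel :: real measure))"
proof -
  interpret product_sigma_finite "\<lambda>_::nat. lborel :: real measure" by standard
  show ?thesis by (rule sigma_finite) simp
qed

abbreviation sample_space :: "nat \<Rightarrow> nat \<Rightarrow> (nat \<Rightarrow> nat \<Rightarrow> real) measure" where
  "sample_space n p \<equiv> (\<Pi>\<^sub>M l\<in>{..<n}. \<Pi>\<^sub>M i\<in>{..<p}. lborel)"

text \<open>A finite product measure is determined by its values on boxes, and on a box the integral
  of a product of one-variable functions factorises.\<close>

lemma PiM_density:
  fixes N :: "'b measure" and f :: "'b \<Rightarrow> ennreal"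
  assumes N: "sigma_finite_measure N" and f: "f \<in> borel_measurable N" and fin: "finite (I :: 'i set)"
    and D: "sigma_finite_measure (density N f)"
  shows "(\<Pi>\<^sub>M i\<in>I. density N f) = density (\<Pi>\<^sub>M i\<in>I. N) (\<lambda>x. \<Prod>i\<in>I. f (x i))"
proof -
  interpret N: product_sigma_finite "\<lambda>_::'i. N" using N by unfold_locales (simp add: sigma_finite_measure_def)
  interpret D: product_sigma_finite "\<lambda>_::'i. density N f" using D by unfold_locales (simp add: sigma_finite_measure_def)
  note f[measurable]
  have s: "sets (density (\<Pi>\<^sub>M i\<in>I. N) (\<lambda>x. \<Prod>i\<in>I. f (x i))) = sets (\<Pi>\<^sub>M i\<in>I. density N f)"
    by (simp, rule sets_PiM_cong) auto
  have "density (\<Pi>\<^sub>M i\<in>I. N) (\<lambda>x. \<Prod>i\<in>I. f (x i)) = (\<Pi>\<^sub>M i\<in>I. density N f)"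
  proof (rule D.PiM_eqI[OF fin s])
    fix A assume A: "\<And>i. i \<in> I \<Longrightarrow> A i \<in> sets (density N f)"
    then have A': "\<And>i. i \<in> I \<Longrightarrow> A i \<in> sets N" by simp
    have AP: "Pi\<^sub>E I A \<in> sets (\<Pi>\<^sub>M i\<in>I. N)" using A' fin by (intro sets_PiM_I_finite) auto
    have "emeasure (density (\<Pi>\<^sub>M i\<in>I. N) (\<lambda>x. \<Prod>i\<in>I. f (x i))) (Pi\<^sub>E I A) =
      (\<integral>\<^sup>+x. (\<Prod>i\<in>I. f (x i)) * indicator (Pi\<^sub>E I A) x \<partial>(\<Pi>\<^sub>M i\<in>I. N))"
      using AP by (intro emeasure_density) auto
    also have "\<dots> = (\<integral>\<^sup>+x. (\<Prod>i\<in>I. f (x i) * indicator (A i) (x i)) \<partial>(\<Pi>\<^sub>M i\<in>I. N))"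
    proof (rule nn_integral_cong)
      fix x assume x: "x \<in> space (\<Pi>\<^sub>M i\<in>I. N)"
      have "indicator (Pi\<^sub>E I A) x = (\<Prod>i\<in>I. indicator (A i) (x i) :: ennreal)"
        using x fin by (auto simp: indicator_def space_PiM PiE_iff prod_zero_iff split: if_splits)
      then show "(\<Prod>i\<in>I. f (x i)) * indicator (Pi\<^sub>E I A) x = (\<Prod>i\<in>I. f (x i) * indicator (A i) (x i))"
        by (simp add: prod.distrib)
    qed
    also have "\<dots> = (\<Prod>i\<in>I. \<integral>\<^sup>+y. f y * indicator (A i) y \<partial>N)"
      using A' by (intro N.product_nn_integral_prod[OF fin]) auto
    also have "\<dots> = (\<Prod>i\<in>I. emeasure (density N f) (A i))"
      using A' by (intro prod.cong refl) (simp add: emeasure_density)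
    finally show "emeasure (density (\<Pi>\<^sub>M i\<in>I. N) (\<lambda>x. \<Prod>i\<in>I. f (x i))) (Pi\<^sub>E I A) = (\<Prod>i\<in>I. emeasure (density N f) (A i))" .
  qed
  then show ?thesis by simp
qed

definition sample_density :: "nat \<Rightarrow> nat \<Rightarrow> real vec \<Rightarrow> real mat \<Rightarrow> (nat \<Rightarrow> nat \<Rightarrow> real) \<Rightarrow> real" where
  "sample_density n p \<mu> A X = (\<Prod>l<n. gauss_density p \<mu> A (X l))"

lemma measurable_sample_density [measurable]:
  assumes [measurable]: "A \<in> carrier_mat p p" "\<mu> \<in> carrier_vec p"
  shows "sample_density n p \<mu> A \<in> borel_measurable (sample_space n p)"
proof -
  note [measurable] = measurable_gauss_density[OF assms]
  show ?thesis unfolding sample_density_def by measurable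
qed

lemma sample_density_pos: "symmetric_pos_def p A \<Longrightarrow> 0 < sample_density n p \<mu> A X"
  by (auto simp: sample_density_def intro!: prod_pos gauss_density_pos)

lemma sample_law_density:
  assumes A: "symmetric_pos_def p A" and m: "\<mu> \<in> carrier_vec p"
  shows "sample_law n p \<mu> (mat_inv A) = density (sample_space n p) (\<lambda>X. ennreal (sample_density n p \<mu> A X))"
proof -
  interpret prob_space "mvn p \<mu> (mat_inv A)" by (rule prob_space_mvn[OF assms])
  have "sample_law n p \<mu> (mat_inv A) = density (sample_space n p) (\<lambda>X. \<Prod>l<n. ennreal (gauss_density p \<mu> A (X l)))"
    unfolding sample_law_def mvn_mat_inv[OF A]
    using sigma_finite_measure_axioms measurable_gauss_density[OF spdD(1)[OF A] m]
    by (intro PiM_density sigma_finite_PiM_lborel) (auto simp: mvn_mat_inv[OF A])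
  also have "(\<lambda>X. \<Prod>l<n. ennreal (gauss_density p \<mu> A (X l))) = (\<lambda>X. ennreal (sample_density n p \<mu> A X))"
    using gauss_density_pos[OF A] by (auto simp: sample_density_def prod_ennreal less_imp_le)
  finally show ?thesis .
qed

lemma nn_integral_sample_prod:
  assumes h: "h \<in> borel_measurable (\<Pi>\<^sub>M i\<in>{..<p}. lborel)"
  shows "(\<integral>\<^sup>+X. (\<Prod>l<n. h (X l)) \<partial>sample_space n p) = (\<integral>\<^sup>+x. h x \<partial>(\<Pi>\<^sub>M i\<in>{..<p}. lborel)) ^ n"
proof -
  interpret product_sigma_finite "\<lambda>_::nat. (\<Pi>\<^sub>M i\<in>{..<p}. lborel :: (nat \<Rightarrow> real) measure)"
    using sigma_finite_PiM_lborel by unfold_locales (simp add: sigma_finite_measure_def)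
  show ?thesis using h by (subst product_nn_integral_prod) auto
qed

lemma nn_integral_sample_density:
  assumes A: "symmetric_pos_def p A" and m: "\<mu> \<in> carrier_vec p"
  shows "(\<integral>\<^sup>+X. ennreal (sample_density n p \<mu> A X) \<partial>sample_space n p) = 1"
proof -
  have "(\<integral>\<^sup>+X. ennreal (sample_density n p \<mu> A X) \<partial>sample_space n p) = (\<integral>\<^sup>+X. (\<Prod>l<n. ennreal (gauss_density p \<mu> A (X l))) \<partial>sample_space n p)"
    using gauss_density_pos[OF A] by (auto simp: sample_density_def prod_ennreal less_imp_le)
  also have "\<dots> = 1"
    using measurable_gauss_density[OF spdD(1)[OF A] m] nn_integral_gauss_density[OF assms]
    by (subst nn_integral_sample_prod) auto
  finally show ?thesis .
qed

text \<open>For one observation the integrand is a constant times a Gaussian exponential with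
  precision \<open>A1 + A2 - A0\<close>; independence gives the power \<open>n\<close>. These
  integrals are the terms of the second moment of the likelihood ratio of a mixture against
  \<open>A0\<close>.\<close>

lemma sample_chi_square:
  assumes A0: "symmetric_pos_def p A0" and A1: "symmetric_pos_def p A1" and A2: "symmetric_pos_def p A2"
    and B: "symmetric_pos_def p (A1 + A2 - A0)" and m: "\<mu> \<in> carrier_vec p"
  shows "(\<integral>\<^sup>+X. ennreal (sample_density n p \<mu> A1 X * sample_density n p \<mu> A2 X / sample_density n p \<mu> A0 X) \<partial>sample_space n p) =
    ennreal (sqrt (Determinant.det A1 * Determinant.det A2 / (Determinant.det A0 * Determinant.det (A1 + A2 - A0))) ^ n)"
proof -
  let ?B = "A1 + A2 - A0"
  let ?h = "\<lambda>x. gauss_density p \<mu> A1 x * gauss_density p \<mu> A2 x / gauss_density p \<mu> A0 x"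
  note pos = spd_det_pos[OF A0] spd_det_pos[OF A1] spd_det_pos[OF A2] spd_det_pos[OF B]
  note car = spdD(1)[OF A0] spdD(1)[OF A1] spdD(1)[OF A2]
  have hpos: "0 \<le> ?h x" for x
    using gauss_density_pos[OF A0, of \<mu> x] gauss_density_pos[OF A1, of \<mu> x] gauss_density_pos[OF A2, of \<mu> x] by simp
  let ?c = "sqrt (Determinant.det A1 * Determinant.det A2 / Determinant.det A0)"
  have "?h x = ?c / sqrt ((2 * pi) ^ p) * exp (- (1/2) * ((vec p x - \<mu>) \<bullet> (?B *\<^sub>v (vec p x - \<mu>))))" for x
  proof -
    let ?v = "vec p x - \<mu>"
    have v: "?v \<in> carrier_vec p" using m by auto
    have "?B *\<^sub>v ?v = A1 *\<^sub>v ?v + A2 *\<^sub>v ?v - A0 *\<^sub>v ?v"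
      using car v by (simp add: minus_mult_distrib_mat_vec[of _ p p] add_mult_distrib_mat_vec[of _ p p])
    also have "?v \<bullet> \<dots> = ?v \<bullet> (A1 *\<^sub>v ?v + A2 *\<^sub>v ?v) - ?v \<bullet> (A0 *\<^sub>v ?v)"
      using car v by (intro scalar_prod_minus_distrib) auto
    also have "?v \<bullet> (A1 *\<^sub>v ?v + A2 *\<^sub>v ?v) = ?v \<bullet> (A1 *\<^sub>v ?v) + ?v \<bullet> (A2 *\<^sub>v ?v)"
      using car v by (intro scalar_prod_add_distrib) auto
    finally have q: "?v \<bullet> (?B *\<^sub>v ?v) = ?v \<bullet> (A1 *\<^sub>v ?v) + ?v \<bullet> (A2 *\<^sub>v ?v) - ?v \<bullet> (A0 *\<^sub>v ?v)" .
    have e: "exp (- (1/2) * (a + b - c)) = exp (- (1/2) * a) * exp (- (1/2) * b) / exp (- (1/2) * c)" for a b c :: real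
    proof -
      have "- (1/2) * (a + b - c) = (- (1/2) * a + - (1/2) * b) - (- (1/2) * c)" by (simp add: field_simps)
      then show ?thesis by (simp only: exp_add exp_diff)
    qed
    show ?thesis unfolding q e using pos
      by (simp add: gauss_density_def real_sqrt_divide real_sqrt_mult field_simps)
  qed
  then have 1: "(\<integral>\<^sup>+x. ennreal (?h x) \<partial>(\<Pi>\<^sub>M i\<in>{..<p}. lborel)) = ennreal (?c / sqrt (Determinant.det ?B))"
    using nn_integral_gauss_ratio[OF A0 B m, of ?c] pos by simp
  note [measurable] = car[THEN measurable_gauss_density[OF _ m]]
  have "(\<integral>\<^sup>+X. ennreal (sample_density n p \<mu> A1 X * sample_density n p \<mu> A2 X / sample_density n p \<mu> A0 X) \<partial>sample_space n p) =
    (\<integral>\<^sup>+X. (\<Prod>l<n. ennreal (?h (X l))) \<partial>sample_space n p)"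
    using hpos by (simp add: sample_density_def prod_ennreal prod.distrib prod_dividef)
  also have "\<dots> = ennreal (?c / sqrt (Determinant.det ?B)) ^ n"
    unfolding 1[symmetric] by (rule nn_integral_sample_prod) measurable
  also have "\<dots> = ennreal ((?c / sqrt (Determinant.det ?B)) ^ n)"
    using pos by (intro ennreal_power) auto
  also have "?c / sqrt (Determinant.det ?B) = sqrt (Determinant.det A1 * Determinant.det A2 / (Determinant.det A0 * Determinant.det ?B))"
    by (simp add: real_sqrt_divide real_sqrt_mult)
  finally show ?thesis .
qed

section \<open>Matrix norms and eigenvalues\<close>

text \<open>Jensen's inequality for the power \<open>q\<close>, with the weights \<open>a i\<close>
  divided by their sum. Replacing that sum by \<open>C\<close> only enlarges the right side, since
  \<open>q - 1\<close> is nonnegative.\<close>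

lemma weighted_powr_le:
  fixes a y :: "'i \<Rightarrow> real"
  assumes fin: "finite I" and a: "\<And>i. i \<in> I \<Longrightarrow> 0 \<le> a i" and y: "\<And>i. i \<in> I \<Longrightarrow> 0 \<le> y i"
    and C: "sum a I \<le> C" and q: "1 \<le> q"
  shows "(\<Sum>i\<in>I. a i * y i) powr q \<le> C powr (q - 1) * (\<Sum>i\<in>I. a i * y i powr q)"
proof -
  \<comment> \<open>Indices with \<open>y i = 0\<close> contribute to neither side; dropping them
    leaves positive arguments for the convexity of the power.\<close>
  define J where "J = {i \<in> I. 0 < y i}"
  have J: "finite J" "J \<subseteq> I" using fin by (auto simp: J_def)
  have z: "y i = 0" if "i \<in> I - J" for i using that y[of i] by (auto simp: J_def)
  have 1: "(\<Sum>i\<in>I. a i * y i) = (\<Sum>i\<in>J. a i * y i)"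
    using fin J z by (intro sum.mono_neutral_right) auto
  have 2: "(\<Sum>i\<in>I. a i * y i powr q) = (\<Sum>i\<in>J. a i * y i powr q)"
    using fin J z by (intro sum.mono_neutral_right) auto
  define s where "s = sum a J"
  have s0: "0 \<le> s" unfolding s_def using a J by (intro sum_nonneg) auto
  have sC: "s \<le> C" unfolding s_def using C sum_mono2[OF fin J(2), of a] a by force
  have nn: "0 \<le> (\<Sum>i\<in>J. a i * y i powr q)" using a J by (intro sum_nonneg) auto
  show ?thesis
  proof (cases "s = 0")
    case True
    have "sum a J = 0 \<longleftrightarrow> (\<forall>i\<in>J. a i = 0)" using a J by (intro sum_nonneg_eq_0_iff) auto
    with True have "\<forall>i\<in>J. a i = 0" unfolding s_def by blast
    then have "(\<Sum>i\<in>J. a i * y i) = 0" "(\<Sum>i\<in>J. a i * y i powr q) = 0" by (auto intro: sum.neutral)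
    then show ?thesis unfolding 1 2 by simp
  next
    case False
    with s0 have s: "0 < s" by simp
    then have "J \<noteq> {}" by (auto simp: s_def)
    have "(\<Sum>i\<in>J. (a i / s) *\<^sub>R y i) powr q \<le> (\<Sum>i\<in>J. (a i / s) * y i powr q)"
      using J(1) \<open>J \<noteq> {}\<close> s a J(2)
    proof (intro convex_on_sum[OF _ _ powr_convex[OF q]])
      show "(\<Sum>i\<in>J. a i / s) = 1" using s by (simp add: s_def sum_divide_distrib[symmetric])
    qed (auto simp: J_def)
    then have "((\<Sum>i\<in>J. a i * y i) / s) powr q \<le> (\<Sum>i\<in>J. a i * y i powr q) / s"
      by (simp add: sum_divide_distrib)
    moreover have "0 \<le> (\<Sum>i\<in>J. a i * y i)" using a y J by (intro sum_nonneg mult_nonneg_nonneg) auto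
    ultimately have "(\<Sum>i\<in>J. a i * y i) powr q \<le> s powr q * ((\<Sum>i\<in>J. a i * y i powr q) / s)"
      using s by (simp add: powr_divide divide_le_eq mult.commute)
    also have "\<dots> = s powr (q - 1) * (\<Sum>i\<in>J. a i * y i powr q)"
      using s by (simp add: powr_diff)
    also have "\<dots> \<le> C powr (q - 1) * (\<Sum>i\<in>J. a i * y i powr q)"
      using s sC q nn by (intro mult_right_mono powr_mono2) auto
    finally show ?thesis unfolding 1 2 .
  qed
qed

lemma ge_one_ereal_cases:
  assumes "1 \<le> (w::ereal)"
  obtains "w = \<infinity>" | q where "w = ereal q" "1 \<le> q"
  using assms by (cases w) auto

lemma lw_norm_ereal: "v \<in> carrier_vec p \<Longrightarrow> lw_norm (ereal q) v = (\<Sum>i<p. \<bar>v $ i\<bar> powr q) powr (1 / q)"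
  by (auto simp: lw_norm_def)

lemma lw_norm_infinity_le_iff:
  "v \<in> carrier_vec p \<Longrightarrow> 0 < p \<Longrightarrow> lw_norm \<infinity> v \<le> c \<longleftrightarrow> (\<forall>i<p. \<bar>v $ i\<bar> \<le> c)"
  by (auto simp: lw_norm_def lessThan_empty_iff)

lemma abs_le_lw_norm_infinity:
  assumes "v \<in> carrier_vec p" "i < p"
  shows "\<bar>v $ i\<bar> \<le> lw_norm \<infinity> v"
  using lw_norm_infinity_le_iff[OF assms(1), of "lw_norm \<infinity> v"] assms(2) by auto

lemma lw_norm_nonneg:
  assumes "v \<in> carrier_vec p" "0 < p"
  shows "0 \<le> lw_norm w v"
proof (cases "w = \<infinity>")
  case True
  then show ?thesis using abs_le_lw_norm_infinity[OF assms] abs_ge_zero order_trans by blast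
qed (simp add: lw_norm_def)

lemma lw_norm_one: "v \<in> carrier_vec p \<Longrightarrow> lw_norm 1 v = (\<Sum>i<p. \<bar>v $ i\<bar>)"
  using lw_norm_ereal[of v p 1] by (simp add: one_ereal_def sum_nonneg)

text \<open>The Schur test; it replaces the interpolation between the \<open>\<ell>\<close>-1 and the \<open>\<ell>\<close>-infinity norm.\<close>

lemma lw_norm_mult_le:
  assumes A: "A \<in> carrier_mat p p" and p: "0 < p" and w: "1 \<le> w" and v: "v \<in> carrier_vec p"
    and row: "\<And>i. i < p \<Longrightarrow> (\<Sum>j<p. \<bar>A $$ (i, j)\<bar>) \<le> C"
    and col: "\<And>j. j < p \<Longrightarrow> (\<Sum>i<p. \<bar>A $$ (i, j)\<bar>) \<le> C"
  shows "lw_norm w (A *\<^sub>v v) \<le> C * lw_norm w v"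
proof -
  have C: "0 \<le> C" using row[OF p] sum_nonneg[of "{..<p}" "\<lambda>j. \<bar>A $$ (0, j)\<bar>"] by linarith
  have Av: "A *\<^sub>v v \<in> carrier_vec p" using mult_mat_vec_carrier[OF A v] .
  have ix: "\<bar>(A *\<^sub>v v) $ i\<bar> \<le> (\<Sum>j<p. \<bar>A $$ (i, j)\<bar> * \<bar>v $ j\<bar>)" if "i < p" for i
  proof -
    have "(A *\<^sub>v v) $ i = (\<Sum>j<p. A $$ (i, j) * v $ j)"
      using A v that by (auto simp: scalar_prod_def atLeast0LessThan intro!: sum.cong)
    also have "\<bar>\<dots>\<bar> \<le> (\<Sum>j<p. \<bar>A $$ (i, j) * v $ j\<bar>)" by (rule sum_abs)
    finally show ?thesis by (simp add: abs_mult)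
  qed
  from w show ?thesis
  proof (cases rule: ge_one_ereal_cases)
    case 1
    have "\<bar>(A *\<^sub>v v) $ i\<bar> \<le> C * lw_norm \<infinity> v" if i: "i < p" for i
    proof -
      have "(\<Sum>j<p. \<bar>A $$ (i, j)\<bar> * \<bar>v $ j\<bar>) \<le> (\<Sum>j<p. \<bar>A $$ (i, j)\<bar> * lw_norm \<infinity> v)"
        using abs_le_lw_norm_infinity[OF v] by (intro sum_mono mult_left_mono) auto
      also have "\<dots> \<le> C * lw_norm \<infinity> v"
        unfolding sum_distrib_right[symmetric] using row[OF i] lw_norm_nonneg[OF v p] by (intro mult_right_mono) auto
      finally show ?thesis using ix[OF i] by linarith
    qed
    then show ?thesis using lw_norm_infinity_le_iff[OF Av p] 1 by simp
  next
    case (2 q)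
    \<comment> \<open>Jensen with the weights of a row yields \<open>C powr (q - 1)\<close>; after
      exchanging the sums the column sums supply the last factor \<open>C\<close>.\<close>
    have "(\<Sum>i<p. \<bar>(A *\<^sub>v v) $ i\<bar> powr q) \<le> (\<Sum>i<p. C powr (q - 1) * (\<Sum>j<p. \<bar>A $$ (i, j)\<bar> * \<bar>v $ j\<bar> powr q))"
    proof (rule sum_mono)
      fix i assume "i \<in> {..<p}"
      then have i: "i < p" by simp
      have "\<bar>(A *\<^sub>v v) $ i\<bar> powr q \<le> (\<Sum>j<p. \<bar>A $$ (i, j)\<bar> * \<bar>v $ j\<bar>) powr q"
        using ix[OF i] 2 by (intro powr_mono2) auto
      also have "\<dots> \<le> C powr (q - 1) * (\<Sum>j<p. \<bar>A $$ (i, j)\<bar> * \<bar>v $ j\<bar> powr q)"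
        using row[OF i] 2 by (intro weighted_powr_le) auto
      finally show "\<bar>(A *\<^sub>v v) $ i\<bar> powr q \<le> C powr (q - 1) * (\<Sum>j<p. \<bar>A $$ (i, j)\<bar> * \<bar>v $ j\<bar> powr q)" .
    qed
    also have "\<dots> = C powr (q - 1) * (\<Sum>j<p. (\<Sum>i<p. \<bar>A $$ (i, j)\<bar>) * \<bar>v $ j\<bar> powr q)"
      unfolding sum_distrib_left[symmetric] sum_distrib_right by (subst sum.swap) simp
    also have "\<dots> \<le> C powr (q - 1) * (\<Sum>j<p. C * \<bar>v $ j\<bar> powr q)"
      using col by (intro mult_left_mono sum_mono mult_right_mono) auto
    also have "\<dots> = C powr q * (\<Sum>j<p. \<bar>v $ j\<bar> powr q)"
      using C by (cases "C = 0") (auto simp: sum_distrib_left[symmetric] powr_diff)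
    finally have "(\<Sum>i<p. \<bar>(A *\<^sub>v v) $ i\<bar> powr q) powr (1 / q) \<le> (C powr q * (\<Sum>j<p. \<bar>v $ j\<bar> powr q)) powr (1 / q)"
      using 2 by (intro powr_mono2) (auto intro: sum_nonneg)
    also have "\<dots> = C * (\<Sum>j<p. \<bar>v $ j\<bar> powr q) powr (1 / q)"
      using C 2 by (simp add: powr_mult powr_powr sum_nonneg)
    finally show ?thesis using 2 by (simp add: lw_norm_ereal[OF Av] lw_norm_ereal[OF v])
  qed
qed

lemma lw_norm_zero: "0 < p \<Longrightarrow> 1 \<le> w \<Longrightarrow> lw_norm w (0\<^sub>v p) \<le> 1"
  by (erule ge_one_ereal_cases) (auto simp: lw_norm_infinity_le_iff[of _ p] lw_norm_ereal[of _ p])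

lemma lw_mat_norm_le:
  assumes A: "A \<in> carrier_mat p p" and p: "0 < p" and w: "1 \<le> w"
    and row: "\<And>i. i < p \<Longrightarrow> (\<Sum>j<p. \<bar>A $$ (i, j)\<bar>) \<le> C"
    and col: "\<And>j. j < p \<Longrightarrow> (\<Sum>i<p. \<bar>A $$ (i, j)\<bar>) \<le> C"
  shows "lw_mat_norm w A \<le> C"
proof -
  have C: "0 \<le> C" using row[OF p] sum_nonneg[of "{..<p}" "\<lambda>j. \<bar>A $$ (0, j)\<bar>"] by linarith
  have "lw_norm w (A *\<^sub>v v) \<le> C" if v: "v \<in> carrier_vec p" "lw_norm w v \<le> 1" for v
    using lw_norm_mult_le[OF A p w v(1) row col] mult_left_mono[OF v(2) C] by simp
  moreover have "{v \<in> carrier_vec p. lw_norm w v \<le> 1} \<noteq> {}"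
    using lw_norm_zero[OF p w] zero_carrier_vec[of p] by blast
  ultimately show ?thesis unfolding lw_mat_norm_def using A
    by (intro cSUP_least) auto
qed

text \<open>The sum of the absolute values of all entries bounds every row and column sum, so the
  Schur test shows that the supremum is taken over a bounded set.\<close>

lemma lw_norm_le_lw_mat_norm:
  assumes A: "A \<in> carrier_mat p p" and p: "0 < p" and w: "1 \<le> w"
    and v: "v \<in> carrier_vec p" "lw_norm w v \<le> 1"
  shows "lw_norm w (A *\<^sub>v v) \<le> lw_mat_norm w A"
proof -
  let ?C = "\<Sum>i<p. \<Sum>j<p. \<bar>A $$ (i, j)\<bar>"
  have C: "0 \<le> ?C" by (intro sum_nonneg) auto
  have row: "(\<Sum>j<p. \<bar>A $$ (i, j)\<bar>) \<le> ?C" if "i < p" for i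
    using that by (intro member_le_sum[of i "{..<p}" "\<lambda>i. \<Sum>j<p. \<bar>A $$ (i, j)\<bar>"]) (auto intro: sum_nonneg)
  have col: "(\<Sum>i<p. \<bar>A $$ (i, j)\<bar>) \<le> ?C" if "j < p" for j
    using that by (intro sum_mono member_le_sum) auto
  have "bdd_above ((\<lambda>v. lw_norm w (A *\<^sub>v v)) ` {v \<in> carrier_vec p. lw_norm w v \<le> 1})"
  proof (rule bdd_aboveI2)
    fix v assume v: "v \<in> {v \<in> carrier_vec p. lw_norm w v \<le> 1}"
    then show "lw_norm w (A *\<^sub>v v) \<le> ?C"
      using lw_norm_mult_le[OF A p w _ row col, of v] mult_left_mono[of "lw_norm w v" 1 ?C] C by auto
  qed
  then show ?thesis unfolding lw_mat_norm_def using v A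
    by (intro cSUP_upper) auto
qed

lemma lw_mat_norm_nonneg:
  assumes "A \<in> carrier_mat p p" "0 < p" "1 \<le> w"
  shows "0 \<le> lw_mat_norm w A"
  using lw_norm_le_lw_mat_norm[OF assms zero_carrier_vec lw_norm_zero[OF assms(2,3)]]
    lw_norm_nonneg[of "A *\<^sub>v 0\<^sub>v p" p w] assms by simp

text \<open>The test vector is constant on \<open>D\<close> and normalised in the norm at hand. By
  Jensen the norm of the image is at least a weighted mean of the row sums, and normalising by
  \<open>card D\<close> on both sides makes the bound independent of \<open>w\<close>. It is the
  tool that lets one lower bound serve all norms.\<close>

lemma lw_mat_norm_ge_block:
  assumes A: "A \<in> carrier_mat p p" and p: "0 < p" and w: "1 \<le> w"
    and R: "R \<subseteq> {..<p}" and D: "D \<subseteq> {..<p}" "D \<noteq> {}" and RD: "card R \<le> card D"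
  shows "(\<Sum>i\<in>R. \<bar>\<Sum>j\<in>D. A $$ (i, j)\<bar>) / real (card D) \<le> lw_mat_norm w A"
proof -
  have fin: "finite R" "finite D" using R D finite_subset by blast+
  define d where "d = real (card D)"
  have d: "0 < d" using D fin by (simp add: d_def card_gt_0_iff)
  define t where "t i = (\<Sum>j\<in>D. A $$ (i, j))" for i
  have Ax: "(A *\<^sub>v vec p (\<lambda>j. if j \<in> D then c else 0)) $ i = c * t i" if "i < p" for i c
  proof -
    have "(A *\<^sub>v vec p (\<lambda>j. if j \<in> D then c else 0)) $ i = (\<Sum>j<p. if j \<in> D then A $$ (i, j) * c else 0)"
      using A that by (auto simp: scalar_prod_def atLeast0LessThan intro!: sum.cong)
    also have "\<dots> = (\<Sum>j\<in>D. A $$ (i, j) * c)"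
      using D by (subst sum.inter_restrict[symmetric]) (auto simp: Int_absorb1)
    finally show ?thesis by (simp add: t_def sum_distrib_left mult.commute)
  qed
  from w show ?thesis
  proof (cases rule: ge_one_ereal_cases)
    case 1
    let ?x = "vec p (\<lambda>j. if j \<in> D then 1 else 0) :: real vec"
    have Axc: "A *\<^sub>v ?x \<in> carrier_vec p" using mult_mat_vec_carrier[OF A vec_carrier] .
    have "lw_norm w ?x \<le> 1" using 1 p by (simp add: lw_norm_infinity_le_iff[of _ p])
    then have le: "lw_norm w (A *\<^sub>v ?x) \<le> lw_mat_norm w A"
      by (intro lw_norm_le_lw_mat_norm[OF A p w]) auto
    have "\<bar>t i\<bar> \<le> lw_mat_norm w A" if "i \<in> R" for i
      using abs_le_lw_norm_infinity[OF Axc, of i] Ax[of i 1] that R le 1 by auto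
    then have "(\<Sum>i\<in>R. \<bar>t i\<bar>) \<le> real (card R) * lw_mat_norm w A"
      by (rule sum_bounded_above)
    also have "\<dots> \<le> d * lw_mat_norm w A"
      using RD lw_mat_norm_nonneg[OF A p w] by (intro mult_right_mono) (auto simp: d_def)
    finally show ?thesis using d by (simp add: t_def d_def divide_le_eq mult.commute)
  next
    case (2 q)
    let ?c = "d powr (- 1 / q)"
    let ?x = "vec p (\<lambda>j. if j \<in> D then ?c else 0) :: real vec"
    have Axc: "A *\<^sub>v ?x \<in> carrier_vec p" using mult_mat_vec_carrier[OF A vec_carrier] .
    have cq: "?c powr q = 1 / d" unfolding powr_powr using d 2 by (simp add: powr_minus_divide)
    have "(\<Sum>i<p. \<bar>?x $ i\<bar> powr q) = (\<Sum>i<p. if i \<in> D then 1 / d else 0)"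
      using cq d 2 by (intro sum.cong) auto
    also have "\<dots> = (\<Sum>i\<in>D. 1 / d)"
      using D by (subst sum.inter_restrict[symmetric]) (auto simp: Int_absorb1)
    also have "\<dots> = 1" using d by (simp add: d_def)
    finally have "lw_norm w ?x \<le> 1" using 2 by (simp add: lw_norm_ereal[of _ p])
    then have le: "lw_norm w (A *\<^sub>v ?x) \<le> lw_mat_norm w A"
      by (intro lw_norm_le_lw_mat_norm[OF A p w]) auto
    let ?m = "\<Sum>i\<in>R. 1 / d * \<bar>t i\<bar>"
    have m0: "0 \<le> ?m" using d by (intro sum_nonneg) auto
    \<comment> \<open>The weights \<open>1 / d\<close> have total at most one because
      \<open>card R \<le> card D\<close>.\<close>
    have "?m powr q \<le> 1 powr (q - 1) * (\<Sum>i\<in>R. 1 / d * \<bar>t i\<bar> powr q)"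
      using fin d 2 RD by (intro weighted_powr_le) (auto simp: d_def)
    also have "\<dots> = (\<Sum>i\<in>R. \<bar>(A *\<^sub>v ?x) $ i\<bar> powr q)"
    proof -
      have "1 / d * \<bar>t i\<bar> powr q = \<bar>(A *\<^sub>v ?x) $ i\<bar> powr q" if "i \<in> R" for i
        using Ax[of i ?c] that R d cq by (auto simp: abs_mult powr_mult)
      then show ?thesis by simp
    qed
    also have "\<dots> \<le> (\<Sum>i<p. \<bar>(A *\<^sub>v ?x) $ i\<bar> powr q)"
      using R by (intro sum_mono2) auto
    finally have "(?m powr q) powr (1 / q) \<le> (\<Sum>i<p. \<bar>(A *\<^sub>v ?x) $ i\<bar> powr q) powr (1 / q)"
      using 2 by (intro powr_mono2) auto
    moreover have "(?m powr q) powr (1 / q) = ?m" using m0 2 by (simp add: powr_powr)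
    ultimately have "?m \<le> lw_mat_norm w A" using le 2 by (simp add: lw_norm_ereal[OF Axc])
    then show ?thesis by (simp add: t_def d_def sum_divide_distrib)
  qed
qed

lemma abs_entry_le_lw_mat_norm:
  assumes "A \<in> carrier_mat p p" "1 \<le> w" "i < p" "j < p"
  shows "\<bar>A $$ (i, j)\<bar> \<le> lw_mat_norm w A"
  using lw_mat_norm_ge_block[OF assms(1) _ assms(2), of "{i}" "{j}"] assms(3,4) by simp

lemma column_sum_le_lw_mat_norm:
  assumes A: "A \<in> carrier_mat p p" and j: "j < p"
  shows "(\<Sum>i<p. \<bar>A $$ (i, j)\<bar>) \<le> lw_mat_norm 1 A"
proof -
  have "(\<Sum>i<p. \<bar>unit_vec p j $ i\<bar>) = (\<Sum>i<p. if i = j then 1 else 0 :: real)"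
    by (intro sum.cong) (auto simp: unit_vec_def)
  also have "\<dots> = 1" using j by simp
  finally have "lw_norm 1 (unit_vec p j) \<le> 1"
    by (simp add: lw_norm_one[of _ p])
  then have "lw_norm 1 (A *\<^sub>v unit_vec p j) \<le> lw_mat_norm 1 A"
    using A j by (intro lw_norm_le_lw_mat_norm) auto
  moreover have "lw_norm 1 (A *\<^sub>v unit_vec p j) = (\<Sum>i<p. \<bar>A $$ (i, j)\<bar>)"
    using A j by (subst lw_norm_one[of _ p]) auto
  ultimately show ?thesis by simp
qed

section \<open>Rayleigh quotients and extreme eigenvalues\<close>

lemma scalar_prod_self_eq: "(v::real vec) \<in> carrier_vec p \<Longrightarrow> v \<bullet> v = (\<Sum>i<p. (v $ i)\<^sup>2)"
  by (auto simp: scalar_prod_def atLeast0LessThan power2_eq_square)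

lemma scalar_prod_self_pos:
  assumes "(v::real vec) \<in> carrier_vec p" "v \<noteq> 0\<^sub>v p"
  shows "0 < v \<bullet> v"
proof -
  obtain i where "i < p" "v $ i \<noteq> 0" using assms by (metis carrier_vecD eq_vecI index_zero_vec)
  then show ?thesis unfolding scalar_prod_self_eq[OF assms(1)]
    by (intro sum_pos2[of _ i]) auto
qed

lemma abs_quadratic_form_le:
  fixes A :: "real mat"
  assumes A: "A \<in> carrier_mat p p" and v: "v \<in> carrier_vec p"
  shows "\<bar>v \<bullet> (A *\<^sub>v v)\<bar> \<le> (\<Sum>i<p. \<Sum>j<p. \<bar>A $$ (i, j)\<bar>) * (v \<bullet> v)"
proof -
  have vi: "\<bar>v $ i * v $ j\<bar> \<le> v \<bullet> v" if "i < p" "j < p" for i j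
  proof -
    have "(v $ i)\<^sup>2 \<le> v \<bullet> v" "(v $ j)\<^sup>2 \<le> v \<bullet> v"
      unfolding scalar_prod_self_eq[OF v] using that by (intro member_le_sum; simp)+
    moreover have "2 * \<bar>v $ i * v $ j\<bar> \<le> (v $ i)\<^sup>2 + (v $ j)\<^sup>2"
      using sum_squares_bound[of "\<bar>v $ i\<bar>" "\<bar>v $ j\<bar>"] by (simp add: abs_mult)
    ultimately show ?thesis by linarith
  qed
  have "\<bar>v \<bullet> (A *\<^sub>v v)\<bar> \<le> (\<Sum>i<p. \<Sum>j<p. \<bar>A $$ (i, j) * v $ i * v $ j\<bar>)"
    unfolding quadratic_form_sum[OF A v v] by (rule order_trans[OF sum_abs], rule sum_mono, rule sum_abs)
  also have "\<dots> \<le> (\<Sum>i<p. \<Sum>j<p. \<bar>A $$ (i, j)\<bar> * (v \<bullet> v))"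
  proof (intro sum_mono)
    fix i j assume "i \<in> {..<p}" "j \<in> {..<p}"
    then show "\<bar>A $$ (i, j) * v $ i * v $ j\<bar> \<le> \<bar>A $$ (i, j)\<bar> * (v \<bullet> v)"
      using vi[of i j] by (auto simp: abs_mult mult.assoc intro: mult_left_mono)
  qed
  finally show ?thesis by (simp add: sum_distrib_right)
qed

text \<open>A zero \<open>v\<close> of a nonnegative form is a minimum, so \<open>B v = 0\<close>:
  otherwise a small step from \<open>v\<close> against the direction \<open>B v\<close> would make
  the form negative. Invertibility then excludes \<open>v \<noteq> 0\<close>.\<close>

lemma psd_invertible_imp_spd:
  assumes B: "B \<in> carrier_mat p p" "transpose_mat B = B" and d: "Determinant.det B \<noteq> 0"
    and psd: "\<And>v. v \<in> carrier_vec p \<Longrightarrow> 0 \<le> v \<bullet> (B *\<^sub>v (v::real vec))"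
  shows "symmetric_pos_def p B"
proof -
  {
    fix v :: "real vec" assume v: "v \<in> carrier_vec p" "v \<noteq> 0\<^sub>v p"
    let ?w = "B *\<^sub>v v"
    have w: "?w \<in> carrier_vec p" using mult_mat_vec_carrier[OF B(1) v(1)] .
    have Bw: "B *\<^sub>v ?w \<in> carrier_vec p" using mult_mat_vec_carrier[OF B(1) w] .
    have "?w \<noteq> 0\<^sub>v p" using det_0_iff_vec_prod_zero_field[OF B(1)] d v by auto
    then have s: "0 < ?w \<bullet> ?w" using scalar_prod_self_pos[OF w] by simp
    have "v \<bullet> ?w \<noteq> 0"
    proof
      assume z: "v \<bullet> ?w = 0"
      define s where "s = ?w \<bullet> ?w"
      define c where "c = ?w \<bullet> (B *\<^sub>v ?w)"
      have c0: "0 \<le> c" using psd[OF w] by (simp add: c_def)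
      \<comment> \<open>The form at the shifted vector is \<open>2 t s + t^2 c\<close>; this step
        makes it \<open>- s^2 (c + 2) / (c + 1)^2\<close>, and the added 1 covers
        \<open>c = 0\<close>.\<close>
      define t where "t = - s / (c + 1)"
      have tw: "t \<cdot>\<^sub>v ?w \<in> carrier_vec p" using w by simp
      have Bt: "B *\<^sub>v (v + t \<cdot>\<^sub>v ?w) = ?w + t \<cdot>\<^sub>v (B *\<^sub>v ?w)"
        using B v w tw by (simp add: mult_add_distrib_mat_vec[of _ p p] mult_mat_vec[of _ p p])
      have sym: "v \<bullet> (B *\<^sub>v ?w) = ?w \<bullet> ?w"
        using symmetric_bilinear[OF B v(1) w] .
      have "0 \<le> (v + t \<cdot>\<^sub>v ?w) \<bullet> (B *\<^sub>v (v + t \<cdot>\<^sub>v ?w))" using v tw by (intro psd) auto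
      also have "\<dots> = (v + t \<cdot>\<^sub>v ?w) \<bullet> ?w + (v + t \<cdot>\<^sub>v ?w) \<bullet> (t \<cdot>\<^sub>v (B *\<^sub>v ?w))"
        unfolding Bt using v w tw Bw by (intro scalar_prod_add_distrib) auto
      also have "(v + t \<cdot>\<^sub>v ?w) \<bullet> ?w = v \<bullet> ?w + (t \<cdot>\<^sub>v ?w) \<bullet> ?w"
        using v w tw by (intro add_scalar_prod_distrib) auto
      also have "(v + t \<cdot>\<^sub>v ?w) \<bullet> (t \<cdot>\<^sub>v (B *\<^sub>v ?w)) = v \<bullet> (t \<cdot>\<^sub>v (B *\<^sub>v ?w)) + (t \<cdot>\<^sub>v ?w) \<bullet> (t \<cdot>\<^sub>v (B *\<^sub>v ?w))"
        using v w tw Bw by (intro add_scalar_prod_distrib) auto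
      also have "v \<bullet> (t \<cdot>\<^sub>v (B *\<^sub>v ?w)) = t * (v \<bullet> (B *\<^sub>v ?w))"
        using v Bw by (intro scalar_prod_smult_distrib) auto
      also have "(t \<cdot>\<^sub>v ?w) \<bullet> (t \<cdot>\<^sub>v (B *\<^sub>v ?w)) = t * (t * (?w \<bullet> (B *\<^sub>v ?w)))"
        using w Bw tw by (subst scalar_prod_smult_distrib[OF tw Bw]) simp
      also have "(t \<cdot>\<^sub>v ?w) \<bullet> ?w = t * (?w \<bullet> ?w)" using w by simp
      finally have "0 \<le> 2 * (t * s) + t * (t * c)"
        using z sym by (simp add: s_def c_def)
      moreover have "2 * (t * s) + t * (t * c) = - (s\<^sup>2 * (c + 2)) / (c + 1)\<^sup>2"
        using c0 by (simp add: t_def power2_eq_square divide_simps) (simp add: algebra_simps)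
      moreover have "0 < s\<^sup>2 * (c + 2) / (c + 1)\<^sup>2" using c0 \<open>0 < ?w \<bullet> ?w\<close> by (simp add: s_def)
      ultimately show False by simp
    qed
    then have "0 < v \<bullet> (B *\<^sub>v v)" using psd[OF v(1)] by simp
  }
  then show ?thesis using B by (simp add: symmetric_pos_def_def)
qed

text \<open>Real symmetric matrices have real eigenvalues: the supremum \<open>L\<close> of the Rayleigh quotient is one,
  since \<open>L - A\<close> is positive semidefinite and, if it were invertible, bounded below on unit vectors.\<close>

lemma ex_max_eigenvalue:
  assumes A: "A \<in> carrier_mat p p" "transpose_mat A = A" and p: "0 < p"
  shows "\<exists>L. eigenvalue A L \<and> (\<forall>v\<in>carrier_vec p. v \<bullet> (A *\<^sub>v v) \<le> L * (v \<bullet> (v::real vec)))"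
proof -
  define S where "S = (\<lambda>v. v \<bullet> (A *\<^sub>v v)) ` {v \<in> carrier_vec p. v \<bullet> v = 1}"
  have "unit_vec p 0 \<in> {v \<in> carrier_vec p. v \<bullet> v = (1::real)}" using p by simp
  then have S0: "S \<noteq> {}" unfolding S_def by blast
  have bdd: "bdd_above S"
  proof (rule bdd_aboveI)
    fix x assume "x \<in> S"
    then obtain v where "v \<in> carrier_vec p" "v \<bullet> v = 1" "x = v \<bullet> (A *\<^sub>v v)" by (auto simp: S_def)
    then show "x \<le> (\<Sum>i<p. \<Sum>j<p. \<bar>A $$ (i, j)\<bar>)" using abs_quadratic_form_le[OF A(1), of v] by simp
  qed
  define L where "L = Sup S"
  have unit: "v \<bullet> (A *\<^sub>v v) \<le> L" if "v \<in> carrier_vec p" "v \<bullet> v = 1" for v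
    unfolding L_def using that by (intro cSup_upper[OF _ bdd]) (auto simp: S_def)
  have L: "v \<bullet> (A *\<^sub>v v) \<le> L * (v \<bullet> v)" if v: "v \<in> carrier_vec p" for v
  proof (cases "v = 0\<^sub>v p")
    case True
    then show ?thesis using A by simp
  next
    case False
    define s where "s = sqrt (v \<bullet> v)"
    have s: "0 < s" "s * s = v \<bullet> v" using scalar_prod_self_pos[OF v False] by (auto simp: s_def)
    let ?u = "(1 / s) \<cdot>\<^sub>v v"
    have "?u \<bullet> ?u = (v \<bullet> v) / (s * s)" using v by simp
    then have "?u \<bullet> ?u = 1" using s(2) scalar_prod_self_pos[OF v False] by simp
    moreover have "?u \<in> carrier_vec p" using v by simp
    ultimately have "?u \<bullet> (A *\<^sub>v ?u) \<le> L" using unit[of ?u] by blast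
    moreover have "?u \<bullet> (A *\<^sub>v ?u) = (v \<bullet> (A *\<^sub>v v)) / (s * s)"
      using v A by (simp add: mult_mat_vec[of _ p p])
    ultimately show ?thesis using s scalar_prod_self_pos[OF v False] by (simp add: divide_le_eq)
  qed
  let ?B = "L \<cdot>\<^sub>m 1\<^sub>m p - A"
  have B: "?B \<in> carrier_mat p p" "transpose_mat ?B = ?B"
    using A by (auto simp: transpose_minus[of _ p p] minus_carrier_mat)
  have Bv: "?B *\<^sub>v v = L \<cdot>\<^sub>v v - A *\<^sub>v v" if "v \<in> carrier_vec p" for v :: "real vec"
    using A that by (subst minus_mult_distrib_mat_vec[of _ p p]) auto
  have qB: "v \<bullet> (?B *\<^sub>v v) = L * (v \<bullet> v) - v \<bullet> (A *\<^sub>v v)" if v: "v \<in> carrier_vec p" for v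
  proof -
    have "v \<bullet> (L \<cdot>\<^sub>v v - A *\<^sub>v v) = v \<bullet> (L \<cdot>\<^sub>v v) - v \<bullet> (A *\<^sub>v v)"
      using A v by (intro scalar_prod_minus_distrib) auto
    then show ?thesis using v by (simp add: Bv)
  qed
  have "Determinant.det ?B = 0"
  proof (rule ccontr)
    assume nz: "Determinant.det ?B \<noteq> 0"
    have spd: "symmetric_pos_def p ?B"
      using L qB by (intro psd_invertible_imp_spd[OF B nz]) simp
    let ?K = "mat_inv ?B"
    define C where "C = (\<Sum>i<p. \<Sum>j<p. \<bar>?K $$ (i, j)\<bar>)"
    \<comment> \<open>Cauchy-Schwarz for the inner product of \<open>?B\<close>, with both vectors
      equal to \<open>v\<close>: a bounded inverse keeps all quotients at distance
      \<open>1 / C\<close> from their own supremum.\<close>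
    have main: "1 \<le> C * (L - x)" if xS: "x \<in> S" for x
    proof -
      obtain v where v: "v \<in> carrier_vec p" "v \<bullet> v = 1" "x = v \<bullet> (A *\<^sub>v v)" using xS by (auto simp: S_def)
      have "1 \<le> (v \<bullet> (?K *\<^sub>v v)) * (L - x)"
        using spd_cauchy_schwarz[OF spd v(1) v(1)] qB[OF v(1)] v by simp
      also have "\<dots> \<le> C * (L - x)"
        using abs_quadratic_form_le[OF spdD(1)[OF spd_mat_inv[OF spd]] v(1)] v unit[OF v(1,2)]
        by (intro mult_right_mono) (auto simp: C_def)
      finally show ?thesis .
    qed
    obtain x where x: "x \<in> S" using S0 by blast
    have "C \<ge> 0" by (auto simp: C_def intro!: sum_nonneg)
    then have C: "0 < C" using main[OF x] by (cases "C = 0") auto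
    have "L \<le> L - 1 / C"
      unfolding L_def
    proof (rule cSup_least[OF S0])
      fix x assume "x \<in> S"
      from main[OF this] show "x \<le> Sup S - 1 / C" using C by (simp add: L_def field_simps)
    qed
    then show False using C by simp
  qed
  then obtain v where v: "v \<in> carrier_vec p" "v \<noteq> 0\<^sub>v p" "?B *\<^sub>v v = 0\<^sub>v p"
    using det_0_iff_vec_prod_zero_field[OF B(1)] by auto
  have "A *\<^sub>v v = L \<cdot>\<^sub>v v"
  proof (rule eq_vecI)
    fix i assume "i < dim_vec (L \<cdot>\<^sub>v v)"
    then have i: "i < p" using v by simp
    have "(L \<cdot>\<^sub>v v - A *\<^sub>v v) $ i = 0" using v(3) i unfolding Bv[OF v(1)] by simp
    then show "(A *\<^sub>v v) $ i = (L \<cdot>\<^sub>v v) $ i" using A v i by simp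
  qed (use A v in simp)
  then have "eigenvalue A L" using A v by (auto simp: eigenvalue_def eigenvector_def)
  then show ?thesis using L by blast
qed

lemma ex_min_eigenvalue:
  assumes A: "A \<in> carrier_mat p p" "transpose_mat A = A" and p: "0 < p"
  shows "\<exists>l. eigenvalue A l \<and> (\<forall>v\<in>carrier_vec p. l * (v \<bullet> (v::real vec)) \<le> v \<bullet> (A *\<^sub>v v))"
proof -
  have m: "- A \<in> carrier_mat p p" "transpose_mat (- A) = - A"
    using A by (auto simp: transpose_uminus)
  have mv: "(- A) *\<^sub>v v = - (A *\<^sub>v v)" if "v \<in> carrier_vec p" for v
    using A that by (intro eq_vecI) auto
  from ex_max_eigenvalue[OF m p] obtain L where L: "eigenvalue (- A) L"
    and q: "\<And>v. v \<in> carrier_vec p \<Longrightarrow> v \<bullet> ((- A) *\<^sub>v v) \<le> L * (v \<bullet> v)" by blast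
  from L obtain v where v: "v \<in> carrier_vec p" "v \<noteq> 0\<^sub>v p" "(- A) *\<^sub>v v = L \<cdot>\<^sub>v v"
    using A by (auto simp: eigenvalue_def eigenvector_def)
  have "A *\<^sub>v v = (- L) \<cdot>\<^sub>v v"
  proof (rule eq_vecI)
    fix i assume "i < dim_vec ((- L) \<cdot>\<^sub>v v)"
    then have i: "i < p" using v by simp
    have "(- (A *\<^sub>v v)) $ i = (L \<cdot>\<^sub>v v) $ i" using v(3) mv[OF v(1)] by simp
    then show "(A *\<^sub>v v) $ i = ((- L) \<cdot>\<^sub>v v) $ i" using A v i by simp
  qed (use A v in simp)
  then have "eigenvalue A (- L)" using A v by (auto simp: eigenvalue_def eigenvector_def)
  moreover have "(- L) * (v \<bullet> v) \<le> v \<bullet> (A *\<^sub>v v)" if "v \<in> carrier_vec p" for v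
    using q[OF that] mv[OF that] that A by simp
  ultimately show ?thesis by blast
qed

lemma eigenvalue_quadratic:
  assumes A: "A \<in> carrier_mat p p" and e: "eigenvalue A (l::real)"
  obtains v where "v \<in> carrier_vec p" "0 < v \<bullet> v" "v \<bullet> (A *\<^sub>v v) = l * (v \<bullet> v)"
proof -
  from e obtain v where v: "v \<in> carrier_vec p" "v \<noteq> 0\<^sub>v p" "A *\<^sub>v v = l \<cdot>\<^sub>v v"
    using A by (auto simp: eigenvalue_def eigenvector_def)
  then show thesis using that[of v] scalar_prod_self_pos[OF v(1,2)] by simp
qed

lemma spectrum_bounds:
  assumes A: "A \<in> carrier_mat p p" "transpose_mat A = A" and p: "0 < p" and v: "v \<in> carrier_vec p"
  shows "v \<bullet> (A *\<^sub>v v) \<le> lambda_max A * (v \<bullet> v)" "lambda_min A * (v \<bullet> v) \<le> v \<bullet> (A *\<^sub>v v)"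
    "eigenvalue A (lambda_max A)" "eigenvalue A (lambda_min A)"
proof -
  have fin: "finite (spectrum A)" by (rule card_finite_spectrum[OF A(1)])
  from ex_max_eigenvalue[OF A p] obtain L where L: "eigenvalue A L" "v \<bullet> (A *\<^sub>v v) \<le> L * (v \<bullet> v)" using v by blast
  from ex_min_eigenvalue[OF A p] obtain l where l: "eigenvalue A l" "l * (v \<bullet> v) \<le> v \<bullet> (A *\<^sub>v v)" using v by blast
  have ne: "spectrum A \<noteq> {}" and "L \<in> spectrum A" "l \<in> spectrum A" using L l by (auto simp: spectrum_def)
  then have "L \<le> lambda_max A" "lambda_min A \<le> l" using fin by (auto simp: lambda_max_def lambda_min_def)
  moreover have "0 \<le> v \<bullet> v" by (simp add: scalar_prod_self_eq[OF v] sum_nonneg)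
  ultimately show "v \<bullet> (A *\<^sub>v v) \<le> lambda_max A * (v \<bullet> v)" "lambda_min A * (v \<bullet> v) \<le> v \<bullet> (A *\<^sub>v v)"
    using L l mult_right_mono[of L "lambda_max A" "v \<bullet> v"] mult_right_mono[of "lambda_min A" l "v \<bullet> v"] by linarith+
  show "eigenvalue A (lambda_max A)" "eigenvalue A (lambda_min A)"
    using Max_in[OF fin ne] Min_in[OF fin ne] by (auto simp: lambda_max_def lambda_min_def spectrum_def)
qed

lemma lambda_min_pos:
  assumes "symmetric_pos_def p A" "0 < p"
  shows "0 < lambda_min A"
proof -
  note A = spdD[OF assms(1)]
  obtain v where v: "v \<in> carrier_vec p" "0 < v \<bullet> v" "v \<bullet> (A *\<^sub>v v) = lambda_min A * (v \<bullet> v)"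
    using eigenvalue_quadratic[OF A(1) spectrum_bounds(4)[OF A(1,2) assms(2) zero_carrier_vec]] by blast
  then have "v \<noteq> 0\<^sub>v p" by auto
  then show ?thesis using A(3)[OF v(1)] v(2,3) by (simp add: zero_less_mult_iff)
qed

lemma condition_number_le:
  assumes A: "A \<in> carrier_mat p p" "transpose_mat A = A" and p: "0 < p" and l: "0 < l"
    and lo: "\<And>v. v \<in> carrier_vec p \<Longrightarrow> l * (v \<bullet> v) \<le> v \<bullet> (A *\<^sub>v v)"
    and up: "\<And>v. v \<in> carrier_vec p \<Longrightarrow> v \<bullet> (A *\<^sub>v v) \<le> u * (v \<bullet> v)"
  shows "lambda_max A / lambda_min A \<le> u / l"
proof -
  note ev = spectrum_bounds(3,4)[OF A p zero_carrier_vec]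
  obtain v where v: "v \<in> carrier_vec p" "0 < v \<bullet> v" "v \<bullet> (A *\<^sub>v v) = lambda_max A * (v \<bullet> v)"
    using eigenvalue_quadratic[OF A(1) ev(1)] by blast
  have 1: "lambda_max A \<le> u" using up[OF v(1)] v by simp
  have 2: "l \<le> lambda_max A" using lo[OF v(1)] v by simp
  obtain v where v: "v \<in> carrier_vec p" "0 < v \<bullet> v" "v \<bullet> (A *\<^sub>v v) = lambda_min A * (v \<bullet> v)"
    using eigenvalue_quadratic[OF A(1) ev(2)] by blast
  have 3: "l \<le> lambda_min A" using lo[OF v(1)] v by simp
  show ?thesis using 1 2 3 l by (intro frac_le) auto
qed

text \<open>\<open>A $$ (j, j)\<close> is a Rayleigh quotient, hence at most
  \<open>lambda_max A\<close>. For the column \<open>z\<close> of the inverse at \<open>i\<close>,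
  \<open>lambda_min A\<close> times \<open>z \<bullet> z\<close> is at most the form of
  \<open>A\<close> at \<open>z\<close>, which is the diagonal entry \<open>z $ i\<close> itself; so
  this entry is at most \<open>1 / lambda_min A\<close>. The upper bound uses the condition number
  only in this way.\<close>

lemma diag_product_le_condition_number:
  assumes A: "symmetric_pos_def p A" and i: "i < p" and j: "j < p"
  shows "mat_inv A $$ (i, i) * A $$ (j, j) \<le> lambda_max A / lambda_min A" "0 \<le> mat_inv A $$ (i, i) * A $$ (j, j)"
proof -
  have p: "0 < p" using i by simp
  note Ac = spdD[OF A] and lp = lambda_min_pos[OF A p]
  let ?K = "mat_inv A"
  note K = spdD[OF spd_mat_inv[OF A]]
  have ue: "unit_vec p i \<in> carrier_vec p" "unit_vec p j \<in> carrier_vec p" by auto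
  have nz: "unit_vec p i \<noteq> 0\<^sub>v p" "unit_vec p j \<noteq> 0\<^sub>v p"
    using i j by (metis index_unit_vec(1) index_zero_vec(1) zero_neq_one)+
  have Ajj: "unit_vec p j \<bullet> (A *\<^sub>v unit_vec p j) = A $$ (j, j)" using Ac(1) j by simp
  have Kii: "unit_vec p i \<bullet> (?K *\<^sub>v unit_vec p i) = ?K $$ (i, i)" using K(1) i by simp
  have a: "0 < A $$ (j, j)" using Ac(3)[OF ue(2) nz(2)] Ajj by simp
  have k: "0 < ?K $$ (i, i)" using K(3)[OF ue(1) nz(1)] Kii by simp
  have aj: "A $$ (j, j) \<le> lambda_max A" using spectrum_bounds(1)[OF Ac(1,2) p ue(2)] j unfolding Ajj by simp
  let ?z = "?K *\<^sub>v unit_vec p i"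
  note z = spd_mult_inv_vec[OF A ue(1)]
  have zi: "?z $ i = ?K $$ (i, i)" using K(1) i by simp
  have "lambda_min A * (?K $$ (i, i))\<^sup>2 \<le> lambda_min A * (?z \<bullet> ?z)"
    unfolding scalar_prod_self_eq[OF z(3)] zi[symmetric] using lp i
    by (intro mult_left_mono member_le_sum) auto
  also have "\<dots> \<le> ?z \<bullet> (A *\<^sub>v ?z)" by (rule spectrum_bounds(2)[OF Ac(1,2) p z(3)])
  also have "\<dots> = ?K $$ (i, i)" unfolding z(1) using comm_scalar_prod[OF z(3) ue(1)] Kii by simp
  finally have "?K $$ (i, i) \<le> 1 / lambda_min A" using lp k by (simp add: power2_eq_square field_simps)
  then show "?K $$ (i, i) * A $$ (j, j) \<le> lambda_max A / lambda_min A"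
    using mult_mono[OF _ aj, of "?K $$ (i, i)" "1 / lambda_min A"] a k lp by simp
  show "0 \<le> ?K $$ (i, i) * A $$ (j, j)" using a k by simp
qed

section \<open>The upper bound\<close>

text \<open>\<open>(1 - t * d)\<^sup>2 - t\<^sup>2 * V\<close> is the ratio of the determinants of a
  tilted and the original precision matrix, with \<open>d\<close> a Kronecker delta. Writing it as
  \<open>1 - u\<close>, one has \<open>- ln (1 - u) / 2 \<le> u / 2 + u\<^sup>2\<close>; the linear
  part \<open>t d\<close> of \<open>u / 2\<close> cancels against the centring, and quadratic terms
  remain. The constant 20 is generous: it keeps \<open>\<bar>u\<bar> \<le> 1 / 2\<close> and absorbs
  \<open>9 * t\<^sup>2\<close>.\<close>

lemma mgf_scalar_bound:
  fixes t V d M1 :: real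
  assumes V: "0 \<le> V" "V \<le> M1" and d: "d = 0 \<or> d = 1" and t: "\<bar>t\<bar> * (M1 + 20) \<le> 1"
  shows "4 * t\<^sup>2 * V < 1" "0 < (1 - t * d)\<^sup>2 - t\<^sup>2 * V"
    "exp (- (t * d)) / sqrt ((1 - t * d)\<^sup>2 - t\<^sup>2 * V) \<le> exp ((M1 + 20) * t\<^sup>2 / 2)"
proof -
  define u where "u = 2 * t * d - t\<^sup>2 * d + t\<^sup>2 * V"
  have M1: "0 \<le> M1" using V by linarith
  have t20: "\<bar>t\<bar> * 20 \<le> 1" and tV: "\<bar>t\<bar> * (V + 1) \<le> 1"
  proof -
    have "\<bar>t\<bar> * 20 \<le> \<bar>t\<bar> * (M1 + 20)" using M1 by (intro mult_left_mono) auto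
    then show "\<bar>t\<bar> * 20 \<le> 1" using t by linarith
    have "\<bar>t\<bar> * (V + 1) \<le> \<bar>t\<bar> * (M1 + 20)" using V by (intro mult_left_mono) auto
    then show "\<bar>t\<bar> * (V + 1) \<le> 1" using t by linarith
  qed
  have tt: "t\<^sup>2 = \<bar>t\<bar> * \<bar>t\<bar>" by (simp add: power2_eq_square)
  have t2V: "t\<^sup>2 * (V + 1) \<le> \<bar>t\<bar>"
    using mult_left_mono[OF tV, of "\<bar>t\<bar>"] by (simp add: tt mult.assoc)
  have t2: "t\<^sup>2 \<ge> 0" by simp
  have t2V': "t\<^sup>2 * V + t\<^sup>2 \<le> \<bar>t\<bar>" using t2V by (simp add: distrib_left)
  show "4 * t\<^sup>2 * V < 1" using t2V' t20 t2 by linarith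
  have "0 \<le> t\<^sup>2 * V" using V by simp
  moreover have "0 \<le> t\<^sup>2 * d" "t\<^sup>2 * d \<le> t\<^sup>2" using d by auto
  ultimately have "\<bar>t\<^sup>2 * V - t\<^sup>2 * d\<bar> \<le> \<bar>t\<bar>" using t2V' by linarith
  moreover have "\<bar>2 * t * d\<bar> \<le> 2 * \<bar>t\<bar>" using d by auto
  ultimately have u: "\<bar>u\<bar> \<le> 3 * \<bar>t\<bar>" unfolding u_def by linarith
  have D: "(1 - t * d)\<^sup>2 - t\<^sup>2 * V = 1 - u"
    using d by (auto simp: u_def power2_eq_square algebra_simps)
  have u2: "\<bar>u\<bar> \<le> 1/2" using u t20 by linarith
  then show "0 < (1 - t * d)\<^sup>2 - t\<^sup>2 * V" unfolding D by linarith
  have "\<bar>ln (1 + (- u)) - (- u)\<bar> \<le> 2 * (- u)\<^sup>2"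
    by (rule abs_ln_one_plus_x_minus_x_bound) (use u2 in simp)
  then have l: "- u - 2 * u\<^sup>2 \<le> ln (1 - u)" by simp
  have "u\<^sup>2 \<le> (3 * \<bar>t\<bar>)\<^sup>2" using u by (metis abs_ge_zero power2_abs power_mono)
  then have u9: "u\<^sup>2 \<le> 9 * t\<^sup>2" by (simp add: power_mult_distrib)
  have pos: "0 < 1 - u" using u2 by linarith
  have "exp (- (t * d)) / sqrt (1 - u) = exp (- (t * d) - ln (1 - u) / 2)"
    using pos by (simp add: exp_diff ln_sqrt[symmetric] real_sqrt_gt_zero)
  also have "\<dots> \<le> exp ((M1 + 20) * t\<^sup>2 / 2)"
  proof -
    have "- (t * d) - ln (1 - u) / 2 \<le> - (t * d) + u / 2 + u\<^sup>2" using l by linarith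
    also have "\<dots> \<le> t\<^sup>2 * V / 2 - t\<^sup>2 * d / 2 + 9 * t\<^sup>2"
    proof -
      have "u / 2 = t * d - t\<^sup>2 * d / 2 + t\<^sup>2 * V / 2" by (simp add: u_def field_simps)
      then show ?thesis using u9 by linarith
    qed
    also have "\<dots> \<le> (M1 + 20) * t\<^sup>2 / 2"
    proof -
      have "t\<^sup>2 * V \<le> t\<^sup>2 * M1" using V by (intro mult_left_mono) auto
      moreover have "0 \<le> t\<^sup>2 * d" using d by auto
      moreover have "(M1 + 20) * t\<^sup>2 / 2 = t\<^sup>2 * M1 / 2 + 10 * t\<^sup>2" by (simp add: algebra_simps)
      ultimately show ?thesis using t2 by linarith
    qed
    finally show ?thesis by simp
  qed
  finally show "exp (- (t * d)) / sqrt ((1 - t * d)\<^sup>2 - t\<^sup>2 * V) \<le> exp ((M1 + 20) * t\<^sup>2 / 2)"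
    unfolding D .
qed

text \<open>The entry \<open>(i, j)\<close> of \<open>(x - \<mu>) (x - \<mu>)^T A - 1\<close>; it is
  centred when \<open>x\<close> has mean \<open>\<mu>\<close> and precision matrix
  \<open>A\<close>.\<close>

definition resid :: "nat \<Rightarrow> real vec \<Rightarrow> real mat \<Rightarrow> nat \<Rightarrow> nat \<Rightarrow> (nat \<Rightarrow> real) \<Rightarrow> real" where
  "resid p \<mu> A i j x = (x i - \<mu> $ i) * (\<Sum>k<p. A $$ (k, j) * (x k - \<mu> $ k)) - (if i = j then 1 else 0)"

lemma measurable_resid [measurable]:
  "i < p \<Longrightarrow> resid p \<mu> A i j \<in> borel_measurable (\<Pi>\<^sub>M i\<in>{..<p}. lborel)"
  unfolding resid_def by measurable auto

text \<open>The exponent is a quadratic form in \<open>x - \<mu>\<close>, so the tilted density is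
  Gaussian with the precision updated along \<open>u = e_i\<close> and \<open>w = A e_j\<close>. The
  moment is then a determinant ratio that involves only \<open>u \<bullet> K u = K_ii\<close>,
  \<open>w \<bullet> K w = A_jj\<close> and \<open>u \<bullet> K w\<close>, the Kronecker delta,
  where \<open>K\<close> is the inverse of \<open>A\<close>.\<close>

lemma nn_integral_exp_resid:
  assumes A: "symmetric_pos_def p A" and m: "\<mu> \<in> carrier_vec p" and i: "i < p" and j: "j < p"
    and V: "mat_inv A $$ (i, i) * A $$ (j, j) \<le> M1" "0 \<le> mat_inv A $$ (i, i) * A $$ (j, j)"
    and t: "\<bar>t\<bar> * (M1 + 20) \<le> 1"
  shows "(\<integral>\<^sup>+x. ennreal (gauss_density p \<mu> A x * exp (t * resid p \<mu> A i j x)) \<partial>(\<Pi>\<^sub>M i\<in>{..<p}. lborel))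
     \<le> ennreal (exp ((M1 + 20) * t\<^sup>2 / 2))"
proof -
  let ?K = "mat_inv A"
  let ?V = "?K $$ (i, i) * A $$ (j, j)"
  define d :: real where "d = (if i = j then 1 else 0)"
  have d: "d = 0 \<or> d = 1" by (simp add: d_def)
  note Ac = spdD[OF A] and K = spdD[OF spd_mat_inv[OF A]]
  let ?u = "unit_vec p i :: real vec" and ?w = "A *\<^sub>v unit_vec p j"
  have u: "?u \<in> carrier_vec p" by simp
  have ej: "unit_vec p j \<in> carrier_vec p" by simp
  have w: "?w \<in> carrier_vec p" using mult_mat_vec_carrier[OF Ac(1) ej] .
  have Kw: "?K *\<^sub>v ?w = unit_vec p j" using spd_mult_inv_vec(2)[OF A ej] .
  have uKu: "?u \<bullet> (?K *\<^sub>v ?u) = ?K $$ (i, i)" using K(1) i by simp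
  have wKw: "?w \<bullet> (?K *\<^sub>v ?w) = A $$ (j, j)" unfolding Kw using Ac(1) j w by simp
  have uKw: "?u \<bullet> (?K *\<^sub>v ?w) = d" unfolding Kw using i j by (simp add: d_def)
  note b = mgf_scalar_bound[OF V(2,1) d t]
  let ?B = "sym_update p A (- t) ?u ?w"
  have B: "symmetric_pos_def p ?B"
    by (rule spd_sym_update[OF A u w]) (use b(1) in \<open>simp only: uKu wKw power2_minus mult.assoc\<close>)
  have detB: "Determinant.det ?B = Determinant.det A * ((1 - t * d)\<^sup>2 - t\<^sup>2 * ?V)"
    unfolding det_sym_update[OF A u w] uKu wKw uKw by (simp add: mult.assoc)
  have eq: "gauss_density p \<mu> A x * exp (t * resid p \<mu> A i j x) =
     (exp (- (t * d)) * sqrt (Determinant.det A)) / sqrt ((2 * pi) ^ p) * exp (- (1/2) * ((vec p x - \<mu>) \<bullet> (?B *\<^sub>v (vec p x - \<mu>))))" for x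
  proof -
    let ?v = "vec p x - \<mu>"
    have v: "?v \<in> carrier_vec p" using m by auto
    have uv: "?u \<bullet> ?v = x i - \<mu> $ i" using i m v by simp
    have "?w \<bullet> ?v = unit_vec p j \<bullet> (A *\<^sub>v ?v)"
      using comm_scalar_prod[OF w v] symmetric_bilinear[OF Ac(1,2) v ej] by simp
    also have "\<dots> = (A *\<^sub>v ?v) $ j"
      using scalar_prod_left_unit[OF mult_mat_vec_carrier[OF Ac(1) v] j] .
    also have "\<dots> = (\<Sum>k<p. A $$ (j, k) * (x k - \<mu> $ k))"
      using Ac(1) j m by (simp add: scalar_prod_def atLeast0LessThan)
    also have "\<dots> = (\<Sum>k<p. A $$ (k, j) * (x k - \<mu> $ k))"
      using spd_gen_quad(2)[OF A _ j] by (intro sum.cong) auto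
    finally have wv: "?w \<bullet> ?v = (\<Sum>k<p. A $$ (k, j) * (x k - \<mu> $ k))" .
    have q: "?v \<bullet> (?B *\<^sub>v ?v) = ?v \<bullet> (A *\<^sub>v ?v) - 2 * (t * (resid p \<mu> A i j x + d))"
      unfolding quadratic_form_sym_update[OF Ac(1) u w v] uv wv by (simp add: resid_def d_def)
    have "exp (- (1/2) * (?v \<bullet> (?B *\<^sub>v ?v))) = exp (- (1/2) * (?v \<bullet> (A *\<^sub>v ?v))) * exp (t * resid p \<mu> A i j x) * exp (t * d)"
      unfolding q exp_add[symmetric] by (simp add: algebra_simps)
    moreover have "exp (- (t * d)) * exp (t * d) = 1" by (simp add: exp_add[symmetric])
    ultimately show ?thesis by (simp add: gauss_density_def real_sqrt_divide mult_ac)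
  qed
  have "(\<integral>\<^sup>+x. ennreal (gauss_density p \<mu> A x * exp (t * resid p \<mu> A i j x)) \<partial>(\<Pi>\<^sub>M i\<in>{..<p}. lborel)) =
     ennreal ((exp (- (t * d)) * sqrt (Determinant.det A)) / sqrt (Determinant.det ?B))"
    unfolding eq using spd_det_pos[OF A] by (intro nn_integral_gauss_ratio[OF A B m]) auto
  also have "(exp (- (t * d)) * sqrt (Determinant.det A)) / sqrt (Determinant.det ?B) = exp (- (t * d)) / sqrt ((1 - t * d)\<^sup>2 - t\<^sup>2 * ?V)"
    using spd_det_pos[OF A] by (simp add: detB real_sqrt_mult)
  finally show ?thesis using b(3) by (simp add: ennreal_leI)
qed

lemma nn_integral_sample_law:
  assumes A: "symmetric_pos_def p A" and m: "\<mu> \<in> carrier_vec p"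
    and h: "h \<in> borel_measurable (sample_space n p)"
  shows "(\<integral>\<^sup>+X. h X \<partial>sample_law n p \<mu> (mat_inv A)) = (\<integral>\<^sup>+X. ennreal (sample_density n p \<mu> A X) * h X \<partial>sample_space n p)"
  unfolding sample_law_density[OF A m]
  using measurable_sample_density[OF spdD(1)[OF A] m] h by (intro nn_integral_density) auto

lemma nn_integral_exp_sum_resid:
  assumes A: "symmetric_pos_def p A" and m: "\<mu> \<in> carrier_vec p" and i: "i < p" and j: "j < p"
    and V: "mat_inv A $$ (i, i) * A $$ (j, j) \<le> M1" "0 \<le> mat_inv A $$ (i, i) * A $$ (j, j)"
    and t: "\<bar>t\<bar> * (M1 + 20) \<le> 1"
  shows "(\<integral>\<^sup>+X. ennreal (exp (t * (\<Sum>l<n. resid p \<mu> A i j (X l)))) \<partial>sample_law n p \<mu> (mat_inv A))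
     \<le> ennreal (exp (real n * ((M1 + 20) * t\<^sup>2 / 2)))"
proof -
  let ?h = "\<lambda>x. gauss_density p \<mu> A x * exp (t * resid p \<mu> A i j x)"
  have hm: "(\<lambda>x. ennreal (?h x)) \<in> borel_measurable (\<Pi>\<^sub>M i\<in>{..<p}. lborel)"
    using measurable_resid[OF i, of \<mu> A j] measurable_gauss_density[OF spdD(1)[OF A] m]
    by (intro measurable_compose[OF _ measurable_ennreal] borel_measurable_times
        measurable_compose[OF _ borel_measurable_exp] borel_measurable_const) auto
  have comp: "(\<lambda>X. resid p \<mu> A i j (X l)) \<in> borel_measurable (sample_space n p)" if "l < n" for l
    using measurable_compose[OF measurable_component_singleton[of l "{..<n}"] measurable_resid[OF i, of \<mu> A j]] that by simp
  have "(\<integral>\<^sup>+X. ennreal (exp (t * (\<Sum>l<n. resid p \<mu> A i j (X l)))) \<partial>sample_law n p \<mu> (mat_inv A)) =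
    (\<integral>\<^sup>+X. ennreal (sample_density n p \<mu> A X) * ennreal (exp (t * (\<Sum>l<n. resid p \<mu> A i j (X l)))) \<partial>sample_space n p)"
    using comp by (intro nn_integral_sample_law[OF A m]) auto
  also have "\<dots> = (\<integral>\<^sup>+X. (\<Prod>l<n. ennreal (?h (X l))) \<partial>sample_space n p)"
  proof (rule nn_integral_cong)
    fix X :: "nat \<Rightarrow> nat \<Rightarrow> real"
    have "sample_density n p \<mu> A X * exp (t * (\<Sum>l<n. resid p \<mu> A i j (X l))) = (\<Prod>l<n. ?h (X l))"
      by (simp add: sample_density_def sum_distrib_left exp_sum prod.distrib)
    moreover have "(\<Prod>l<n. ennreal (?h (X l))) = ennreal (\<Prod>l<n. ?h (X l))"
      using gauss_density_pos[OF A] by (intro prod_ennreal) (simp add: less_imp_le)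
    ultimately show "ennreal (sample_density n p \<mu> A X) * ennreal (exp (t * (\<Sum>l<n. resid p \<mu> A i j (X l)))) = (\<Prod>l<n. ennreal (?h (X l)))"
      using sample_density_pos[OF A, of n \<mu> X] by (simp add: ennreal_mult[symmetric])
  qed
  also have "\<dots> = (\<integral>\<^sup>+x. ennreal (?h x) \<partial>(\<Pi>\<^sub>M i\<in>{..<p}. lborel)) ^ n"
    by (rule nn_integral_sample_prod[OF hm])
  also have "\<dots> \<le> ennreal (exp ((M1 + 20) * t\<^sup>2 / 2)) ^ n"
    using nn_integral_exp_resid[OF A m i j V t] by (rule power_mono) simp
  also have "\<dots> = ennreal (exp (real n * ((M1 + 20) * t\<^sup>2 / 2)))"
    by (simp only: ennreal_power[OF exp_ge_zero] exp_of_nat_mult)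
  finally show ?thesis .
qed

section \<open>Stability within the parameter class\<close>

lemma G0_D:
  assumes "A \<in> G0 p M1 k M" "0 < p"
  shows "symmetric_pos_def p A" "A \<in> carrier_mat p p"
    "\<And>i j. i < p \<Longrightarrow> j < p \<Longrightarrow> A $$ (i, j) = A $$ (j, i)"
    "\<And>i. i < p \<Longrightarrow> (\<Sum>j<p. \<bar>A $$ (i, j)\<bar>) \<le> M"
    "\<And>j. j < p \<Longrightarrow> (\<Sum>i<p. \<bar>A $$ (i, j)\<bar>) \<le> M"
    "\<And>i. i < p \<Longrightarrow> real (card {j. j < p \<and> A $$ (i, j) \<noteq> 0}) \<le> k"
    "\<And>j. j < p \<Longrightarrow> real (card {i. i < p \<and> A $$ (i, j) \<noteq> 0}) \<le> k"
    "\<And>i j. i < p \<Longrightarrow> j < p \<Longrightarrow> mat_inv A $$ (i, i) * A $$ (j, j) \<le> M1"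
proof -
  show spd: "symmetric_pos_def p A" using assms by (simp add: G0_def)
  show c: "A \<in> carrier_mat p p" by (rule spdD(1)[OF spd])
  show s: "A $$ (i, j) = A $$ (j, i)" if "i < p" "j < p" for i j using spd_gen_quad(2)[OF spd that] .
  show col: "(\<Sum>i<p. \<bar>A $$ (i, j)\<bar>) \<le> M" if "j < p" for j
    using column_sum_le_lw_mat_norm[OF c that] assms by (simp add: G0_def)
  show "(\<Sum>j<p. \<bar>A $$ (i, j)\<bar>) \<le> M" if "i < p" for i
  proof -
    have "(\<Sum>j<p. \<bar>A $$ (i, j)\<bar>) = (\<Sum>j<p. \<bar>A $$ (j, i)\<bar>)"
      using s[OF that] by (intro sum.cong) auto
    then show ?thesis using col[OF that] by simp
  qed
  show "mat_inv A $$ (i, i) * A $$ (j, j) \<le> M1" if "i < p" "j < p" for i j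
    using diag_product_le_condition_number(1)[OF spd that] assms by (simp add: G0_def)
qed (use assms in \<open>simp_all add: G0_def\<close>)

lemma sum_abs_le_of_card:
  fixes f :: "'a \<Rightarrow> real"
  assumes "finite I" "\<And>i. i \<in> I \<Longrightarrow> \<bar>f i\<bar> \<le> m" "real (card {i \<in> I. f i \<noteq> 0}) \<le> c" "0 \<le> m"
  shows "(\<Sum>i\<in>I. \<bar>f i\<bar>) \<le> c * m"
proof -
  have "(\<Sum>i\<in>I. \<bar>f i\<bar>) = (\<Sum>i\<in>{i \<in> I. f i \<noteq> 0}. \<bar>f i\<bar>)"
    using assms(1) by (intro sum.mono_neutral_right) auto
  also have "\<dots> \<le> real (card {i \<in> I. f i \<noteq> 0}) * m"
    using assms(2) by (intro sum_bounded_above) auto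
  also have "\<dots> \<le> c * m" using assms(3,4) by (rule mult_right_mono)
  finally show ?thesis .
qed

lemma card_diff_nonzero_le:
  fixes a b :: "nat \<Rightarrow> real"
  assumes "real (card {j. j < p \<and> a j \<noteq> 0}) \<le> k" "real (card {j. j < p \<and> b j \<noteq> 0}) \<le> k"
  shows "real (card {j \<in> {..<p}. a j - b j \<noteq> 0}) \<le> 2 * k"
proof -
  have "{j \<in> {..<p}. a j - b j \<noteq> 0} \<subseteq> {j. j < p \<and> a j \<noteq> 0} \<union> {j. j < p \<and> b j \<noteq> 0}" by auto
  then have "card {j \<in> {..<p}. a j - b j \<noteq> 0} \<le> card {j. j < p \<and> a j \<noteq> 0} + card {j. j < p \<and> b j \<noteq> 0}"
    by (intro order_trans[OF card_mono card_Un_le]) auto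
  then show ?thesis using assms by linarith
qed

text \<open>With \<open>D = B - A\<close> one has \<open>D = (1 - A S) D + A S D\<close>: the second summand is small entrywise since
  \<open>S B\<close> and \<open>S A\<close> are both close to the identity, and the first is absorbed because \<open>D\<close> is sparse.\<close>

lemma G0_close:
  assumes A: "A \<in> G0 p M1 k M" and B: "B \<in> G0 p M1 k M" and p: "0 < p" and w: "1 \<le> w"
    and s: "\<And>i j. i < p \<Longrightarrow> j < p \<Longrightarrow> s i j = s j i"
    and SA: "\<And>i j. i < p \<Longrightarrow> j < p \<Longrightarrow> \<bar>(\<Sum>l<p. s i l * A $$ (l, j)) - (if i = j then 1 else 0)\<bar> \<le> 2 * r"
    and SB: "\<And>i j. i < p \<Longrightarrow> j < p \<Longrightarrow> \<bar>(\<Sum>l<p. s i l * B $$ (l, j)) - (if i = j then 1 else 0)\<bar> \<le> 2 * r"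
    and r: "0 \<le> r" and kr: "8 * k * r \<le> 1" and k: "0 \<le> k" and M: "0 \<le> M"
  shows "lw_mat_norm w (B - A) \<le> 16 * k * M * r"
proof -
  note a = G0_D[OF A p] and b = G0_D[OF B p]
  define D where "D i j = B $$ (i, j) - A $$ (i, j)" for i j
  define m where "m = Max ((\<lambda>(i, j). \<bar>D i j\<bar>) ` ({..<p} \<times> {..<p}))"
  have fin: "finite ((\<lambda>(i, j). \<bar>D i j\<bar>) ` ({..<p} \<times> {..<p}))" by simp
  have ne: "((\<lambda>(i, j). \<bar>D i j\<bar>) ` ({..<p} \<times> {..<p})) \<noteq> {}" using p by (auto simp: lessThan_empty_iff)
  have Dm: "\<bar>D i j\<bar> \<le> m" if "i < p" "j < p" for i j
    unfolding m_def by (rule Max_ge[OF fin]) (use that in force)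
  have m0: "0 \<le> m" using Dm[OF p p] by linarith
  have row: "(\<Sum>j<p. \<bar>D i j\<bar>) \<le> 2 * k * m" if "i < p" for i
    using Dm[OF that] card_diff_nonzero_le[OF b(6)[OF that] a(6)[OF that]] m0
    by (intro sum_abs_le_of_card) (auto simp: D_def)
  have col: "(\<Sum>i<p. \<bar>D i j\<bar>) \<le> 2 * k * m" if "j < p" for j
    using Dm[OF _ that] card_diff_nonzero_le[OF b(7)[OF that] a(7)[OF that]] m0
    by (intro sum_abs_le_of_card) (auto simp: D_def)
  have entry: "\<bar>D i j\<bar> \<le> 4 * M * r + m / 2" if i: "i < p" and j: "j < p" for i j
  proof -
    \<comment> \<open>\<open>e\<close> is column \<open>j\<close> of \<open>S D\<close> and
      \<open>f\<close> is row \<open>i\<close> of \<open>1 - A S\<close>, for the two summands of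
      \<open>D\<close>.\<close>
    define e where "e l = (\<Sum>q<p. s l q * D q j)" for l
    define f where "f q = (if i = q then 1 else 0) - (\<Sum>l<p. A $$ (i, l) * s l q)" for q
    have el: "\<bar>e l\<bar> \<le> 4 * r" if "l < p" for l
    proof -
      have "e l = ((\<Sum>q<p. s l q * B $$ (q, j)) - (if l = j then 1 else 0)) - ((\<Sum>q<p. s l q * A $$ (q, j)) - (if l = j then 1 else 0))"
        by (simp add: e_def D_def right_diff_distrib sum_subtractf)
      then show ?thesis using SA[OF that j] SB[OF that j] by linarith
    qed
    have fq: "\<bar>f q\<bar> \<le> 2 * r" if "q < p" for q
    proof -
      have "(\<Sum>l<p. A $$ (i, l) * s l q) = (\<Sum>l<p. s q l * A $$ (l, i))"
        using a(3)[OF i] s[OF that] by (intro sum.cong) auto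
      then show ?thesis using SA[OF that i] by (auto simp: f_def abs_minus_commute)
    qed
    have "(\<Sum>l<p. A $$ (i, l) * e l) = (\<Sum>q<p. (\<Sum>l<p. A $$ (i, l) * s l q) * D q j)"
      unfolding e_def sum_distrib_left sum_distrib_right by (subst sum.swap) (simp add: mult.assoc)
    moreover have "(\<Sum>q<p. (if i = q then 1 else 0) * D q j) = D i j"
      using i by (simp add: if_distrib[of "\<lambda>x. x * _"] cong: if_cong)
    ultimately have "D i j = (\<Sum>q<p. f q * D q j) + (\<Sum>l<p. A $$ (i, l) * e l)"
      by (simp add: f_def left_diff_distrib sum_subtractf)
    moreover have "\<bar>\<Sum>q<p. f q * D q j\<bar> \<le> (\<Sum>q<p. 2 * r * \<bar>D q j\<bar>)"
      using fq by (intro order_trans[OF sum_abs] sum_mono) (auto simp: abs_mult intro: mult_right_mono)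
    moreover have "(\<Sum>q<p. 2 * r * \<bar>D q j\<bar>) \<le> 2 * r * (2 * k * m)"
      unfolding sum_distrib_left[symmetric] using col[OF j] r by (intro mult_left_mono) auto
    \<comment> \<open>The bound on \<open>k r\<close> enters only here: \<open>4 k r m\<close> is at
      most half of the largest entry \<open>m\<close> and is absorbed when the maximum is
      taken.\<close>
    moreover have "2 * r * (2 * k * m) \<le> m / 2"
      using mult_right_mono[OF kr m0] by (simp add: mult_ac)
    moreover have "\<bar>\<Sum>l<p. A $$ (i, l) * e l\<bar> \<le> (\<Sum>l<p. \<bar>A $$ (i, l)\<bar> * (4 * r))"
      using el by (intro order_trans[OF sum_abs] sum_mono) (auto simp: abs_mult intro: mult_left_mono)
    moreover have "(\<Sum>l<p. \<bar>A $$ (i, l)\<bar> * (4 * r)) \<le> M * (4 * r)"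
      unfolding sum_distrib_right[symmetric] using a(4)[OF i] r by (intro mult_right_mono) auto
    moreover have "M * (4 * r) = 4 * M * r" by simp
    ultimately show ?thesis by linarith
  qed
  have "m \<le> 4 * M * r + m / 2"
    unfolding m_def using entry by (intro Max.boundedI[OF fin ne]) (auto simp: m_def)
  then have m: "m \<le> 8 * M * r" by simp
  have C: "2 * k * m \<le> 16 * k * M * r" using mult_left_mono[OF m, of "2 * k"] k by (simp add: mult_ac)
  have BA: "B - A \<in> carrier_mat p p" using a(2) by (rule minus_carrier_mat)
  have ix: "(B - A) $$ (i, j) = D i j" if "i < p" "j < p" for i j
    using a(2) b(2) that by (simp add: D_def)
  show ?thesis
  proof (rule lw_mat_norm_le[OF BA p w])
    show "(\<Sum>j<p. \<bar>(B - A) $$ (i, j)\<bar>) \<le> 16 * k * M * r" if "i < p" for i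
    proof -
      have "(\<Sum>j<p. \<bar>(B - A) $$ (i, j)\<bar>) = (\<Sum>j<p. \<bar>D i j\<bar>)" using ix[OF that] by simp
      then show ?thesis using row[OF that] C by linarith
    qed
    show "(\<Sum>i<p. \<bar>(B - A) $$ (i, j)\<bar>) \<le> 16 * k * M * r" if "j < p" for j
    proof -
      have "(\<Sum>i<p. \<bar>(B - A) $$ (i, j)\<bar>) = (\<Sum>i<p. \<bar>D i j\<bar>)" using ix[OF _ that] by simp
      then show ?thesis using col[OF that] C by linarith
    qed
  qed
qed

section \<open>The rounded estimator\<close>

definition emp_cov :: "nat \<Rightarrow> real vec \<Rightarrow> (nat \<Rightarrow> nat \<Rightarrow> real) \<Rightarrow> nat \<Rightarrow> nat \<Rightarrow> real" where
  "emp_cov n \<mu> X i j = (\<Sum>l<n. (X l i - \<mu> $ i) * (X l j - \<mu> $ j)) / real n"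

text \<open>Nested lists of integers form a countable type, so codes can carry the discrete
  sigma-algebra.\<close>

definition grid_code :: "nat \<Rightarrow> nat \<Rightarrow> real vec \<Rightarrow> real \<Rightarrow> (nat \<Rightarrow> nat \<Rightarrow> real) \<Rightarrow> int list list" where
  "grid_code n p \<mu> h X = map (\<lambda>i. map (\<lambda>j. \<lfloor>emp_cov n \<mu> X i j / h\<rfloor>) [0..<p]) [0..<p]"

text \<open>Rounding the empirical covariance to a grid makes the estimator countably valued, so that it is
  measurable no matter how the constrained problem is solved.\<close>

definition grid_feasible :: "nat \<Rightarrow> real mat set \<Rightarrow> real \<Rightarrow> real \<Rightarrow> int list list \<Rightarrow> real mat \<Rightarrow> bool" where
  "grid_feasible p G h r L B \<longleftrightarrow> B \<in> G \<and> (\<forall>i<p. \<forall>j<p.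
     \<bar>(\<Sum>l<p. h * of_int (L ! i ! l) * B $$ (l, j)) - (if i = j then 1 else 0)\<bar> \<le> 2 * r)"

text \<open>The default zero has row and column sums at most \<open>M\<close>, like the members of
  the class, so the loss stays below \<open>2 * M\<close> also when no feasible matrix
  exists.\<close>

definition grid_estimator :: "nat \<Rightarrow> real mat set \<Rightarrow> real \<Rightarrow> real \<Rightarrow> int list list \<Rightarrow> real mat" where
  "grid_estimator p G h r L =
    (if \<exists>B. grid_feasible p G h r L B then SOME B. grid_feasible p G h r L B else 0\<^sub>m p p)"

lemma grid_estimator_feasible:
  assumes "grid_feasible p G h r L B"
  shows "grid_feasible p G h r L (grid_estimator p G h r L)"
proof -
  have "grid_feasible p G h r L (SOME B. grid_feasible p G h r L B)" using assms by (rule someI)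
  then show ?thesis using assms by (auto simp: grid_estimator_def)
qed

lemma grid_estimator_cases:
  "grid_estimator p G h r L \<in> G \<or> grid_estimator p G h r L = 0\<^sub>m p p"
proof (cases "\<exists>B. grid_feasible p G h r L B")
  case True
  then show ?thesis using grid_estimator_feasible grid_feasible_def by blast
qed (simp add: grid_estimator_def)

lemma measurable_map_count_space:
  fixes f :: "'x \<Rightarrow> 'a \<Rightarrow> 'b::countable"
  assumes "\<And>a. a \<in> set xs \<Longrightarrow> (\<lambda>X. f X a) \<in> measurable N (count_space UNIV)"
  shows "(\<lambda>X. map (f X) xs) \<in> measurable N (count_space UNIV)"
  using assms
proof (induction xs)
  case (Cons a xs)
  have "(\<lambda>X. map (f X) xs) \<in> measurable N (count_space UNIV)" using Cons by simp
  then have "(\<lambda>X. b # map (f X) xs) \<in> measurable N (count_space UNIV)" for b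
    by (rule measurable_compose) simp
  moreover have "(\<lambda>X. f X a) \<in> measurable N (count_space UNIV)" using Cons.prems[of a] by simp
  ultimately have "(\<lambda>X. f X a # map (f X) xs) \<in> measurable N (count_space UNIV)"
    by (rule measurable_compose_countable)
  then show ?case by simp
qed simp

lemma measurable_emp_cov:
  assumes "i < p" "j < p"
  shows "(\<lambda>X. emp_cov n \<mu> X i j) \<in> borel_measurable (\<Pi>\<^sub>M l\<in>{..<n}. \<Pi>\<^sub>M i\<in>{..<p}. borel)"
proof -
  have [measurable]: "(\<lambda>X. X l i) \<in> borel_measurable (\<Pi>\<^sub>M l\<in>{..<n}. \<Pi>\<^sub>M i\<in>{..<p}. (borel :: real measure))" if "l < n" "i < p" for l i
    using measurable_compose[OF measurable_component_singleton[of l "{..<n}" "\<lambda>_. \<Pi>\<^sub>M i\<in>{..<p}. (borel :: real measure)"]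
        measurable_component_singleton[of i "{..<p}" "\<lambda>_. borel :: real measure"]] that by simp
  show ?thesis unfolding emp_cov_def using assms by (intro borel_measurable_divide borel_measurable_sum borel_measurable_times borel_measurable_diff) auto
qed

lemma grid_estimator_in_estimators:
  assumes G: "G \<subseteq> carrier_mat p p"
  shows "(\<lambda>X. grid_estimator p G h r (grid_code n p \<mu> h X)) \<in> estimators n p"
proof -
  have c: "grid_estimator p G h r L \<in> carrier_mat p p" for L
    using grid_estimator_cases[of p G h r L] G by auto
  have code: "grid_code n p \<mu> h \<in> measurable (\<Pi>\<^sub>M l\<in>{..<n}. \<Pi>\<^sub>M i\<in>{..<p}. borel) (count_space UNIV)"
    unfolding grid_code_def[abs_def]
  proof (intro measurable_map_count_space)
    fix i j assume "i \<in> set [0..<p]" "j \<in> set [0..<p]"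
    then have "(\<lambda>X. emp_cov n \<mu> X i j / h) \<in> borel_measurable (\<Pi>\<^sub>M l\<in>{..<n}. \<Pi>\<^sub>M i\<in>{..<p}. borel)"
      using measurable_emp_cov[of i p j n \<mu>] by (intro borel_measurable_divide) auto
    then show "(\<lambda>X. \<lfloor>emp_cov n \<mu> X i j / h\<rfloor>) \<in> measurable (\<Pi>\<^sub>M l\<in>{..<n}. \<Pi>\<^sub>M i\<in>{..<p}. borel) (count_space UNIV)"
      by (rule measurable_compose) (rule measurable_real_floor)
  qed
  have "(\<lambda>X. grid_estimator p G h r (grid_code n p \<mu> h X) $$ (i, j)) \<in> borel_measurable (\<Pi>\<^sub>M l\<in>{..<n}. \<Pi>\<^sub>M i\<in>{..<p}. borel)" for i j
    using measurable_compose[OF code, of "\<lambda>L. grid_estimator p G h r L $$ (i, j)" borel] by simp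
  then show ?thesis using c by (simp add: estimators_def)
qed

lemma emp_cov_mult:
  assumes n: "0 < n"
  shows "(\<Sum>l<p. emp_cov n \<mu> X i l * A $$ (l, j)) - (if i = j then 1 else 0) = (\<Sum>l<n. resid p \<mu> A i j (X l)) / real n"
proof -
  have "emp_cov n \<mu> X i l * A $$ (l, j) = (\<Sum>q<n. (X q i - \<mu> $ i) * (A $$ (l, j) * (X q l - \<mu> $ l))) / real n" for l
    unfolding emp_cov_def times_divide_eq_left sum_distrib_right by (simp add: mult_ac)
  then have "(\<Sum>l<p. emp_cov n \<mu> X i l * A $$ (l, j)) = (\<Sum>l<p. \<Sum>q<n. (X q i - \<mu> $ i) * (A $$ (l, j) * (X q l - \<mu> $ l))) / real n"
    by (simp add: sum_divide_distrib)
  also have "(\<Sum>l<p. \<Sum>q<n. (X q i - \<mu> $ i) * (A $$ (l, j) * (X q l - \<mu> $ l))) = (\<Sum>q<n. (X q i - \<mu> $ i) * (\<Sum>l<p. A $$ (l, j) * (X q l - \<mu> $ l)))"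
    unfolding sum_distrib_left by (rule sum.swap)
  finally show ?thesis using n by (simp add: resid_def sum_subtractf diff_divide_distrib)
qed

text \<open>The mesh \<open>r / M\<close> is chosen so that rounding changes the entries of
  \<open>S A\<close> by at most \<open>r\<close>, as the column sums of \<open>A\<close> are at most
  \<open>M\<close>. With the deviation \<open>r\<close> this explains the tolerance
  \<open>2 * r\<close>: the true matrix is feasible, and the matrix picked is as good by
  \<open>G0_close\<close>.\<close>

lemma grid_estimator_loss_good:
  assumes A: "A \<in> G0 p M1 k M" and p: "0 < p" and w: "1 \<le> w" and n: "0 < n"
    and r: "0 < r" and kr: "8 * k * r \<le> 1" and k: "0 \<le> k" and M: "0 < M"
    and good: "\<And>i j. i < p \<Longrightarrow> j < p \<Longrightarrow> \<bar>(\<Sum>l<n. resid p \<mu> A i j (X l)) / real n\<bar> \<le> r"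
  shows "lw_mat_norm w (grid_estimator p (G0 p M1 k M) (r / M) r (grid_code n p \<mu> (r / M) X) - A) \<le> 16 * k * M * r"
proof -
  define h where "h = r / M"
  have h: "0 < h" and hM: "h * M = r" using r M by (simp_all add: h_def)
  let ?L = "grid_code n p \<mu> h X"
  define s where "s i l = h * of_int (?L ! i ! l)" for i l
  note a = G0_D[OF A p]
  have L: "?L ! i ! l = \<lfloor>emp_cov n \<mu> X i l / h\<rfloor>" if "i < p" "l < p" for i l
    using that by (simp add: grid_code_def)
  have sym: "s i l = s l i" if "i < p" "l < p" for i l
    using L that by (simp add: s_def emp_cov_def mult.commute)
  have near: "\<bar>s i l - emp_cov n \<mu> X i l\<bar> \<le> h" if "i < p" "l < p" for i l
  proof -
    let ?y = "emp_cov n \<mu> X i l / h"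
    have "\<bar>of_int \<lfloor>?y\<rfloor> - ?y\<bar> \<le> 1" by linarith
    then have "h * \<bar>of_int \<lfloor>?y\<rfloor> - ?y\<bar> \<le> h * 1" using h by (intro mult_left_mono) auto
    moreover have "h * \<bar>of_int \<lfloor>?y\<rfloor> - ?y\<bar> = \<bar>h * (of_int \<lfloor>?y\<rfloor> - ?y)\<bar>" using h by (simp add: abs_mult)
    moreover have "h * (of_int \<lfloor>?y\<rfloor> - ?y) = s i l - emp_cov n \<mu> X i l"
      using h L[OF that] by (simp add: s_def right_diff_distrib)
    ultimately show ?thesis by (metis mult_1_right)
  qed
  have SA: "\<bar>(\<Sum>l<p. s i l * A $$ (l, j)) - (if i = j then 1 else 0)\<bar> \<le> 2 * r" if i: "i < p" and j: "j < p" for i j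
  proof -
    have "\<bar>\<Sum>l<p. (s i l - emp_cov n \<mu> X i l) * A $$ (l, j)\<bar> \<le> (\<Sum>l<p. h * \<bar>A $$ (l, j)\<bar>)"
      using near[OF i] by (intro order_trans[OF sum_abs] sum_mono) (auto simp: abs_mult intro: mult_right_mono)
    also have "\<dots> \<le> h * M" unfolding sum_distrib_left[symmetric] using a(5)[OF j] h by (intro mult_left_mono) auto
    also have "\<dots> = r" by (rule hM)
    finally have 1: "\<bar>(\<Sum>l<p. s i l * A $$ (l, j)) - (\<Sum>l<p. emp_cov n \<mu> X i l * A $$ (l, j))\<bar> \<le> r"
      by (simp add: left_diff_distrib sum_subtractf)
    have 2: "\<bar>(\<Sum>l<p. emp_cov n \<mu> X i l * A $$ (l, j)) - (if i = j then 1 else 0)\<bar> \<le> r"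
      using good[OF i j] unfolding emp_cov_mult[OF n] .
    from 1 2 show ?thesis by linarith
  qed
  let ?B = "grid_estimator p (G0 p M1 k M) h r ?L"
  have "grid_feasible p (G0 p M1 k M) h r ?L A"
    unfolding grid_feasible_def s_def[symmetric] using A SA by blast
  then have "grid_feasible p (G0 p M1 k M) h r ?L ?B" by (rule grid_estimator_feasible)
  then have BG: "?B \<in> G0 p M1 k M" and SB: "\<And>i j. i < p \<Longrightarrow> j < p \<Longrightarrow> \<bar>(\<Sum>l<p. s i l * ?B $$ (l, j)) - (if i = j then 1 else 0)\<bar> \<le> 2 * r"
    unfolding grid_feasible_def s_def[symmetric] by blast+
  show ?thesis unfolding h_def[symmetric]
    using G0_close[OF A BG p w sym SA SB less_imp_le[OF r] kr k less_imp_le[OF M]] .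
qed

section \<open>Risk of the estimators\<close>

lemma lw_mat_norm_diff_le:
  assumes A: "A \<in> G0 p M1 k M" and B: "B \<in> G0 p M1 k M \<or> B = 0\<^sub>m p p" and p: "0 < p" and w: "1 \<le> w"
  shows "lw_mat_norm w (B - A) \<le> 2 * M"
proof -
  note a = G0_D[OF A p]
  have "0 \<le> (\<Sum>j<p. \<bar>A $$ (0, j)\<bar>)" by (rule sum_nonneg) simp
  then have M: "0 \<le> M" using a(4)[OF p] by linarith
  have Bc: "B \<in> carrier_mat p p" using B G0_D(2)[OF _ p] by auto
  have br: "(\<Sum>j<p. \<bar>B $$ (i, j)\<bar>) \<le> M" if "i < p" for i
    using B G0_D(4)[OF _ p that, of B] M that by auto
  have bc: "(\<Sum>i<p. \<bar>B $$ (i, j)\<bar>) \<le> M" if "j < p" for j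
    using B G0_D(5)[OF _ p that, of B] M that by auto
  have BA: "B - A \<in> carrier_mat p p" using a(2) by (rule minus_carrier_mat)
  have ix: "\<bar>(B - A) $$ (i, j)\<bar> \<le> \<bar>B $$ (i, j)\<bar> + \<bar>A $$ (i, j)\<bar>" if "i < p" "j < p" for i j
    using a(2) Bc that by simp
  show ?thesis
  proof (rule lw_mat_norm_le[OF BA p w])
    fix i assume i: "i < p"
    have "(\<Sum>j<p. \<bar>(B - A) $$ (i, j)\<bar>) \<le> (\<Sum>j<p. \<bar>B $$ (i, j)\<bar> + \<bar>A $$ (i, j)\<bar>)"
      using ix[OF i] by (intro sum_mono) auto
    then show "(\<Sum>j<p. \<bar>(B - A) $$ (i, j)\<bar>) \<le> 2 * M"
      using br[OF i] a(4)[OF i] by (simp add: sum.distrib)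
  next
    fix j assume j: "j < p"
    have "(\<Sum>i<p. \<bar>(B - A) $$ (i, j)\<bar>) \<le> (\<Sum>i<p. \<bar>B $$ (i, j)\<bar> + \<bar>A $$ (i, j)\<bar>)"
      using ix[OF _ j] by (intro sum_mono) auto
    then show "(\<Sum>i<p. \<bar>(B - A) $$ (i, j)\<bar>) \<le> 2 * M"
      using bc[OF j] a(5)[OF j] by (simp add: sum.distrib)
  qed
qed



lemma prob_space_sample_law:
  assumes "symmetric_pos_def p A" "\<mu> \<in> carrier_vec p"
  shows "prob_space (sample_law n p \<mu> (mat_inv A))"
proof
  show "emeasure (sample_law n p \<mu> (mat_inv A)) (space (sample_law n p \<mu> (mat_inv A))) = 1"
    using nn_integral_sample_density[OF assms] measurable_sample_density[OF spdD(1)[OF assms(1)] assms(2)]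
    by (simp add: sample_law_density[OF assms] emeasure_density cong: nn_integral_cong)
qed

text \<open>Covers the finitely many \<open>n\<close> outside the asymptotic regime, where the
  deviations may be too large for \<open>8 * k * r \<le> 1\<close>.\<close>

lemma minimax_risk_trivial_upper:
  assumes p: "0 < p" and w: "1 \<le> w" and m: "\<mu> \<in> carrier_vec p" and M: "0 < M"
  shows "minimax_risk w n p \<mu> (G0 p M1 k M) \<le> ennreal (4 * M\<^sup>2)"
proof -
  have T: "(\<lambda>_. 0\<^sub>m p p) \<in> estimators n p" by (simp add: estimators_def)
  have "risk w n p \<mu> (\<lambda>_. 0\<^sub>m p p) A \<le> ennreal (4 * M\<^sup>2)" if A: "A \<in> G0 p M1 k M" for A
  proof -
    note a = G0_D[OF A p]
    interpret prob_space "sample_law n p \<mu> (mat_inv A)" by (rule prob_space_sample_law[OF a(1) m])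
    have c: "0\<^sub>m p p - A \<in> carrier_mat p p" using a(2) by (rule minus_carrier_mat)
    have "(lw_mat_norm w (0\<^sub>m p p - A))\<^sup>2 \<le> (2 * M)\<^sup>2"
      using lw_mat_norm_diff_le[OF A _ p w, of "0\<^sub>m p p"] lw_mat_norm_nonneg[OF c p w] by (intro power_mono) auto
    then have "(lw_mat_norm w (0\<^sub>m p p - A))\<^sup>2 \<le> 4 * M\<^sup>2" by (simp add: power_mult_distrib)
    then show ?thesis unfolding risk_def by (simp add: emeasure_space_1 ennreal_leI)
  qed
  then have "(SUP A\<in>G0 p M1 k M. risk w n p \<mu> (\<lambda>_. 0\<^sub>m p p) A) \<le> ennreal (4 * M\<^sup>2)"
    by (rule SUP_least)
  then show ?thesis unfolding minimax_risk_def using T by (rule INF_lower2[rotated])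
qed

text \<open>Chernoff's bound is put into the integrand: the squared loss is everywhere at most its
  value on the good event plus \<open>4 * M\<^sup>2\<close> times a sum of exponentials, one of
  which is at least one whenever some entry deviates by more than \<open>r\<close>. Integration then
  needs only the exponential moments.\<close>

lemma minimax_risk_upper:
  assumes p: "0 < p" and w: "1 \<le> w" and n: "0 < n" and m: "\<mu> \<in> carrier_vec p" and M: "0 < M" and M1: "0 \<le> M1"
    and r: "0 < r" "r \<le> 1" and kr: "8 * k * r \<le> 1" and k: "0 \<le> k"
  shows "minimax_risk w n p \<mu> (G0 p M1 k M) \<le>
    ennreal ((16 * k * M * r)\<^sup>2 + 4 * M\<^sup>2 * (real p)\<^sup>2 * (2 * exp (- real n * r\<^sup>2 / (2 * (M1 + 20)))))"
proof -
  let ?G = "G0 p M1 k M"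
  let ?T = "\<lambda>X. grid_estimator p ?G (r / M) r (grid_code n p \<mu> (r / M) X)"
  have T: "?T \<in> estimators n p"
    using G0_D(2)[OF _ p] by (intro grid_estimator_in_estimators) auto
  define W where "W = M1 + 20"
  have W: "20 \<le> W" using M1 by (simp add: W_def)
  \<comment> \<open>Minimises \<open>- t n r + n W t^2 / 2\<close>, with value
    \<open>- n r^2 / (2 W)\<close>; the range allowed for \<open>t\<close> is respected because
    \<open>r \<le> 1\<close>.\<close>
  define t where "t = r / W"
  have t: "0 < t" "\<bar>t\<bar> * W \<le> 1" "\<bar>- t\<bar> * W \<le> 1" using r W by (auto simp: t_def)
  define E where "E = exp (- real n * r\<^sup>2 / (2 * W))"
  let ?R = "(16 * k * M * r)\<^sup>2 + 4 * M\<^sup>2 * (real p)\<^sup>2 * (2 * E)"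
  have "risk w n p \<mu> ?T A \<le> ennreal ?R" if A: "A \<in> ?G" for A
  proof -
    note a = G0_D[OF A p]
    let ?P = "sample_law n p \<mu> (mat_inv A)"
    interpret prob_space ?P by (rule prob_space_sample_law[OF a(1) m])
    define z where "z i j X = (\<Sum>l<n. resid p \<mu> A i j (X l))" for i j X
    \<comment> \<open>Both tails of \<open>z i j\<close> at the level \<open>n r\<close>.\<close>
    define b where "b i j X = exp (- t * real n * r) * exp (t * z i j X) + exp (- t * real n * r) * exp (- t * z i j X)" for i j X
    have sets: "sets ?P = sets (sample_space n p)" by (simp add: sample_law_density[OF a(1) m])
    have zm: "z i j \<in> borel_measurable ?P" if "i < p" for i j
    proof -
      have "(\<lambda>X. resid p \<mu> A i j (X l)) \<in> borel_measurable (sample_space n p)" if "l < n" for l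
        using measurable_compose[OF measurable_component_singleton[of l "{..<n}"] measurable_resid[OF \<open>i < p\<close>, of \<mu> A j]] that by simp
      then have "z i j \<in> borel_measurable (sample_space n p)" unfolding z_def by (intro borel_measurable_sum) auto
      then show ?thesis by (simp only: measurable_cong_sets[OF sets refl])
    qed
    have b0: "0 \<le> b i j X" for i j X by (simp add: b_def)
    have bint: "(\<integral>\<^sup>+X. ennreal (b i j X) \<partial>?P) \<le> ennreal (2 * E)" if i: "i < p" and j: "j < p" for i j
    proof -
      have V0: "0 \<le> mat_inv A $$ (i, i) * A $$ (j, j)" by (rule diag_product_le_condition_number(2)[OF a(1) i j])
      have one: "(\<integral>\<^sup>+X. ennreal (exp (- t * real n * r) * exp (s * z i j X)) \<partial>?P) \<le> ennreal E" if s: "\<bar>s\<bar> * W \<le> 1" "s\<^sup>2 = t\<^sup>2" for s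
      proof -
        have "(\<integral>\<^sup>+X. ennreal (exp (- t * real n * r) * exp (s * z i j X)) \<partial>?P) = ennreal (exp (- t * real n * r)) * (\<integral>\<^sup>+X. ennreal (exp (s * z i j X)) \<partial>?P)"
          using zm[OF i, of j] by (subst nn_integral_cmult[symmetric]) (auto simp: ennreal_mult)
        also have "\<dots> \<le> ennreal (exp (- t * real n * r)) * ennreal (exp (real n * (W * s\<^sup>2 / 2)))"
          using nn_integral_exp_sum_resid[OF a(1) m i j a(8)[OF i j] V0, of s n] s
          by (intro mult_left_mono) (auto simp: z_def W_def)
        also have "\<dots> = ennreal (exp (- t * real n * r + real n * (W * s\<^sup>2 / 2)))"
          by (simp only: ennreal_mult[symmetric, OF exp_ge_zero exp_ge_zero] exp_add)
        also have "- t * real n * r + real n * (W * s\<^sup>2 / 2) = - real n * r\<^sup>2 / (2 * W)"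
          unfolding s(2) t_def using W by (simp add: power2_eq_square field_simps)
        finally show ?thesis by (simp add: E_def)
      qed
      have "(\<integral>\<^sup>+X. ennreal (b i j X) \<partial>?P) = (\<integral>\<^sup>+X. ennreal (exp (- t * real n * r) * exp (t * z i j X)) \<partial>?P) + (\<integral>\<^sup>+X. ennreal (exp (- t * real n * r) * exp (- t * z i j X)) \<partial>?P)"
        using zm[OF i, of j] by (subst nn_integral_add[symmetric]) (auto simp: b_def ennreal_plus)
      also have "\<dots> \<le> ennreal E + ennreal E"
        using t by (intro add_mono one) auto
      also have "\<dots> = ennreal (2 * E)" by (simp add: ennreal_plus[symmetric] E_def del: ennreal_plus)
      finally show ?thesis .
    qed
    have loss: "(lw_mat_norm w (?T X - A))\<^sup>2 \<le> (16 * k * M * r)\<^sup>2 + 4 * M\<^sup>2 * (\<Sum>i<p. \<Sum>j<p. b i j X)" for X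
    proof (cases "\<forall>i<p. \<forall>j<p. \<bar>z i j X / real n\<bar> \<le> r")
      case True
      have c: "?T X - A \<in> carrier_mat p p" using a(2) by (rule minus_carrier_mat)
      have "lw_mat_norm w (?T X - A) \<le> 16 * k * M * r"
        using True by (intro grid_estimator_loss_good[OF A p w n r(1) kr k M]) (auto simp: z_def)
      then have "(lw_mat_norm w (?T X - A))\<^sup>2 \<le> (16 * k * M * r)\<^sup>2"
        using lw_mat_norm_nonneg[OF c p w] by (rule power_mono)
      moreover have "0 \<le> 4 * M\<^sup>2 * (\<Sum>i<p. \<Sum>j<p. b i j X)"
        using b0 by (intro mult_nonneg_nonneg sum_nonneg) auto
      ultimately show ?thesis by linarith
    next
      case False
      then obtain i j where ij: "i < p" "j < p" "r < \<bar>z i j X / real n\<bar>" by (auto simp: not_le)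
      have c: "?T X - A \<in> carrier_mat p p" using a(2) by (rule minus_carrier_mat)
      have "(lw_mat_norm w (?T X - A))\<^sup>2 \<le> (2 * M)\<^sup>2"
        using lw_mat_norm_nonneg[OF c p w] lw_mat_norm_diff_le[OF A grid_estimator_cases p w] by (intro power_mono) auto
      also have "\<dots> = 4 * M\<^sup>2 * 1" by (simp add: power_mult_distrib)
      also have "\<dots> \<le> 4 * M\<^sup>2 * (\<Sum>i<p. \<Sum>j<p. b i j X)"
      proof (intro mult_left_mono)
        have "real n * r \<le> \<bar>z i j X\<bar>" using ij(3) n by (simp add: field_simps)
        then have "real n * r \<le> z i j X \<or> real n * r \<le> - z i j X" by linarith
        then have "t * (real n * r) \<le> t * z i j X \<or> t * (real n * r) \<le> t * (- z i j X)"
          using mult_left_mono[of _ _ t] t(1) by (meson less_imp_le)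
        then have "0 \<le> - t * real n * r + t * z i j X \<or> 0 \<le> - t * real n * r + - t * z i j X" by (auto simp: mult.assoc)
        then have "1 \<le> exp (- t * real n * r + t * z i j X) \<or> 1 \<le> exp (- t * real n * r + - t * z i j X)" by simp
        then have "1 \<le> b i j X" unfolding b_def exp_add[symmetric] using exp_ge_zero by (smt (verit))
        also have "\<dots> \<le> (\<Sum>j<p. b i j X)" using ij b0 by (intro member_le_sum) auto
        also have "\<dots> \<le> (\<Sum>i<p. \<Sum>j<p. b i j X)" using ij b0
          by (intro member_le_sum[of i "{..<p}" "\<lambda>i. \<Sum>j<p. b i j X"]) (auto intro: sum_nonneg)
        finally show "1 \<le> (\<Sum>i<p. \<Sum>j<p. b i j X)" .
      qed simp
      finally show ?thesis by (smt (verit) zero_le_power2)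
    qed
    have "risk w n p \<mu> ?T A \<le> (\<integral>\<^sup>+X. ennreal ((16 * k * M * r)\<^sup>2) + ennreal (4 * M\<^sup>2) * (\<Sum>i<p. \<Sum>j<p. ennreal (b i j X)) \<partial>?P)"
      unfolding risk_def
    proof (rule nn_integral_mono)
      fix X
      have "ennreal ((lw_mat_norm w (?T X - A))\<^sup>2) \<le> ennreal ((16 * k * M * r)\<^sup>2 + 4 * M\<^sup>2 * (\<Sum>i<p. \<Sum>j<p. b i j X))"
        using loss[of X] by (rule ennreal_leI)
      also have "\<dots> = ennreal ((16 * k * M * r)\<^sup>2) + ennreal (4 * M\<^sup>2 * (\<Sum>i<p. \<Sum>j<p. b i j X))"
        using b0 by (intro ennreal_plus mult_nonneg_nonneg sum_nonneg) auto
      also have "ennreal (4 * M\<^sup>2 * (\<Sum>i<p. \<Sum>j<p. b i j X)) = ennreal (4 * M\<^sup>2) * ennreal (\<Sum>i<p. \<Sum>j<p. b i j X)"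
        using b0 by (intro ennreal_mult sum_nonneg) auto
      also have "ennreal (\<Sum>i<p. \<Sum>j<p. b i j X) = (\<Sum>i<p. \<Sum>j<p. ennreal (b i j X))"
        using b0 by (simp add: sum_ennreal[symmetric] sum_nonneg del: sum_ennreal)
      finally show "ennreal ((lw_mat_norm w (?T X - A))\<^sup>2) \<le> ennreal ((16 * k * M * r)\<^sup>2) + ennreal (4 * M\<^sup>2) * (\<Sum>i<p. \<Sum>j<p. ennreal (b i j X))" .
    qed
    also have "\<dots> = ennreal ((16 * k * M * r)\<^sup>2) + ennreal (4 * M\<^sup>2) * (\<Sum>i<p. \<Sum>j<p. (\<integral>\<^sup>+X. ennreal (b i j X) \<partial>?P))"
    proof -
      have bm: "(\<lambda>X. ennreal (b i j X)) \<in> borel_measurable ?P" if "i < p" for i j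
        unfolding b_def using zm[OF that, of j] by measurable
      have "(\<integral>\<^sup>+X. ennreal ((16 * k * M * r)\<^sup>2) + ennreal (4 * M\<^sup>2) * (\<Sum>i<p. \<Sum>j<p. ennreal (b i j X)) \<partial>?P) =
        (\<integral>\<^sup>+X. ennreal ((16 * k * M * r)\<^sup>2) \<partial>?P) + (\<integral>\<^sup>+X. ennreal (4 * M\<^sup>2) * (\<Sum>i<p. \<Sum>j<p. ennreal (b i j X)) \<partial>?P)"
        using bm by (intro nn_integral_add) auto
      also have "(\<integral>\<^sup>+X. ennreal ((16 * k * M * r)\<^sup>2) \<partial>?P) = ennreal ((16 * k * M * r)\<^sup>2)"
        by (simp add: emeasure_space_1)
      also have "(\<integral>\<^sup>+X. ennreal (4 * M\<^sup>2) * (\<Sum>i<p. \<Sum>j<p. ennreal (b i j X)) \<partial>?P) = ennreal (4 * M\<^sup>2) * (\<integral>\<^sup>+X. (\<Sum>i<p. \<Sum>j<p. ennreal (b i j X)) \<partial>?P)"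
        using bm by (intro nn_integral_cmult borel_measurable_sum) auto
      also have "(\<integral>\<^sup>+X. (\<Sum>i<p. \<Sum>j<p. ennreal (b i j X)) \<partial>?P) = (\<Sum>i<p. \<integral>\<^sup>+X. (\<Sum>j<p. ennreal (b i j X)) \<partial>?P)"
        using bm by (intro nn_integral_sum borel_measurable_sum) auto
      also have "\<dots> = (\<Sum>i<p. \<Sum>j<p. (\<integral>\<^sup>+X. ennreal (b i j X) \<partial>?P))"
        using bm by (intro sum.cong refl nn_integral_sum) auto
      finally show ?thesis .
    qed
    also have "\<dots> \<le> ennreal ((16 * k * M * r)\<^sup>2) + ennreal (4 * M\<^sup>2) * (\<Sum>i<p. \<Sum>j<p. ennreal (2 * E))"
      using bint by (intro add_left_mono mult_left_mono sum_mono) auto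
    also have "(\<Sum>i<p. \<Sum>j<p. ennreal (2 * E)) = ennreal (\<Sum>i<p. \<Sum>j<p. 2 * E)"
      by (simp add: E_def sum_ennreal sum_nonneg del: sum_constant)
    also have "(\<Sum>i<p. \<Sum>j<p. 2 * E) = (real p)\<^sup>2 * (2 * E)" by (simp add: power2_eq_square)
    also have "ennreal (4 * M\<^sup>2) * ennreal ((real p)\<^sup>2 * (2 * E)) = ennreal (4 * M\<^sup>2 * (real p)\<^sup>2 * (2 * E))"
      by (simp add: ennreal_mult[symmetric] E_def mult.assoc)
    also have "ennreal ((16 * k * M * r)\<^sup>2) + \<dots> = ennreal ?R"
      by (simp add: ennreal_plus E_def)
    finally show ?thesis .
  qed
  then have "(SUP A\<in>?G. risk w n p \<mu> ?T A) \<le> ennreal ?R" by (rule SUP_least)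
  then have "minimax_risk w n p \<mu> ?G \<le> ennreal ?R" unfolding minimax_risk_def using T by (rule INF_lower2[rotated])
  then show ?thesis by (simp add: E_def W_def)
qed

section \<open>Mixtures and the diagonal lower bound\<close>

text \<open>Let \<open>F\<close> be the mixture density. The condition
  \<open>h \<le> l0 + l j\<close> bounds \<open>h * min f0 F\<close> by the two weighted losses, and
  the rest satisfies \<open>F - min f0 F \<le> F\<^sup>2 / (4 * f0)\<close>, because
  \<open>(F - 2 * f0)\<^sup>2\<close> is nonnegative. After integration the last term is a quarter
  of the second moment of the likelihood ratio.\<close>

lemma mixture_pointwise:
  fixes f0 h l0 :: real and f l :: "'j \<Rightarrow> real"
  assumes J: "finite J" "J \<noteq> {}" and f0: "0 < f0" and f: "\<And>j. j \<in> J \<Longrightarrow> 0 \<le> f j"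
    and l0: "0 \<le> l0" and l: "\<And>j. j \<in> J \<Longrightarrow> 0 \<le> l j" "\<And>j. j \<in> J \<Longrightarrow> h \<le> l0 + l j" and h: "0 \<le> h"
  shows "h * ((\<Sum>j\<in>J. f j) / real (card J)) \<le>
    l0 * f0 + (\<Sum>j\<in>J. l j * f j) / real (card J) +
    (h / 4) * ((\<Sum>i\<in>J. \<Sum>j\<in>J. f i * f j / f0) / (real (card J))\<^sup>2)"
proof -
  define c where "c = real (card J)"
  define F where "F = (\<Sum>j\<in>J. f j) / c"
  have c: "0 < c" using J by (simp add: c_def card_gt_0_iff)
  have F0: "0 \<le> F" unfolding F_def using c f by (intro divide_nonneg_pos sum_nonneg) auto
  have sq: "(\<Sum>i\<in>J. \<Sum>j\<in>J. f i * f j / f0) / c\<^sup>2 = F\<^sup>2 / f0"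
    by (simp add: F_def power2_eq_square sum_product sum_divide_distrib mult_ac)
  have "h * min f0 F \<le> l0 * f0 + (\<Sum>j\<in>J. l j * f j) / c"
  proof (cases "h \<le> l0")
    case True
    have "h * min f0 F \<le> h * f0" using h by (intro mult_left_mono) auto
    also have "\<dots> \<le> l0 * f0" using True f0 by (intro mult_right_mono) auto
    finally show ?thesis using c f l by (smt (verit, ccfv_SIG) divide_nonneg_pos mult_nonneg_nonneg sum_nonneg)
  next
    case False
    have "(h - l0) * (\<Sum>j\<in>J. f j) = (\<Sum>j\<in>J. (h - l0) * f j)" by (simp add: sum_distrib_left)
    also have "\<dots> \<le> (\<Sum>j\<in>J. l j * f j)"
    proof (rule sum_mono)
      fix j assume j: "j \<in> J"
      have "h - l0 \<le> l j" using l(2)[OF j] by linarith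
      then show "(h - l0) * f j \<le> l j * f j" using f[OF j] by (rule mult_right_mono)
    qed
    finally have "(h - l0) * F \<le> (\<Sum>j\<in>J. l j * f j) / c"
      using c by (simp add: F_def divide_right_mono)
    moreover have "h * min f0 F \<le> l0 * f0 + (h - l0) * F"
    proof -
      have "l0 * min f0 F \<le> l0 * f0" using l0 by (intro mult_left_mono) auto
      moreover have "(h - l0) * min f0 F \<le> (h - l0) * F" using False by (intro mult_left_mono) auto
      ultimately show ?thesis by (simp add: left_diff_distrib)
    qed
    ultimately show ?thesis by linarith
  qed
  moreover have "F \<le> min f0 F + F\<^sup>2 / f0 / 4"
  proof -
    have "0 \<le> (F - 2 * f0)\<^sup>2" by simp
    then have "4 * f0 * F \<le> 4 * f0 * f0 + F\<^sup>2" by (simp add: power2_eq_square algebra_simps)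
    then have "F \<le> f0 + F\<^sup>2 / f0 / 4" using f0 by (simp add: field_simps power2_eq_square)
    moreover have "0 \<le> F\<^sup>2 / f0 / 4" using f0 by simp
    ultimately show ?thesis by (simp add: min_def)
  qed
  then have "h * F \<le> h * (min f0 F + F\<^sup>2 / f0 / 4)" using h by (rule mult_left_mono)
  then have "h * F \<le> h * min f0 F + (h / 4) * (F\<^sup>2 / f0)" by (simp add: distrib_left)
  ultimately show ?thesis unfolding c_def[symmetric] sq F_def[symmetric] by linarith
qed

lemma measurable_estimator:
  assumes T: "T \<in> estimators n p" and "i < p" "j < p"
  shows "(\<lambda>X. T X $$ (i, j)) \<in> borel_measurable (sample_space n p)"
proof -
  have "sets (\<Pi>\<^sub>M l\<in>{..<n}. \<Pi>\<^sub>M i\<in>{..<p}. (borel :: real measure)) = sets (sample_space n p)"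
    by (intro sets_PiM_cong refl) simp
  note eq = measurable_cong_sets[OF this refl]
  show ?thesis using assms unfolding estimators_def eq by blast
qed

lemma ennreal_half_le:
  assumes "ennreal h \<le> Z + ennreal (h / 2)" "0 \<le> h"
  shows "ennreal (h / 2) \<le> Z"
proof (cases Z)
  case (real r)
  then have "ennreal h \<le> ennreal (r + h / 2)" using assms by (simp add: ennreal_plus)
  then have "h \<le> r + h / 2" using real assms(2) by (subst (asm) ennreal_le_iff) auto
  then show ?thesis unfolding real(2) by (intro ennreal_leI) simp
qed simp

text \<open>Le Cam's method for a point against a uniform mixture. Integrating the pointwise
  inequality, a second moment of at most 2 costs half of \<open>h\<close>. The losses are arbitrary
  functions with \<open>h \<le> l0 + l j\<close>, so that both norms and single row sums can be
  tested.\<close>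

lemma le_cam_mixture:
  fixes A :: "'j \<Rightarrow> real mat"
  assumes J: "finite J" "J \<noteq> {}" and m: "\<mu> \<in> carrier_vec p"
    and A0: "symmetric_pos_def p A0" and A: "\<And>j. j \<in> J \<Longrightarrow> symmetric_pos_def p (A j)"
    and B: "\<And>i j. i \<in> J \<Longrightarrow> j \<in> J \<Longrightarrow> symmetric_pos_def p (A i + A j - A0)"
    and chi: "(\<Sum>i\<in>J. \<Sum>j\<in>J. sqrt (Determinant.det (A i) * Determinant.det (A j) /
        (Determinant.det A0 * Determinant.det (A i + A j - A0))) ^ n) \<le> 2 * (real (card J))\<^sup>2"
    and l0m: "l0 \<in> borel_measurable (sample_space n p)" and lm: "\<And>j. j \<in> J \<Longrightarrow> l j \<in> borel_measurable (sample_space n p)"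
    and l0: "\<And>X. 0 \<le> l0 X" and l: "\<And>X j. j \<in> J \<Longrightarrow> 0 \<le> l j X" "\<And>X j. j \<in> J \<Longrightarrow> h \<le> l0 X + l j X" and h: "0 \<le> h"
  shows "ennreal (h / 2) \<le> (\<integral>\<^sup>+X. ennreal (l0 X) \<partial>sample_law n p \<mu> (mat_inv A0)) +
     ennreal (1 / real (card J)) * (\<Sum>j\<in>J. \<integral>\<^sup>+X. ennreal (l j X) \<partial>sample_law n p \<mu> (mat_inv (A j)))"
proof -
  define c where "c = real (card J)"
  have c: "0 < c" using J by (simp add: c_def card_gt_0_iff)
  let ?N = "sample_space n p"
  let ?g = "sample_density n p \<mu> A0" and ?f = "\<lambda>j. sample_density n p \<mu> (A j)"
  have f0: "0 < ?g X" for X by (rule sample_density_pos[OF A0])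
  have f: "0 < ?f j X" if "j \<in> J" for j X by (rule sample_density_pos[OF A[OF that]])
  have f0m[measurable]: "?g \<in> borel_measurable ?N" by (rule measurable_sample_density[OF spdD(1)[OF A0] m])
  have fm: "?f j \<in> borel_measurable ?N" if "j \<in> J" for j by (rule measurable_sample_density[OF spdD(1)[OF A[OF that]] m])
  let ?H = "\<integral>\<^sup>+X. ennreal (?g X) * ennreal (l0 X) \<partial>?N"
  let ?I = "\<lambda>j. \<integral>\<^sup>+X. ennreal (?f j X) * ennreal (l j X) \<partial>?N"
  let ?R = "\<lambda>i j. \<integral>\<^sup>+X. ennreal (?f i X * ?f j X / ?g X) \<partial>?N"
  have pw: "ennreal (h / c) * (\<Sum>j\<in>J. ennreal (?f j X)) \<le> ennreal (?g X) * ennreal (l0 X) + ennreal (1 / c) * (\<Sum>j\<in>J. ennreal (?f j X) * ennreal (l j X))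
     + ennreal (h / 4 / c\<^sup>2) * (\<Sum>i\<in>J. \<Sum>j\<in>J. ennreal (?f i X * ?f j X / ?g X))" for X
  proof -
    have fn: "0 \<le> ?f j X" if "j \<in> J" for j using f[OF that, of X] by simp
    have rn: "0 \<le> ?f i X * ?f j X / ?g X" if "i \<in> J" "j \<in> J" for i j
      using fn[OF that(1)] fn[OF that(2)] f0[of X] by simp
    have e1: "(\<Sum>j\<in>J. ennreal (?f j X)) = ennreal (\<Sum>j\<in>J. ?f j X)" using fn by (intro sum_ennreal) auto
    have e2: "(\<Sum>j\<in>J. ennreal (?f j X) * ennreal (l j X)) = ennreal (\<Sum>j\<in>J. l j X * ?f j X)"
      using fn l(1) by (subst sum_ennreal[symmetric]) (auto intro!: sum.cong simp: ennreal_mult mult.commute)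
    have e3: "(\<Sum>i\<in>J. \<Sum>j\<in>J. ennreal (?f i X * ?f j X / ?g X)) = ennreal (\<Sum>i\<in>J. \<Sum>j\<in>J. ?f i X * ?f j X / ?g X)"
    proof -
      have "(\<Sum>j\<in>J. ennreal (?f i X * ?f j X / ?g X)) = ennreal (\<Sum>j\<in>J. ?f i X * ?f j X / ?g X)" if "i \<in> J" for i
        using rn[OF that] by (intro sum_ennreal) auto
      then have "(\<Sum>i\<in>J. \<Sum>j\<in>J. ennreal (?f i X * ?f j X / ?g X)) = (\<Sum>i\<in>J. ennreal (\<Sum>j\<in>J. ?f i X * ?f j X / ?g X))"
        by simp
      also have "\<dots> = ennreal (\<Sum>i\<in>J. \<Sum>j\<in>J. ?f i X * ?f j X / ?g X)"
        using rn by (intro sum_ennreal sum_nonneg) auto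
      finally show ?thesis .
    qed
    have n1: "0 \<le> (\<Sum>j\<in>J. l j X * ?f j X)" using fn l(1) by (intro sum_nonneg mult_nonneg_nonneg) auto
    have n2: "0 \<le> (\<Sum>i\<in>J. \<Sum>j\<in>J. ?f i X * ?f j X / ?g X)" using rn by (intro sum_nonneg) auto
    have n3: "0 \<le> (\<Sum>j\<in>J. ?f j X)" using fn by (intro sum_nonneg) auto
    have "h * ((\<Sum>j\<in>J. ?f j X) / c) \<le> l0 X * ?g X + (\<Sum>j\<in>J. l j X * ?f j X) / c + (h / 4) * ((\<Sum>i\<in>J. \<Sum>j\<in>J. ?f i X * ?f j X / ?g X) / c\<^sup>2)"
      unfolding c_def using J f0 fn l0 l h by (intro mixture_pointwise) auto
    then have "ennreal (h / c * (\<Sum>j\<in>J. ?f j X)) \<le> ennreal (?g X * l0 X + 1 / c * (\<Sum>j\<in>J. l j X * ?f j X) + (h / 4 / c\<^sup>2) * (\<Sum>i\<in>J. \<Sum>j\<in>J. ?f i X * ?f j X / ?g X))"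
      by (intro ennreal_leI) (simp add: mult.commute)
    also have "\<dots> = ennreal (?g X * l0 X) + ennreal (1 / c * (\<Sum>j\<in>J. l j X * ?f j X)) + ennreal ((h / 4 / c\<^sup>2) * (\<Sum>i\<in>J. \<Sum>j\<in>J. ?f i X * ?f j X / ?g X))"
      using l0[of X] f0[of X] n1 n2 c h by (simp add: ennreal_plus)
    finally have fin: "ennreal (h / c * (\<Sum>j\<in>J. ?f j X)) \<le> \<dots>" .
    have m0: "ennreal (?g X * l0 X) = ennreal (?g X) * ennreal (l0 X)"
      using l0[of X] f0[of X] by (intro ennreal_mult) auto
    have m1: "ennreal (h / c * (\<Sum>j\<in>J. ?f j X)) = ennreal (h / c) * ennreal (\<Sum>j\<in>J. ?f j X)"
      using n3 c h by (intro ennreal_mult) auto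
    have m2: "ennreal (1 / c * (\<Sum>j\<in>J. l j X * ?f j X)) = ennreal (1 / c) * ennreal (\<Sum>j\<in>J. l j X * ?f j X)"
      using n1 c by (intro ennreal_mult) auto
    have m3: "ennreal ((h / 4 / c\<^sup>2) * (\<Sum>i\<in>J. \<Sum>j\<in>J. ?f i X * ?f j X / ?g X)) = ennreal (h / 4 / c\<^sup>2) * ennreal (\<Sum>i\<in>J. \<Sum>j\<in>J. ?f i X * ?f j X / ?g X)"
      using n2 h by (intro ennreal_mult) auto
    show ?thesis using fin unfolding m0 m1 m2 m3 e1 e2 e3 .
  qed
  have lfm: "(\<lambda>X. ennreal (?f j X) * ennreal (l j X)) \<in> borel_measurable ?N" if "j \<in> J" for j
    using fm[OF that] lm[OF that] by measurable
  have l0fm: "(\<lambda>X. ennreal (?g X) * ennreal (l0 X)) \<in> borel_measurable ?N"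
    using f0m l0m by measurable
  have rm: "(\<lambda>X. ennreal (?f i X * ?f j X / ?g X)) \<in> borel_measurable ?N" if "i \<in> J" "j \<in> J" for i j
    using fm[OF that(1)] fm[OF that(2)] f0m by measurable
  have fme: "(\<lambda>X. ennreal (?f j X)) \<in> borel_measurable ?N" if "j \<in> J" for j
    using fm[OF that] by measurable
  have "(\<integral>\<^sup>+X. ennreal (h / c) * (\<Sum>j\<in>J. ennreal (?f j X)) \<partial>?N) = ennreal (h / c) * (\<Sum>j\<in>J. \<integral>\<^sup>+X. ennreal (?f j X) \<partial>?N)"
    by (simp only: nn_integral_cmult[OF borel_measurable_sum[OF fme]] nn_integral_sum[OF fme])
  also have "(\<Sum>j\<in>J. \<integral>\<^sup>+X. ennreal (?f j X) \<partial>?N) = (\<Sum>j\<in>J. 1)"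
    using nn_integral_sample_density[OF A m] by (intro sum.cong) auto
  also have "(\<Sum>j\<in>J. 1::ennreal) = ennreal c" by (simp add: c_def ennreal_of_nat_eq_real_of_nat)
  also have "ennreal (h / c) * ennreal c = ennreal h" using c h by (simp add: ennreal_mult[symmetric])
  finally have "ennreal h = (\<integral>\<^sup>+X. ennreal (h / c) * (\<Sum>j\<in>J. ennreal (?f j X)) \<partial>?N)" ..
  also have "\<dots> \<le> (\<integral>\<^sup>+X. ennreal (?g X) * ennreal (l0 X) + ennreal (1 / c) * (\<Sum>j\<in>J. ennreal (?f j X) * ennreal (l j X))
     + ennreal (h / 4 / c\<^sup>2) * (\<Sum>i\<in>J. \<Sum>j\<in>J. ennreal (?f i X * ?f j X / ?g X)) \<partial>?N)"
    using pw by (rule nn_integral_mono)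
  also have "\<dots> = ?H + ennreal (1 / c) * (\<Sum>j\<in>J. ?I j) + ennreal (h / 4 / c\<^sup>2) * (\<Sum>i\<in>J. \<Sum>j\<in>J. ?R i j)"
  proof -
    have m2: "(\<lambda>X. ennreal (1 / c) * (\<Sum>j\<in>J. ennreal (?f j X) * ennreal (l j X))) \<in> borel_measurable ?N"
      by (intro borel_measurable_times_ennreal borel_measurable_const borel_measurable_sum lfm)
    have m3: "(\<lambda>X. ennreal (h / 4 / c\<^sup>2) * (\<Sum>i\<in>J. \<Sum>j\<in>J. ennreal (?f i X * ?f j X / ?g X))) \<in> borel_measurable ?N"
      by (intro borel_measurable_times_ennreal borel_measurable_const borel_measurable_sum rm)
    have s2: "(\<integral>\<^sup>+X. ennreal (1 / c) * (\<Sum>j\<in>J. ennreal (?f j X) * ennreal (l j X)) \<partial>?N) = ennreal (1 / c) * (\<Sum>j\<in>J. ?I j)"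
      by (simp only: nn_integral_cmult[OF borel_measurable_sum[OF lfm]] nn_integral_sum[OF lfm])
    have "(\<integral>\<^sup>+X. (\<Sum>i\<in>J. \<Sum>j\<in>J. ennreal (?f i X * ?f j X / ?g X)) \<partial>?N) = (\<Sum>i\<in>J. \<integral>\<^sup>+X. (\<Sum>j\<in>J. ennreal (?f i X * ?f j X / ?g X)) \<partial>?N)"
      by (intro nn_integral_sum borel_measurable_sum rm)
    also have "\<dots> = (\<Sum>i\<in>J. \<Sum>j\<in>J. ?R i j)"
      by (intro sum.cong refl nn_integral_sum rm)
    finally have s3: "(\<integral>\<^sup>+X. ennreal (h / 4 / c\<^sup>2) * (\<Sum>i\<in>J. \<Sum>j\<in>J. ennreal (?f i X * ?f j X / ?g X)) \<partial>?N) = ennreal (h / 4 / c\<^sup>2) * (\<Sum>i\<in>J. \<Sum>j\<in>J. ?R i j)"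
      using rm by (subst nn_integral_cmult) (auto intro!: borel_measurable_sum)
    show ?thesis unfolding s2[symmetric] s3[symmetric]
      by (subst nn_integral_add[OF borel_measurable_add[OF l0fm m2] m3], subst nn_integral_add[OF l0fm m2]) simp
  qed
  finally have main: "ennreal h \<le> ?H + ennreal (1 / c) * (\<Sum>j\<in>J. ?I j) + ennreal (h / 4 / c\<^sup>2) * (\<Sum>i\<in>J. \<Sum>j\<in>J. ?R i j)" .
  have "(\<Sum>i\<in>J. \<Sum>j\<in>J. ?R i j) \<le> ennreal (2 * c\<^sup>2)"
  proof -
    let ?q = "\<lambda>i j. sqrt (Determinant.det (A i) * Determinant.det (A j) / (Determinant.det A0 * Determinant.det (A i + A j - A0))) ^ n"
    have q0: "0 \<le> ?q i j" if "i \<in> J" "j \<in> J" for i j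
      using spd_det_pos[OF A0] spd_det_pos[OF A] spd_det_pos[OF B] that by (simp add: less_imp_le)
    have "(\<Sum>i\<in>J. \<Sum>j\<in>J. ?R i j) = (\<Sum>i\<in>J. \<Sum>j\<in>J. ennreal (?q i j))"
      using sample_chi_square[OF A0 A A B m] by (intro sum.cong refl) auto
    also have "\<dots> = (\<Sum>i\<in>J. ennreal (\<Sum>j\<in>J. ?q i j))"
      using q0 by (intro sum.cong refl sum_ennreal) auto
    also have "\<dots> = ennreal (\<Sum>i\<in>J. \<Sum>j\<in>J. ?q i j)"
      using q0 by (intro sum_ennreal sum_nonneg) auto
    also have "\<dots> \<le> ennreal (2 * c\<^sup>2)" using chi by (intro ennreal_leI) (simp add: c_def)
    finally show ?thesis .
  qed
  then have "?H + ennreal (1 / c) * (\<Sum>j\<in>J. ?I j) + ennreal (h / 4 / c\<^sup>2) * (\<Sum>i\<in>J. \<Sum>j\<in>J. ?R i j)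
    \<le> ?H + ennreal (1 / c) * (\<Sum>j\<in>J. ?I j) + ennreal (h / 4 / c\<^sup>2) * ennreal (2 * c\<^sup>2)"
    by (intro add_left_mono mult_left_mono) auto
  note order_trans[OF main this]
  also have "ennreal (h / 4 / c\<^sup>2) * ennreal (2 * c\<^sup>2) = ennreal (h / 2)"
    using c h by (simp add: ennreal_mult[symmetric])
  finally have "ennreal h \<le> (?H + ennreal (1 / c) * (\<Sum>j\<in>J. ?I j)) + ennreal (h / 2)" .
  then have "ennreal (h / 2) \<le> ?H + ennreal (1 / c) * (\<Sum>j\<in>J. ?I j)"
    using h by (rule ennreal_half_le)
  also have "?H = (\<integral>\<^sup>+X. ennreal (l0 X) \<partial>sample_law n p \<mu> (mat_inv A0))"
    using l0m by (intro nn_integral_sample_law[OF A0 m, symmetric]) auto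
  also have "(\<Sum>j\<in>J. ?I j) = (\<Sum>j\<in>J. \<integral>\<^sup>+X. ennreal (l j X) \<partial>sample_law n p \<mu> (mat_inv (A j)))"
    using lm by (intro sum.cong refl nn_integral_sample_law[OF A m, symmetric]) auto
  finally show ?thesis unfolding c_def .
qed

section \<open>One perturbed diagonal entry\<close>

definition real_diag :: "nat \<Rightarrow> (nat \<Rightarrow> real) \<Rightarrow> real mat" where
  "real_diag p d = mat p p (\<lambda>(i, j). if i = j then d i else 0)"

lemma real_diag_carrier [simp]: "real_diag p d \<in> carrier_mat p p"
  by (simp add: real_diag_def)

lemma quadratic_real_diag:
  assumes "v \<in> carrier_vec p"
  shows "v \<bullet> (real_diag p d *\<^sub>v v) = (\<Sum>i<p. d i * (v $ i)\<^sup>2)"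
proof -
  have "(\<Sum>j<p. real_diag p d $$ (i, j) * v $ i * v $ j) = d i * (v $ i)\<^sup>2" if "i < p" for i
  proof -
    have "(\<Sum>j<p. real_diag p d $$ (i, j) * v $ i * v $ j) = (\<Sum>j<p. if i = j then d i * v $ i * v $ j else 0)"
      using that by (intro sum.cong) (auto simp: real_diag_def)
    then show ?thesis using that by (simp add: power2_eq_square)
  qed
  then show ?thesis unfolding quadratic_form_sum[OF real_diag_carrier assms assms] by simp
qed

lemma spd_real_diag:
  assumes "\<And>i. i < p \<Longrightarrow> 0 < d i"
  shows "symmetric_pos_def p (real_diag p d)"
proof -
  {
    fix v :: "real vec" assume v: "v \<in> carrier_vec p" "v \<noteq> 0\<^sub>v p"
    then obtain i where "i < p" "v $ i \<noteq> 0" by (metis carrier_vecD eq_vecI index_zero_vec)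
    then have "0 < v \<bullet> (real_diag p d *\<^sub>v v)" unfolding quadratic_real_diag[OF v(1)]
      using assms by (intro sum_pos2[of _ i]) (auto simp: less_imp_le)
  }
  then show ?thesis by (auto simp: symmetric_pos_def_def real_diag_def intro!: eq_matI)
qed

lemma det_real_diag: "Determinant.det (real_diag p d) = (\<Prod>i<p. d i)"
proof -
  have "Determinant.det (real_diag p d) = prod_list (diag_mat (real_diag p d))"
    by (rule det_upper_triangular[of _ p]) (auto simp: real_diag_def upper_triangular_def)
  also have "\<dots> = (\<Prod>i<p. d i)"
    by (subst prod_list_diag_prod) (simp add: real_diag_def atLeast0LessThan)
  finally show ?thesis .
qed

lemma real_diag_in_G0:
  assumes p: "0 < p" and s: "0 < s" and e: "0 \<le> e" and d: "\<And>i. i < p \<Longrightarrow> s \<le> d i" "\<And>i. i < p \<Longrightarrow> d i \<le> s * (1 + e)"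
    and k: "1 \<le> k" and M: "s * (1 + e) \<le> M" and M1: "1 + e \<le> M1"
  shows "real_diag p d \<in> G0 p M1 k M"
proof -
  have dp: "0 < d i" if "i < p" for i using d(1)[OF that] s by linarith
  have tr: "transpose_mat (real_diag p d) = real_diag p d"
    by (auto simp: real_diag_def intro!: eq_matI)
  have lo: "s * (v \<bullet> v) \<le> v \<bullet> (real_diag p d *\<^sub>v v)" and up: "v \<bullet> (real_diag p d *\<^sub>v v) \<le> s * (1 + e) * (v \<bullet> v)"
    if v: "v \<in> carrier_vec p" for v
    unfolding quadratic_real_diag[OF v] scalar_prod_self_eq[OF v] sum_distrib_left
    using d by (auto intro!: sum_mono mult_right_mono)
  have cond: "lambda_max (real_diag p d) / lambda_min (real_diag p d) \<le> s * (1 + e) / s"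
    by (rule condition_number_le[OF real_diag_carrier tr p s lo up])
  have row: "{j. j < p \<and> real_diag p d $$ (i, j) \<noteq> 0} \<subseteq> {i}" if "i < p" for i
    using that by (auto simp: real_diag_def split: if_splits)
  have col: "{i. i < p \<and> real_diag p d $$ (i, j) \<noteq> 0} \<subseteq> {j}" if "j < p" for j
    using that by (auto simp: real_diag_def split: if_splits)
  have r1: "real (card {j. j < p \<and> real_diag p d $$ (i, j) \<noteq> 0}) \<le> k" if "i < p" for i
    using card_mono[OF _ row[OF that]] k by simp
  have c1: "real (card {i. i < p \<and> real_diag p d $$ (i, j) \<noteq> 0}) \<le> k" if "j < p" for j
    using card_mono[OF _ col[OF that]] k by simp
  have rs: "(\<Sum>j<p. \<bar>real_diag p d $$ (i, j)\<bar>) \<le> M" if i: "i < p" for i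
  proof -
    have "(\<Sum>j<p. \<bar>real_diag p d $$ (i, j)\<bar>) = (\<Sum>j<p. if i = j then \<bar>d i\<bar> else 0)"
      using i by (intro sum.cong) (auto simp: real_diag_def)
    then show ?thesis using i d(2)[OF i] dp[OF i] M by simp
  qed
  have cs: "(\<Sum>i<p. \<bar>real_diag p d $$ (i, j)\<bar>) \<le> M" if j: "j < p" for j
  proof -
    have "(\<Sum>i<p. \<bar>real_diag p d $$ (i, j)\<bar>) = (\<Sum>i<p. if i = j then \<bar>d j\<bar> else 0)"
      using j by (intro sum.cong) (auto simp: real_diag_def)
    then show ?thesis using j d(2)[OF j] dp[OF j] M by simp
  qed
  have "lw_mat_norm 1 (real_diag p d) \<le> M"
    by (rule lw_mat_norm_le[OF real_diag_carrier p _ rs cs]) auto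
  then show ?thesis using spd_real_diag[OF dp] r1 c1 cond s M1 by (simp add: G0_def)
qed

text \<open>The alternatives raise one of \<open>p\<close> diagonal entries from \<open>s\<close> to
  \<open>s * (1 + e)\<close>, where \<open>s = M / 2\<close> leaves room for the factor. Different
  alternatives contribute 1 to the second moment, equal ones at most
  \<open>exp (n e^2 / 2) \<le> p\<close>, and the \<open>p\<close> equal pairs among
  \<open>p^2\<close> bring it to at most 2. Diagonal matrices fit every sparsity
  \<open>k \<ge> 1\<close>.\<close>

lemma minimax_risk_lower_diag:
  assumes p: "0 < p" and w: "1 \<le> w" and m: "\<mu> \<in> carrier_vec p" and M: "0 < M" and k: "1 \<le> k"
    and e: "0 \<le> e" "e \<le> 1" "1 + e \<le> M1" and ne: "exp (real n * e\<^sup>2 / 2) \<le> real p"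
  shows "ennreal (M\<^sup>2 * e\<^sup>2 / 32) \<le> minimax_risk w n p \<mu> (G0 p M1 k M)"
proof -
  define s where "s = M / 2"
  have s: "0 < s" using M by (simp add: s_def)
  have se: "s * (1 + e) \<le> M" using e M by (simp add: s_def field_simps)
  define A0 where "A0 = real_diag p (\<lambda>_. s)"
  define A where "A j = real_diag p (\<lambda>i. if i = j then s * (1 + e) else s)" for j
  have sse: "s \<le> s * (1 + e)" using s e by simp
  have G: "A0 \<in> G0 p M1 k M" "A j \<in> G0 p M1 k M" for j
    unfolding A0_def A_def using p s e k se sse by (auto intro!: real_diag_in_G0)
  have spd: "symmetric_pos_def p A0" "symmetric_pos_def p (A j)" for j
    by (rule G0_D(1)[OF G(1) p], rule G0_D(1)[OF G(2) p])
  have Bd: "A i + A j - A0 = real_diag p (\<lambda>l. (if l = i then s * (1 + e) else s) + (if l = j then s * (1 + e) else s) - s)" for i j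
    unfolding A0_def A_def real_diag_def by (intro eq_matI) auto
  have B: "symmetric_pos_def p (A i + A j - A0)" for i j
    unfolding Bd using s e sse by (intro spd_real_diag) (auto simp: algebra_simps intro: add_pos_nonneg)
  have det0: "Determinant.det A0 = s ^ p" by (simp add: A0_def det_real_diag)
  have prod1: "(\<Prod>l<p. if l = j then a else s) = a * s ^ (p - 1)" if "j < p" for j a
  proof -
    have "(\<Prod>l<p. if l = j then a else s) = a * (\<Prod>l\<in>{..<p} - {j}. if l = j then a else s)"
      using that by (subst prod.remove[of _ j]) auto
    also have "(\<Prod>l\<in>{..<p} - {j}. if l = j then a else s) = (\<Prod>l\<in>{..<p} - {j}. s)" by (intro prod.cong) auto
    finally show ?thesis using that by simp
  qed
  have sp: "s ^ p = s * s ^ (p - 1)" using p by (cases p) auto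
  have detj: "Determinant.det (A j) = s ^ p * (1 + e)" if "j < p" for j
    unfolding A_def det_real_diag prod1[OF that] sp by simp
  have detB: "Determinant.det (A i + A j - A0) = (if i = j then s ^ p * (1 + 2 * e) else s ^ p * (1 + e)\<^sup>2)" if i: "i < p" and j: "j < p" for i j
  proof (cases "i = j")
    case True
    have "(\<Prod>l<p. (if l = i then s * (1 + e) else s) + (if l = j then s * (1 + e) else s) - s) = (\<Prod>l<p. if l = j then s * (1 + 2 * e) else s)"
      using True by (intro prod.cong) (auto simp: algebra_simps)
    then show ?thesis unfolding Bd det_real_diag prod1[OF j] using True sp by simp
  next
    case False
    have "(\<Prod>l<p. (if l = i then s * (1 + e) else s) + (if l = j then s * (1 + e) else s) - s) =
      (\<Prod>l<p. (if l = i then 1 + e else 1) * (if l = j then s * (1 + e) else s))"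
      using False by (intro prod.cong) auto
    also have "\<dots> = (1 + e) * (s ^ p * (1 + e))"
      unfolding prod.distrib prod1[OF j] sp using i by simp
    finally show ?thesis unfolding Bd det_real_diag using False by (simp add: power2_eq_square)
  qed
  have ratio: "sqrt (Determinant.det (A i) * Determinant.det (A j) / (Determinant.det A0 * Determinant.det (A i + A j - A0))) ^ n
      \<le> 1 + (if i = j then real p else 0)" if i: "i < p" and j: "j < p" for i j
  proof (cases "i = j")
    case False
    then show ?thesis using s e by (simp add: det0 detj[OF i] detj[OF j] detB[OF i j] power2_eq_square)
  next
    case True
    have "Determinant.det (A i) * Determinant.det (A j) / (Determinant.det A0 * Determinant.det (A i + A j - A0)) = (1 + e)\<^sup>2 / (1 + 2 * e)"
      unfolding det0 detj[OF i] detj[OF j] detB[OF i j] using s True by (simp add: power2_eq_square)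
    also have "\<dots> \<le> 1 + e\<^sup>2"
      using e by (simp add: divide_le_eq power2_eq_square algebra_simps)
    also have "\<dots> \<le> exp (e\<^sup>2)" by simp
    finally have "sqrt (Determinant.det (A i) * Determinant.det (A j) / (Determinant.det A0 * Determinant.det (A i + A j - A0))) \<le> sqrt (exp (e\<^sup>2))"
      by simp
    also have "sqrt (exp (e\<^sup>2)) = exp (e\<^sup>2 / 2)"
      by (rule real_sqrt_unique) (simp_all add: power2_eq_square exp_add[symmetric])
    finally have "sqrt (Determinant.det (A i) * Determinant.det (A j) / (Determinant.det A0 * Determinant.det (A i + A j - A0))) ^ n \<le> exp (e\<^sup>2 / 2) ^ n"
      using spd_det_pos[OF spd(1)] spd_det_pos[OF spd(2)] spd_det_pos[OF B] by (intro power_mono) (auto simp: less_imp_le)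
    also have "\<dots> = exp (real n * e\<^sup>2 / 2)" by (simp add: exp_of_nat_mult[symmetric])
    finally show ?thesis using ne True by simp
  qed
  have "(\<Sum>i<p. \<Sum>j<p. sqrt (Determinant.det (A i) * Determinant.det (A j) / (Determinant.det A0 * Determinant.det (A i + A j - A0))) ^ n)
    \<le> (\<Sum>i<p. \<Sum>j<p. 1 + (if i = j then real p else 0))"
    using ratio by (intro sum_mono) auto
  also have "\<dots> = 2 * (real (card {..<p}))\<^sup>2"
    by (simp add: sum.distrib power2_eq_square)
  finally have chi: "(\<Sum>i<p. \<Sum>j<p. sqrt (Determinant.det (A i) * Determinant.det (A j) / (Determinant.det A0 * Determinant.det (A i + A j - A0))) ^ n)
    \<le> 2 * (real (card {..<p}))\<^sup>2" .
  have "ennreal (M\<^sup>2 * e\<^sup>2 / 32) \<le> (SUP A\<in>G0 p M1 k M. risk w n p \<mu> T A)" if T: "T \<in> estimators n p" for T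
  proof -
    have Tc: "T X \<in> carrier_mat p p" for X using T by (simp add: estimators_def)
    \<comment> \<open>The loss under the null matrix must be comparable with every alternative at
      once; a maximum of entry errors is still below the matrix norm.\<close>
    define l0 where "l0 X = Max ((\<lambda>j. (T X $$ (j, j) - s)\<^sup>2) ` {..<p})" for X
    define l where "l j X = (if j < p then (T X $$ (j, j) - s * (1 + e))\<^sup>2 else 0)" for j X
    have ne: "{..<p} \<noteq> {}" using p by (auto simp: lessThan_empty_iff)
    have l0_ge: "(T X $$ (j, j) - s)\<^sup>2 \<le> l0 X" if "j < p" for j X
      unfolding l0_def by (rule Max_ge) (use that in auto)
    have entry: "(T X $$ (j, j) - B $$ (j, j))\<^sup>2 \<le> (lw_mat_norm w (T X - B))\<^sup>2" if "j < p" "B \<in> carrier_mat p p" for j X B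
    proof -
      have "\<bar>(T X - B) $$ (j, j)\<bar> \<le> lw_mat_norm w (T X - B)"
        using that by (intro abs_entry_le_lw_mat_norm[OF _ w]) (auto intro: minus_carrier_mat)
      then have "\<bar>(T X - B) $$ (j, j)\<bar>\<^sup>2 \<le> (lw_mat_norm w (T X - B))\<^sup>2" by (intro power_mono) auto
      then show ?thesis using that Tc[of X] by simp
    qed
    let ?S = "SUP A\<in>G0 p M1 k M. risk w n p \<mu> T A"
    have lc: "ennreal ((s * e)\<^sup>2 / 2 / 2) \<le> (\<integral>\<^sup>+X. ennreal (l0 X) \<partial>sample_law n p \<mu> (mat_inv A0)) +
       ennreal (1 / real (card {..<p})) * (\<Sum>j<p. \<integral>\<^sup>+X. ennreal (l j X) \<partial>sample_law n p \<mu> (mat_inv (A j)))"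
    proof (rule le_cam_mixture[OF _ ne m spd(1) spd(2) B chi])
      show "l0 \<in> borel_measurable (sample_space n p)" unfolding l0_def
        using measurable_estimator[OF T] by (intro borel_measurable_Max borel_measurable_power borel_measurable_diff) auto
      show "l j \<in> borel_measurable (sample_space n p)" if "j \<in> {..<p}" for j
        using that measurable_estimator[OF T, of j j] unfolding l_def by simp
      show "0 \<le> l0 X" for X using l0_ge[OF p, of X] by (smt (verit) zero_le_power2)
      show "0 \<le> l j X" for j X by (simp add: l_def)
      show "(s * e)\<^sup>2 / 2 \<le> l0 X + l j X" if "j \<in> {..<p}" for X j
      proof -
        have "(s * e)\<^sup>2 \<le> 2 * ((T X $$ (j, j) - s)\<^sup>2 + (T X $$ (j, j) - s * (1 + e))\<^sup>2)"
          using zero_le_power2[of "2 * T X $$ (j, j) - 2 * s - s * e"] by (simp add: power2_eq_square algebra_simps)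
        then show ?thesis using l0_ge[of j X] that by (simp add: l_def)
      qed
    qed simp_all
    have "(\<integral>\<^sup>+X. ennreal (l0 X) \<partial>sample_law n p \<mu> (mat_inv A0)) \<le> risk w n p \<mu> T A0"
      unfolding risk_def
    proof (intro nn_integral_mono ennreal_leI)
      fix X
      show "l0 X \<le> (lw_mat_norm w (T X - A0))\<^sup>2"
        unfolding l0_def using ne entry[of _ A0 X] by (intro Max.boundedI) (auto simp: A0_def real_diag_def)
    qed
    also have "\<dots> \<le> ?S" using G(1) by (rule SUP_upper)
    finally have r0: "(\<integral>\<^sup>+X. ennreal (l0 X) \<partial>sample_law n p \<mu> (mat_inv A0)) \<le> ?S" .
    have r1: "(\<Sum>j<p. \<integral>\<^sup>+X. ennreal (l j X) \<partial>sample_law n p \<mu> (mat_inv (A j))) \<le> (\<Sum>j<p. ?S)"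
    proof (rule sum_mono)
      fix j assume j: "j \<in> {..<p}"
      have "(\<integral>\<^sup>+X. ennreal (l j X) \<partial>sample_law n p \<mu> (mat_inv (A j))) \<le> risk w n p \<mu> T (A j)"
        unfolding risk_def
      proof (intro nn_integral_mono ennreal_leI)
        fix X
        show "l j X \<le> (lw_mat_norm w (T X - A j))\<^sup>2"
          using entry[of j "A j" X] j by (simp add: l_def A_def real_diag_def)
      qed
      also have "\<dots> \<le> (SUP A\<in>G0 p M1 k M. risk w n p \<mu> T A)" using G(2) by (rule SUP_upper)
      finally show "(\<integral>\<^sup>+X. ennreal (l j X) \<partial>sample_law n p \<mu> (mat_inv (A j))) \<le> (SUP A\<in>G0 p M1 k M. risk w n p \<mu> T A)" .
    qed
    have avg: "ennreal (1 / real (card {..<p})) * (\<Sum>j<p. ?S) = ?S"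
    proof -
      have "ennreal (1 / real (card {..<p})) * (\<Sum>j<p. S) = S" for S :: ennreal
      proof -
        have "ennreal (1 / real p) * (of_nat p * S) = ennreal (1 / real p * real p) * S"
          using p by (simp add: ennreal_of_nat_eq_real_of_nat mult.assoc[symmetric] ennreal_mult[symmetric] del: ennreal_1)
        then show ?thesis using p by simp
      qed
      then show ?thesis .
    qed
    have *: "ennreal ((s * e)\<^sup>2 / 2 / 2) \<le> ?S + ?S"
    proof -
      have "(\<integral>\<^sup>+X. ennreal (l0 X) \<partial>sample_law n p \<mu> (mat_inv A0)) +
          ennreal (1 / real (card {..<p})) * (\<Sum>j<p. \<integral>\<^sup>+X. ennreal (l j X) \<partial>sample_law n p \<mu> (mat_inv (A j)))
        \<le> ?S + ennreal (1 / real (card {..<p})) * (\<Sum>j<p. ?S)"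
        by (rule add_mono[OF r0 mult_left_mono[OF r1]]) simp
      with lc show ?thesis unfolding avg by (rule order_trans)
    qed
    have "ennreal a \<le> S" if "ennreal (2 * a) \<le> S + S" "0 \<le> a" for a and S :: ennreal
    proof (cases S)
      case (real r)
      then show ?thesis using that by (simp add: ennreal_plus[symmetric] del: ennreal_plus)
    qed simp
    \<comment> \<open>The last factor 2 reflects that Le Cam's bound is for a sum of two risks, each
      below the supremum.\<close>
    moreover have "(s * e)\<^sup>2 / 2 / 2 = 2 * (M\<^sup>2 * e\<^sup>2 / 32)" by (simp add: s_def power2_eq_square)
    ultimately show ?thesis using * by (metis zero_le_divide_iff zero_le_mult_iff zero_le_numeral zero_le_power2)
  qed
  then show ?thesis unfolding minimax_risk_def by (rule INF_greatest)
qed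

section \<open>Perturbing one row\<close>

text \<open>In the uses \<open>f\<close> is the adjacency matrix of a graph, so bounds on row sums
  are bounds on degrees.\<close>

definition pert :: "nat \<Rightarrow> real \<Rightarrow> real \<Rightarrow> (nat \<Rightarrow> nat \<Rightarrow> real) \<Rightarrow> real mat" where
  "pert p s e f = mat p p (\<lambda>(i, j). s * ((if i = j then 1 else 0) + e * f i j))"

lemma pert_carrier [simp]: "pert p s e f \<in> carrier_mat p p"
  by (simp add: pert_def)

text \<open>From \<open>2 * \<bar>v i * v j\<bar> \<le> (v i)\<^sup>2 + (v j)\<^sup>2\<close>: the
  spectral radius of a nonnegative symmetric matrix is at most its largest row sum.\<close>

lemma abs_symmetric_quadratic_le:
  fixes f :: "nat \<Rightarrow> nat \<Rightarrow> real" and v :: "nat \<Rightarrow> real"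
  assumes sym: "\<And>i j. i < p \<Longrightarrow> j < p \<Longrightarrow> f i j = f j i" and nn: "\<And>i j. 0 \<le> f i j"
    and row: "\<And>i. i < p \<Longrightarrow> (\<Sum>j<p. f i j) \<le> Q"
  shows "\<bar>\<Sum>i<p. \<Sum>j<p. f i j * v i * v j\<bar> \<le> Q * (\<Sum>i<p. (v i)\<^sup>2)"
proof -
  have "\<bar>\<Sum>i<p. \<Sum>j<p. f i j * v i * v j\<bar> \<le> (\<Sum>i<p. \<Sum>j<p. \<bar>f i j * v i * v j\<bar>)"
    by (rule order_trans[OF sum_abs], rule sum_mono, rule sum_abs)
  also have "\<dots> \<le> (\<Sum>i<p. \<Sum>j<p. f i j * (v i)\<^sup>2 / 2 + f i j * (v j)\<^sup>2 / 2)"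
  proof (intro sum_mono)
    fix i j
    have "2 * (\<bar>v i\<bar> * \<bar>v j\<bar>) \<le> (v i)\<^sup>2 + (v j)\<^sup>2"
      using sum_squares_bound[of "\<bar>v i\<bar>" "\<bar>v j\<bar>"] by simp
    then have "f i j * (2 * (\<bar>v i\<bar> * \<bar>v j\<bar>)) \<le> f i j * ((v i)\<^sup>2 + (v j)\<^sup>2)"
      using nn by (rule mult_left_mono)
    then show "\<bar>f i j * v i * v j\<bar> \<le> f i j * (v i)\<^sup>2 / 2 + f i j * (v j)\<^sup>2 / 2"
      using nn[of i j] by (simp add: abs_mult distrib_left)
  qed
  also have "\<dots> = (\<Sum>i<p. \<Sum>j<p. f i j * (v i)\<^sup>2 / 2) + (\<Sum>i<p. \<Sum>j<p. f i j * (v j)\<^sup>2 / 2)"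
    by (simp add: sum.distrib)
  also have "(\<Sum>i<p. \<Sum>j<p. f i j * (v j)\<^sup>2 / 2) = (\<Sum>j<p. \<Sum>i<p. f i j * (v j)\<^sup>2 / 2)"
    by (rule sum.swap)
  also have "\<dots> = (\<Sum>i<p. \<Sum>j<p. f i j * (v i)\<^sup>2 / 2)"
    using sym by (intro sum.cong) auto
  also have "(\<Sum>i<p. \<Sum>j<p. f i j * (v i)\<^sup>2 / 2) + (\<Sum>i<p. \<Sum>j<p. f i j * (v i)\<^sup>2 / 2) = (\<Sum>i<p. (\<Sum>j<p. f i j) * (v i)\<^sup>2)"
    by (simp add: sum.distrib[symmetric] sum_distrib_right)
  also have "\<dots> \<le> (\<Sum>i<p. Q * (v i)\<^sup>2)"
    using row by (intro sum_mono mult_right_mono) auto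
  finally show ?thesis by (simp add: sum_distrib_left)
qed

lemma pert_quadratic:
  assumes v: "v \<in> carrier_vec p"
  shows "v \<bullet> (pert p s e f *\<^sub>v v) = s * (v \<bullet> v + e * (\<Sum>i<p. \<Sum>j<p. f i j * v $ i * v $ j))"
proof -
  have "(\<Sum>j<p. pert p s e f $$ (i, j) * v $ i * v $ j) = s * ((v $ i)\<^sup>2 + e * (\<Sum>j<p. f i j * v $ i * v $ j))" if i: "i < p" for i
  proof -
    have "(\<Sum>j<p. pert p s e f $$ (i, j) * v $ i * v $ j) = (\<Sum>j<p. s * ((if i = j then v $ i * v $ j else 0) + e * (f i j * v $ i * v $ j)))"
      using i by (intro sum.cong) (auto simp: pert_def algebra_simps)
    also have "\<dots> = s * ((\<Sum>j<p. if i = j then v $ i * v $ j else 0) + e * (\<Sum>j<p. f i j * v $ i * v $ j))"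
      by (simp only: sum_distrib_left[symmetric] sum.distrib)
    finally show ?thesis using i by (simp add: power2_eq_square)
  qed
  then show ?thesis unfolding quadratic_form_sum[OF pert_carrier v v] scalar_prod_self_eq[OF v]
    by (simp add: sum.distrib sum_distrib_left distrib_left)
qed

lemma transpose_pert:
  assumes sym: "\<And>i j. i < p \<Longrightarrow> j < p \<Longrightarrow> f i j = f j i"
  shows "transpose_mat (pert p s e f) = pert p s e f"
  using sym by (intro eq_matI) (auto simp: pert_def)

lemma pert_quadratic_bounds:
  assumes sym: "\<And>i j. i < p \<Longrightarrow> j < p \<Longrightarrow> f i j = f j i" and nn: "\<And>i j. 0 \<le> f i j"
    and row: "\<And>i. i < p \<Longrightarrow> (\<Sum>j<p. f i j) \<le> Q" and s: "0 < s" and e: "0 \<le> e" and v: "v \<in> carrier_vec p"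
  shows "s * (1 - e * Q) * (v \<bullet> v) \<le> v \<bullet> (pert p s e f *\<^sub>v v)" "v \<bullet> (pert p s e f *\<^sub>v v) \<le> s * (1 + e * Q) * (v \<bullet> v)"
proof -
  let ?q = "\<Sum>i<p. \<Sum>j<p. f i j * v $ i * v $ j"
  have "\<bar>?q\<bar> \<le> Q * (v \<bullet> v)"
    using abs_symmetric_quadratic_le[of p f Q "\<lambda>i. v $ i"] sym nn row scalar_prod_self_eq[OF v] by simp
  then have "e * \<bar>?q\<bar> \<le> e * (Q * (v \<bullet> v))" using e by (rule mult_left_mono)
  then have "\<bar>e * ?q\<bar> \<le> e * Q * (v \<bullet> v)" using e by (simp add: abs_mult mult.assoc)
  then have "(1 - e * Q) * (v \<bullet> v) \<le> v \<bullet> v + e * ?q" "v \<bullet> v + e * ?q \<le> (1 + e * Q) * (v \<bullet> v)"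
    by (auto simp: algebra_simps)
  then show "s * (1 - e * Q) * (v \<bullet> v) \<le> v \<bullet> (pert p s e f *\<^sub>v v)" "v \<bullet> (pert p s e f *\<^sub>v v) \<le> s * (1 + e * Q) * (v \<bullet> v)"
    unfolding pert_quadratic[OF v] using s by (auto simp: mult.assoc intro: mult_left_mono)
qed

lemma spd_pert:
  assumes sym: "\<And>i j. i < p \<Longrightarrow> j < p \<Longrightarrow> f i j = f j i" and nn: "\<And>i j. 0 \<le> f i j"
    and row: "\<And>i. i < p \<Longrightarrow> (\<Sum>j<p. f i j) \<le> Q" and s: "0 < s" and e: "0 \<le> e" "e * Q < 1"
  shows "symmetric_pos_def p (pert p s e f)"
proof -
  {
    fix v :: "real vec" assume v: "v \<in> carrier_vec p" "v \<noteq> 0\<^sub>v p"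
    have "0 < s * (1 - e * Q) * (v \<bullet> v)" using s e scalar_prod_self_pos[OF v] by simp
    also have "\<dots> \<le> v \<bullet> (pert p s e f *\<^sub>v v)"
      using pert_quadratic_bounds(1)[of p f Q s e v] sym nn row s e(1) v(1) by blast
    finally have "0 < v \<bullet> (pert p s e f *\<^sub>v v)" .
  }
  then show ?thesis using transpose_pert[of p f s e] sym by (auto simp: symmetric_pos_def_def)
qed

text \<open>The form lies between \<open>s * (1 - e * Q)\<close> and \<open>s * (1 + e * Q)\<close>
  times the squared length, which gives the condition number. The 1 in \<open>Q + 1\<close> counts
  the diagonal entry.\<close>

lemma pert_in_G0:
  assumes p: "0 < p" and sym: "\<And>i j. i < p \<Longrightarrow> j < p \<Longrightarrow> f i j = f j i" and f01: "\<And>i j. f i j = 0 \<or> f i j = 1"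
    and row: "\<And>i. i < p \<Longrightarrow> (\<Sum>j<p. f i j) \<le> Q" and s: "0 < s" and e: "0 \<le> e" "e * Q < 1"
    and k: "Q + 1 \<le> k" and M: "s * (1 + e * Q) \<le> M" and M1: "(1 + e * Q) / (1 - e * Q) \<le> M1"
  shows "pert p s e f \<in> G0 p M1 k M"
proof -
  let ?A = "pert p s e f"
  have nn: "0 \<le> f i j" for i j using f01[of i j] by auto
  have spd: "symmetric_pos_def p ?A" using sym nn row s e by (rule spd_pert)
  have "lambda_max ?A / lambda_min ?A \<le> (s * (1 + e * Q)) / (s * (1 - e * Q))"
  proof (rule condition_number_le[OF pert_carrier _ p])
    show "transpose_mat ?A = ?A" using sym by (rule transpose_pert)
    show "0 < s * (1 - e * Q)" using s e by simp
    show "s * (1 - e * Q) * (v \<bullet> v) \<le> v \<bullet> (?A *\<^sub>v v)" if "v \<in> carrier_vec p" for v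
      using sym nn row s e(1) that by (rule pert_quadratic_bounds(1))
    show "v \<bullet> (?A *\<^sub>v v) \<le> s * (1 + e * Q) * (v \<bullet> v)" if "v \<in> carrier_vec p" for v
      using sym nn row s e(1) that by (rule pert_quadratic_bounds(2))
  qed
  also have "\<dots> = (1 + e * Q) / (1 - e * Q)" using s by simp
  finally have cond: "lambda_max ?A / lambda_min ?A \<le> M1" using M1 by linarith
  have symA: "?A $$ (i, j) = ?A $$ (j, i)" if "i < p" "j < p" for i j using sym[OF that] that by (simp add: pert_def)
  have rs: "(\<Sum>j<p. \<bar>?A $$ (i, j)\<bar>) \<le> M" if i: "i < p" for i
  proof -
    have "(\<Sum>j<p. \<bar>?A $$ (i, j)\<bar>) = (\<Sum>j<p. s * ((if i = j then 1 else 0) + e * f i j))"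
      using i s e nn by (intro sum.cong) (auto simp: pert_def)
    also have "\<dots> = s * (1 + e * (\<Sum>j<p. f i j))"
      using i by (simp add: sum_distrib_left[symmetric] sum.distrib)
    also have "\<dots> \<le> s * (1 + e * Q)" using row[OF i] s e by (intro mult_left_mono add_left_mono) auto
    finally show ?thesis using M by linarith
  qed
  have cs: "(\<Sum>i<p. \<bar>?A $$ (i, j)\<bar>) \<le> M" if j: "j < p" for j
  proof -
    have "(\<Sum>i<p. \<bar>?A $$ (i, j)\<bar>) = (\<Sum>i<p. \<bar>?A $$ (j, i)\<bar>)" using symA j by (intro sum.cong) auto
    then show ?thesis using rs[OF j] by simp
  qed
  have norm: "lw_mat_norm 1 ?A \<le> M" using rs cs by (intro lw_mat_norm_le[OF pert_carrier p]) auto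
  have nnz: "real (card {j. j < p \<and> ?A $$ (i, j) \<noteq> 0}) \<le> k" if i: "i < p" for i
  proof -
    have "{j. j < p \<and> ?A $$ (i, j) \<noteq> 0} \<subseteq> insert i {j \<in> {..<p}. f i j \<noteq> 0}"
      using i by (auto simp: pert_def split: if_splits)
    then have "card {j. j < p \<and> ?A $$ (i, j) \<noteq> 0} \<le> card (insert i {j \<in> {..<p}. f i j \<noteq> 0})" by (intro card_mono) auto
    also have "\<dots> \<le> Suc (card {j \<in> {..<p}. f i j \<noteq> 0})" by (simp add: card_insert_le_m1 card_insert_if)
    finally have "real (card {j. j < p \<and> ?A $$ (i, j) \<noteq> 0}) \<le> real (card {j \<in> {..<p}. f i j \<noteq> 0}) + 1" by simp
    also have "real (card {j \<in> {..<p}. f i j \<noteq> 0}) = (\<Sum>j\<in>{j \<in> {..<p}. f i j \<noteq> 0}. 1)" by simp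
    also have "\<dots> = (\<Sum>j\<in>{j \<in> {..<p}. f i j \<noteq> 0}. f i j)"
      by (rule sum.cong[OF refl]) (use f01 in fastforce)
    also have "\<dots> = (\<Sum>j<p. f i j)" by (intro sum.mono_neutral_left) auto
    finally show ?thesis using row[OF i] k by linarith
  qed
  have nnzc: "real (card {i. i < p \<and> ?A $$ (i, j) \<noteq> 0}) \<le> k" if j: "j < p" for j
  proof -
    have "{i. i < p \<and> ?A $$ (i, j) \<noteq> 0} = {i. i < p \<and> ?A $$ (j, i) \<noteq> 0}" using symA j by auto
    then show ?thesis using nnz[OF j] by simp
  qed
  show ?thesis using spd cond norm nnz nnzc by (simp add: G0_def)
qed

text \<open>\<open>y\<close> is \<open>b\<close> multiplied by the inverse of
  \<open>1 + e f\<close>. As \<open>e * Q \<le> 1 / 2\<close>, multiplication by \<open>e f\<close>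
  halves both the maximum norm (row sums) and the sum norm (column sums), so \<open>y\<close> is at
  most twice \<open>b\<close> in either; putting this into \<open>y - b = - e f y\<close> bounds the
  distortion.\<close>

lemma perturbed_identity_solution:
  fixes y b :: "nat \<Rightarrow> real"
  assumes sym: "\<And>i j. i < p \<Longrightarrow> j < p \<Longrightarrow> f i j = f j i" and nn: "\<And>i j. 0 \<le> f i j"
    and row: "\<And>i. i < p \<Longrightarrow> (\<Sum>j<p. f i j) \<le> Q" and e: "0 \<le> e" "e * Q \<le> 1 / 2" and Q: "0 \<le> Q"
    and y: "\<And>i. i < p \<Longrightarrow> y i + e * (\<Sum>j<p. f i j * y j) = b i"
    and b: "\<And>i. i < p \<Longrightarrow> \<bar>b i\<bar> \<le> 1" and b1: "(\<Sum>i<p. \<bar>b i\<bar>) \<le> c"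
  shows "\<And>i. i < p \<Longrightarrow> \<bar>y i\<bar> \<le> 2" "\<And>i. i < p \<Longrightarrow> \<bar>y i - b i\<bar> \<le> 2 * e * Q"
    "(\<Sum>i<p. \<bar>y i - b i\<bar>) \<le> 2 * e * Q * c"
proof -
  have d: "\<bar>y i - b i\<bar> \<le> e * (\<Sum>j<p. f i j * \<bar>y j\<bar>)" if i: "i < p" for i
  proof -
    have "y i - b i = - (e * (\<Sum>j<p. f i j * y j))" using y[OF i] by linarith
    then have "\<bar>y i - b i\<bar> = e * \<bar>\<Sum>j<p. f i j * y j\<bar>" using e(1) by (simp add: abs_mult)
    also have "\<bar>\<Sum>j<p. f i j * y j\<bar> \<le> (\<Sum>j<p. f i j * \<bar>y j\<bar>)"
      using nn by (intro order_trans[OF sum_abs] sum_mono) (auto simp: abs_mult)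
    finally show ?thesis using e(1) by (simp add: mult_left_mono)
  qed
  show y2: "\<bar>y i\<bar> \<le> 2" if i0: "i < p" for i
  proof -
    define m where "m = Max ((\<lambda>i. \<bar>y i\<bar>) ` {..<p})"
    have fin: "finite ((\<lambda>i. \<bar>y i\<bar>) ` {..<p})" by simp
    have ne: "(\<lambda>i. \<bar>y i\<bar>) ` {..<p} \<noteq> {}" using i0 by auto
    have m: "\<bar>y i\<bar> \<le> m" if "i < p" for i unfolding m_def using that by (intro Max_ge) auto
    have m0: "0 \<le> m" using m[OF i0] by linarith
    have "\<bar>y i\<bar> \<le> 1 + m / 2" if i: "i < p" for i
    proof -
      have "(\<Sum>j<p. f i j * \<bar>y j\<bar>) \<le> (\<Sum>j<p. f i j * m)" using m nn by (intro sum_mono mult_left_mono) auto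
      also have "\<dots> \<le> Q * m" unfolding sum_distrib_right[symmetric] using row[OF i] m0 by (rule mult_right_mono)
      finally have "e * (\<Sum>j<p. f i j * \<bar>y j\<bar>) \<le> e * (Q * m)" using e(1) by (rule mult_left_mono)
      also have "\<dots> \<le> 1 / 2 * m" unfolding mult.assoc[symmetric] using e(2) m0 by (rule mult_right_mono)
      finally show ?thesis using d[OF i] b[OF i] by linarith
    qed
    then have "m \<le> 1 + m / 2" unfolding m_def by (intro Max.boundedI[OF fin ne]) (auto simp: m_def)
    then show ?thesis using m[OF i0] by linarith
  qed
  show "\<bar>y i - b i\<bar> \<le> 2 * e * Q" if i: "i < p" for i
  proof -
    have "(\<Sum>j<p. f i j * \<bar>y j\<bar>) \<le> (\<Sum>j<p. f i j * 2)" using y2 nn by (intro sum_mono mult_left_mono) auto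
    also have "\<dots> \<le> Q * 2" unfolding sum_distrib_right[symmetric] using row[OF i] by (intro mult_right_mono) auto
    finally have "e * (\<Sum>j<p. f i j * \<bar>y j\<bar>) \<le> e * (Q * 2)" using e(1) by (rule mult_left_mono)
    then show ?thesis using d[OF i] by (simp add: mult_ac)
  qed
  define l where "l = (\<Sum>i<p. \<bar>y i\<bar>)"
  have l0: "0 \<le> l" by (simp add: l_def sum_nonneg)
  have "(\<Sum>i<p. \<bar>y i - b i\<bar>) \<le> (\<Sum>i<p. e * (\<Sum>j<p. f i j * \<bar>y j\<bar>))" using d by (intro sum_mono) auto
  also have "\<dots> = e * (\<Sum>j<p. (\<Sum>i<p. f i j) * \<bar>y j\<bar>)"
    unfolding sum_distrib_left[symmetric] sum_distrib_right by (subst sum.swap) simp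
  also have "\<dots> \<le> e * (\<Sum>j<p. Q * \<bar>y j\<bar>)"
  proof (intro mult_left_mono sum_mono mult_right_mono)
    fix j assume "j \<in> {..<p}"
    then have j: "j < p" by simp
    have "(\<Sum>i<p. f i j) = (\<Sum>i<p. f j i)" using sym[OF _ j] by (intro sum.cong) auto
    then show "(\<Sum>i<p. f i j) \<le> Q" using row[OF j] by simp
  qed (use e in auto)
  also have "\<dots> = e * Q * l" by (simp add: l_def sum_distrib_left[symmetric])
  finally have dl: "(\<Sum>i<p. \<bar>y i - b i\<bar>) \<le> e * Q * l" .
  have "l \<le> (\<Sum>i<p. \<bar>b i\<bar> + \<bar>y i - b i\<bar>)" unfolding l_def by (intro sum_mono) auto
  also have "\<dots> \<le> c + e * Q * l" using dl b1 by (simp add: sum.distrib)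
  also have "e * Q * l \<le> 1 / 2 * l" using e(2) l0 by (rule mult_right_mono)
  finally have "l \<le> 2 * c" by simp
  then have "e * Q * l \<le> e * Q * (2 * c)" using e(1) Q by (intro mult_left_mono) auto
  then show "(\<Sum>i<p. \<bar>y i - b i\<bar>) \<le> 2 * e * Q * c" using dl by (simp add: mult_ac)
qed

text \<open>\<open>(1 - a) (1 - a')\<close> exceeds the denominator
  \<open>1 - (a + a' + 2 b)\<close> by \<open>a a' + 2 b\<close>, and the denominator is at least
  1/2. Only \<open>b\<close> will carry the overlap of two random supports, so its bound
  \<open>bp\<close> stays in the exponent, while \<open>a a'\<close> is estimated by
  \<open>t\<^sup>2\<close>.\<close>

lemma chi_square_scalar_bound:
  fixes a a' b bp t d0 :: real
  assumes d0: "0 < d0" and a: "\<bar>a\<bar> \<le> t" "\<bar>a'\<bar> \<le> t" and b: "\<bar>b\<bar> \<le> bp" "bp \<le> t" and t: "t \<le> 1 / 8"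
  shows "sqrt (d0 * (1 - a) * (d0 * (1 - a')) / (d0 * (d0 * (1 - (a + a' + 2 * b))))) ^ n \<le> exp (real n * t\<^sup>2 + 2 * real n * bp)"
proof -
  let ?D = "1 - (a + a' + 2 * b)"
  define N where "N = t\<^sup>2 + 2 * bp"
  have D: "1 / 2 \<le> ?D" using a b t by linarith
  have "a * a' \<le> \<bar>a\<bar> * \<bar>a'\<bar>" by (metis abs_ge_self abs_mult)
  also have "\<dots> \<le> t * t" using a by (intro mult_mono) auto
  finally have N: "a * a' + 2 * b \<le> N" using b by (simp add: N_def power2_eq_square)
  have N0: "0 \<le> N" using b by (simp add: N_def)
  have "d0 * (1 - a) * (d0 * (1 - a')) / (d0 * (d0 * ?D)) = (1 - a) * (1 - a') / ?D"
    using d0 by simp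
  also have "\<dots> \<le> 1 + 2 * N"
  proof -
    have "(1 - a) * (1 - a') = ?D + (a * a' + 2 * b)" by (simp add: algebra_simps)
    also have "\<dots> \<le> ?D + N" using N by simp
    also have "\<dots> \<le> ?D + 2 * N * ?D"
      using mult_left_mono[OF D, of "2 * N"] N0 by simp
    also have "\<dots> = (1 + 2 * N) * ?D" by (simp add: algebra_simps)
    finally show ?thesis using D by (simp add: divide_le_eq)
  qed
  also have "\<dots> \<le> exp (2 * N)" by simp
  finally have "sqrt (d0 * (1 - a) * (d0 * (1 - a')) / (d0 * (d0 * ?D))) \<le> sqrt (exp (2 * N))" by simp
  also have "sqrt (exp (2 * N)) = exp N" by (rule real_sqrt_unique) (simp_all add: exp_double)
  finally have "sqrt (d0 * (1 - a) * (d0 * (1 - a')) / (d0 * (d0 * ?D))) ^ n \<le> exp N ^ n"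
    using d0 D a b t by (intro power_mono) auto
  also have "\<dots> = exp (real n * N)" by (simp add: exp_of_nat_mult)
  finally show ?thesis by (simp add: N_def algebra_simps)
qed

lemma mult_mat_vec_sum:
  fixes A :: "real mat"
  assumes "A \<in> carrier_mat p p" "z \<in> carrier_vec p" "c < p"
  shows "(A *\<^sub>v z) $ c = (\<Sum>j<p. A $$ (c, j) * z $ j)"
  using assms by (auto simp: scalar_prod_def atLeast0LessThan intro!: sum.cong)

text \<open>One row \<open>i\<close> of the matrix is replaced by a random one, with one nonzero entry per group \<open>t\<close> at a column
  \<open>cl t (x t)\<close>, uniform over \<open>Fr t\<close>. All other rows are known, and their effect on the chi-square
  distance is that the overlaps of two rows are measured by \<open>(1 + e f)\<close> inverse instead of the identity.\<close>

lemma row_chi_square_bound: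
  fixes f :: "nat \<Rightarrow> nat \<Rightarrow> real" and q n :: nat and Fr :: "nat \<Rightarrow> nat set" and cl :: "nat \<Rightarrow> nat \<Rightarrow> nat"
  assumes sym: "\<And>i j. i < p \<Longrightarrow> j < p \<Longrightarrow> f i j = f j i" and nn: "\<And>i j. 0 \<le> f i j"
    and row: "\<And>i. i < p \<Longrightarrow> (\<Sum>j<p. f i j) \<le> real q"
    and i: "i < p" and fi: "\<And>j. j < p \<Longrightarrow> f i j = 0"
    and s: "0 < s" and e: "0 < e" and q: "0 < q" and eq: "64 * e * real q \<le> 1"
    and fin: "\<And>t. t < q \<Longrightarrow> finite (Fr t)" and h: "0 < h" and hF: "\<And>t. t < q \<Longrightarrow> h \<le> real (card (Fr t))"
    and cl: "\<And>t v. t < q \<Longrightarrow> v \<in> Fr t \<Longrightarrow> cl t v < p \<and> cl t v \<noteq> i"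
    and inj: "\<And>t v t' v'. t < q \<Longrightarrow> v \<in> Fr t \<Longrightarrow> t' < q \<Longrightarrow> v' \<in> Fr t' \<Longrightarrow> cl t v = cl t' v' \<Longrightarrow> t = t' \<and> v = v'"
    and c3: "4 * real n * e ^ 3 * real q \<le> 1" and c4: "16 * real n * (real q)\<^sup>2 * e ^ 4 \<le> 1"
    and c5: "8 * real q * exp (2 * real n * e\<^sup>2 + 1) \<le> h"
  defines "P \<equiv> PiE {..<q} Fr"
    and "A0 \<equiv> pert p s e f"
    and "b \<equiv> (\<lambda>x. vec p (\<lambda>c. if \<exists>t<q. c = cl t (x t) then 1 else 0 :: real))"
  shows "\<And>x x'. x \<in> P \<Longrightarrow> x' \<in> P \<Longrightarrow>
      symmetric_pos_def p (sym_update p A0 (s * e) (unit_vec p i) (b x) + sym_update p A0 (s * e) (unit_vec p i) (b x') - A0)"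
    and "(\<Sum>x\<in>P. \<Sum>x'\<in>P. sqrt (Determinant.det (sym_update p A0 (s * e) (unit_vec p i) (b x)) * Determinant.det (sym_update p A0 (s * e) (unit_vec p i) (b x')) /
        (Determinant.det A0 * Determinant.det (sym_update p A0 (s * e) (unit_vec p i) (b x) + sym_update p A0 (s * e) (unit_vec p i) (b x') - A0))) ^ n)
      \<le> 2 * (real (card P))\<^sup>2"
proof -
  let ?u = "unit_vec p i :: real vec"
  have q1: "1 \<le> real q" using q by simp
  have "64 * e * 1 \<le> 64 * e * real q" using q1 e by (intro mult_left_mono) auto
  then have e64: "64 * e \<le> 1" using eq by linarith
  have eq2: "e * real q \<le> 1 / 64" using eq by simp
  have spd: "symmetric_pos_def p A0" unfolding A0_def
    using sym nn row s less_imp_le[OF e] eq2 by (intro spd_pert[of p f "real q"]) auto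
  note Ac = spdD[OF spd]
  let ?K = "mat_inv A0"
  note K = spdD[OF spd_mat_inv[OF spd]]
  have u: "?u \<in> carrier_vec p" by simp
  \<comment> \<open>As row \<open>i\<close> is still unperturbed, \<open>?u\<close> is an
    eigenvector of \<open>A0\<close>. Its products with vectors vanishing at \<open>i\<close> are
    therefore zero in the metric of the inverse, and the determinant of an update reduces to the
    factor \<open>1 - e\<^sup>2 * B w w\<close>.\<close>
  have A0u: "A0 *\<^sub>v ?u = s \<cdot>\<^sub>v ?u"
  proof (rule eq_vecI)
    fix j assume "j < dim_vec (s \<cdot>\<^sub>v ?u)"
    then have j: "j < p" by simp
    have "(A0 *\<^sub>v ?u) $ j = A0 $$ (j, i)" using Ac(1) i j by simp
    also have "\<dots> = (s \<cdot>\<^sub>v ?u) $ j" using i j sym[OF j i] fi[OF j] by (simp add: A0_def pert_def)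
    finally show "(A0 *\<^sub>v ?u) $ j = (s \<cdot>\<^sub>v ?u) $ j" .
  qed (use Ac in simp)
  have "s \<cdot>\<^sub>v (?K *\<^sub>v ?u) = ?u"
    using spd_mult_inv_vec(2)[OF spd u] unfolding A0u using mult_mat_vec[OF K(1) u] by simp
  then have Ku: "v \<bullet> (?K *\<^sub>v ?u) = v $ i / s" if v: "v \<in> carrier_vec p" for v
  proof -
    have "v \<bullet> (s \<cdot>\<^sub>v (?K *\<^sub>v ?u)) = v \<bullet> ?u" using \<open>s \<cdot>\<^sub>v (?K *\<^sub>v ?u) = ?u\<close> by simp
    moreover have "v \<bullet> (s \<cdot>\<^sub>v (?K *\<^sub>v ?u)) = s * (v \<bullet> (?K *\<^sub>v ?u))"
      using v spd_mult_inv_vec(3)[OF spd u] by (intro scalar_prod_smult_distrib) auto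
    moreover have "v \<bullet> ?u = v $ i" using i by simp
    ultimately show ?thesis using s by (simp add: field_simps)
  qed
  have uKu: "?u \<bullet> (?K *\<^sub>v ?u) = 1 / s" using Ku[OF u] i by simp
  have uKw: "?u \<bullet> (?K *\<^sub>v w) = 0" if "w \<in> carrier_vec p" "w $ i = 0" for w
    using symmetric_bilinear[OF K(1,2) u that(1)] Ku[OF that(1)] that(2) by simp
  \<comment> \<open>The overlap: for \<open>f = 0\<close> and indicator vectors it would be the
    number of common columns.\<close>
  define B where "B w w' = s * (w \<bullet> (?K *\<^sub>v w'))" for w w'
  have det: "Determinant.det (sym_update p A0 (s * e) ?u w) = Determinant.det A0 * (1 - e\<^sup>2 * B w w)"
    if w: "w \<in> carrier_vec p" "w $ i = 0" for w
    unfolding det_sym_update[OF spd u w(1)] uKu uKw[OF w] B_def using s by (simp add: power2_eq_square)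
  have spdw: "symmetric_pos_def p (sym_update p A0 (s * e) ?u w)" if w: "w \<in> carrier_vec p" and lt: "4 * e\<^sup>2 * B w w < 1" for w
  proof (rule spd_sym_update[OF spd u w])
    have "4 * (s * e)\<^sup>2 * (?u \<bullet> (?K *\<^sub>v ?u) * (w \<bullet> (?K *\<^sub>v w))) = 4 * e\<^sup>2 * B w w"
      unfolding uKu B_def using s by (simp add: power2_eq_square)
    then show "4 * (s * e)\<^sup>2 * (?u \<bullet> (?K *\<^sub>v ?u) * (w \<bullet> (?K *\<^sub>v w))) < 1" using lt by simp
  qed
  define C where "C x = (\<lambda>t. cl t (x t)) ` {..<q}" for x
  have xF: "x t \<in> Fr t" if "x \<in> P" "t < q" for x t using that by (auto simp: P_def PiE_def Pi_def)
  have Cp: "C x \<subseteq> {..<p}" "i \<notin> C x" if "x \<in> P" for x using cl xF[OF that] by (auto simp: C_def)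
  have injC: "inj_on (\<lambda>t. cl t (x t)) {..<q}" if "x \<in> P" for x
  proof (rule inj_onI)
    fix t t' assume tt: "t \<in> {..<q}" "t' \<in> {..<q}" "cl t (x t) = cl t' (x t')"
    then have t: "t < q" "t' < q" by auto
    show "t = t'" using inj[OF t(1) xF[OF that t(1)] t(2) xF[OF that t(2)] tt(3)] by simp
  qed
  have bc: "b x \<in> carrier_vec p" for x by (simp add: b_def)
  have bx: "b x $ c = (if c \<in> C x then 1 else 0)" if "c < p" for x c
    using that by (auto simp: b_def C_def)
  have bi: "b x $ i = 0" if "x \<in> P" for x using bx[OF i] Cp(2)[OF that] by simp
  have bsum: "b x \<bullet> z = (\<Sum>t<q. z $ (cl t (x t)))" if x: "x \<in> P" and z: "z \<in> carrier_vec p" for x z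
  proof -
    have "b x \<bullet> z = (\<Sum>c<p. if c \<in> C x then z $ c else 0)"
      using z bx by (auto simp: scalar_prod_def atLeast0LessThan intro!: sum.cong)
    also have "\<dots> = (\<Sum>c\<in>C x. z $ c)"
      using Cp(1)[OF x] by (subst sum.inter_restrict[symmetric]) (auto simp: Int_absorb1)
    also have "\<dots> = (\<Sum>t<q. z $ (cl t (x t)))"
      unfolding C_def by (subst sum.reindex[OF injC[OF x]]) simp
    finally show ?thesis .
  qed
  \<comment> \<open>The indicator \<open>b x\<close> distorted by the inverse of
    \<open>1 + e f\<close>.\<close>
  define y where "y x c = s * (?K *\<^sub>v b x) $ c" for x c
  have Kb: "?K *\<^sub>v b x \<in> carrier_vec p" for x by (rule spd_mult_inv_vec(3)[OF spd bc])
  have ysol: "y x c + e * (\<Sum>j<p. f c j * y x j) = b x $ c" if c: "c < p" for x c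
  proof -
    have "b x $ c = (A0 *\<^sub>v (?K *\<^sub>v b x)) $ c" using spd_mult_inv_vec(1)[OF spd bc] by simp
    also have "\<dots> = (\<Sum>j<p. A0 $$ (c, j) * (?K *\<^sub>v b x) $ j)"
      by (rule mult_mat_vec_sum[OF Ac(1) Kb c])
    also have "\<dots> = (\<Sum>j<p. (if c = j then y x j else 0) + e * (f c j * y x j))"
      using c by (intro sum.cong) (auto simp: A0_def pert_def y_def algebra_simps)
    also have "\<dots> = y x c + e * (\<Sum>j<p. f c j * y x j)"
      using c by (simp add: sum.distrib sum_distrib_left)
    finally show ?thesis by simp
  qed
  have b1: "(\<Sum>c<p. \<bar>b x $ c\<bar>) \<le> real q" if x: "x \<in> P" for x
  proof -
    have "(\<Sum>c<p. \<bar>b x $ c\<bar>) = (\<Sum>c<p. if c \<in> C x then 1 else 0)" using bx by (intro sum.cong) auto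
    also have "\<dots> = (\<Sum>c\<in>C x. 1)"
      using Cp(1)[OF x] by (subst sum.inter_restrict[symmetric]) (auto simp: Int_absorb1)
    also have "\<dots> \<le> real q" using card_image_le[of "{..<q}" "\<lambda>t. cl t (x t)"] by (simp add: C_def)
    finally show ?thesis .
  qed
  have bb: "\<bar>b x $ c\<bar> \<le> 1" if "c < p" for x c using bx[OF that] by simp
  have e2: "e * real q \<le> 1 / 2" using eq2 by simp
  note sol = perturbed_identity_solution[of p f "real q" e "y x" "\<lambda>c. b x $ c" "real q" for x, OF sym nn row less_imp_le[OF e] e2 _ ysol bb b1]
  have y2: "\<bar>y x c\<bar> \<le> 2" if "x \<in> P" "c < p" for x c using sol(1)[of x] that by simp
  have yd: "\<bar>y x c - b x $ c\<bar> \<le> 2 * e * real q" if "x \<in> P" "c < p" for x c using sol(2)[of x] that by simp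
  have yd1: "(\<Sum>c<p. \<bar>y x c - b x $ c\<bar>) \<le> 2 * e * real q * real q" if "x \<in> P" for x using sol(3)[of x] that by simp
  \<comment> \<open>Bounds the overlap and is, for fixed \<open>x\<close>, a sum over the groups of
    \<open>x'\<close>; so its exponential factorises over the product set \<open>P\<close>.\<close>
  define Y where "Y x x' = (\<Sum>t<q. \<bar>y x (cl t (x' t))\<bar>)" for x x'
  have Bsym: "B w w' = B w' w" if "w \<in> carrier_vec p" "w' \<in> carrier_vec p" for w w'
    unfolding B_def using symmetric_bilinear[OF K(1,2) that] by simp
  have BY: "\<bar>B (b x) (b x')\<bar> \<le> Y x x'" if x: "x \<in> P" and x': "x' \<in> P" for x x'
  proof -
    have "B (b x) (b x') = B (b x') (b x)" by (rule Bsym[OF bc bc])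
    also have "\<dots> = (\<Sum>t<q. y x (cl t (x' t)))"
      unfolding B_def bsum[OF x' Kb] y_def by (simp add: sum_distrib_left)
    finally show ?thesis unfolding Y_def by (simp add: sum_abs)
  qed
  have Y2: "Y x x' \<le> 2 * real q" if x: "x \<in> P" and x': "x' \<in> P" for x x'
  proof -
    have "Y x x' \<le> (\<Sum>t<q. 2)" unfolding Y_def using y2[OF x] cl xF[OF x'] by (intro sum_mono) auto
    then show ?thesis by simp
  qed
  have B2: "\<bar>B (b x) (b x')\<bar> \<le> 2 * real q" if "x \<in> P" "x' \<in> P" for x x'
    using BY[OF that] Y2[OF that] by linarith
  have Badd: "B (b x + b x') (b x + b x') = B (b x) (b x) + B (b x') (b x') + 2 * B (b x) (b x')" for x x'
  proof -
    have k: "?K *\<^sub>v (b x + b x') = ?K *\<^sub>v b x + ?K *\<^sub>v b x'" by (rule mult_add_distrib_mat_vec[OF K(1) bc bc])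
    have "(b x + b x') \<bullet> (?K *\<^sub>v b x + ?K *\<^sub>v b x') = (b x + b x') \<bullet> (?K *\<^sub>v b x) + (b x + b x') \<bullet> (?K *\<^sub>v b x')"
      using bc by (intro scalar_prod_add_distrib[OF _ Kb Kb]) auto
    also have "(b x + b x') \<bullet> (?K *\<^sub>v b x) = b x \<bullet> (?K *\<^sub>v b x) + b x' \<bullet> (?K *\<^sub>v b x)" by (rule add_scalar_prod_distrib[OF bc bc Kb])
    also have "(b x + b x') \<bullet> (?K *\<^sub>v b x') = b x \<bullet> (?K *\<^sub>v b x') + b x' \<bullet> (?K *\<^sub>v b x')" by (rule add_scalar_prod_distrib[OF bc bc Kb])
    finally show ?thesis unfolding k B_def symmetric_bilinear[OF K(1,2) bc[of x] bc[of x']]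
      by (simp add: algebra_simps)
  qed
  have add: "sym_update p A0 (s * e) ?u w + sym_update p A0 (s * e) ?u w' - A0 = sym_update p A0 (s * e) ?u (w + w')"
    if "w \<in> carrier_vec p" "w' \<in> carrier_vec p" for w w'
    using that Ac(1) by (intro eq_matI) (auto simp: sym_update_def algebra_simps)
  have e2q: "e\<^sup>2 * real q \<le> 1 / 4096"
  proof -
    have "e * (e * real q) \<le> (1 / 64) * (1 / 64)" using e e64 eq2 by (intro mult_mono) auto
    then show ?thesis by (simp add: power2_eq_square mult.assoc)
  qed
  define tau where "tau = 2 * (e\<^sup>2 * real q)"
  have tau: "tau \<le> 1 / 8" using e2q by (simp add: tau_def)
  have etau: "e\<^sup>2 * z \<le> tau" if "z \<le> 2 * real q" for z
    using mult_left_mono[OF that, of "e\<^sup>2"] by (simp add: tau_def)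
  have Bt: "\<bar>e\<^sup>2 * B (b x) (b x')\<bar> \<le> e\<^sup>2 * Y x x'" "e\<^sup>2 * Y x x' \<le> tau" if "x \<in> P" "x' \<in> P" for x x'
    using mult_left_mono[OF BY[OF that], of "e\<^sup>2"] etau[OF Y2[OF that]] by (auto simp: abs_mult)
  show spdadd: "symmetric_pos_def p (sym_update p A0 (s * e) ?u (b x) + sym_update p A0 (s * e) ?u (b x') - A0)"
    if x: "x \<in> P" and x': "x' \<in> P" for x x'
    unfolding add[OF bc bc]
  proof (rule spdw)
    have "B (b x + b x') (b x + b x') \<le> 8 * real q"
      unfolding Badd using B2[OF x x] B2[OF x' x'] B2[OF x x'] by linarith
    then have "4 * e\<^sup>2 * B (b x + b x') (b x + b x') \<le> 4 * e\<^sup>2 * (8 * real q)" by (intro mult_left_mono) auto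
    then show "4 * e\<^sup>2 * B (b x + b x') (b x + b x') < 1" using e2q by linarith
  qed (use bc in simp)
  let ?r = "\<lambda>x x'. sqrt (Determinant.det (sym_update p A0 (s * e) ?u (b x)) * Determinant.det (sym_update p A0 (s * e) ?u (b x')) /
        (Determinant.det A0 * Determinant.det (sym_update p A0 (s * e) ?u (b x) + sym_update p A0 (s * e) ?u (b x') - A0))) ^ n"
  define T where "T = 2 * real n * e\<^sup>2"
  have T0: "0 \<le> T" by (simp add: T_def)
  have ratio: "?r x x' \<le> exp (1 / 4) * exp (T * Y x x')" if x: "x \<in> P" and x': "x' \<in> P" for x x'
  proof -
    have wi: "(b x + b x') $ i = 0" using bi[OF x] bi[OF x'] carrier_vecD[OF bc[of x']] i by simp
    have "?r x x' \<le> exp (real n * tau\<^sup>2 + 2 * real n * (e\<^sup>2 * Y x x'))"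
      unfolding add[OF bc bc] det[OF bc bi[OF x]] det[OF bc bi[OF x']] det[OF add_carrier_vec[OF bc bc] wi] Badd
      using chi_square_scalar_bound[OF spd_det_pos[OF spd], of "e\<^sup>2 * B (b x) (b x)" tau "e\<^sup>2 * B (b x') (b x')" "e\<^sup>2 * B (b x) (b x')" "e\<^sup>2 * Y x x'" n]
        Bt[OF x x] Bt[OF x' x'] Bt[OF x x'] tau by (simp add: distrib_left mult.assoc mult.left_commute)
    also have "\<dots> \<le> exp (1 / 4 + T * Y x x')"
    proof -
      have "4 * (real n * tau\<^sup>2) = 16 * real n * (real q)\<^sup>2 * e ^ 4"
        by (simp add: tau_def power2_eq_square power4_eq_xxxx mult_ac)
      then have "real n * tau\<^sup>2 \<le> 1 / 4" using c4 by linarith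
      then show ?thesis by (simp add: T_def mult.assoc)
    qed
    finally show ?thesis by (simp add: exp_add)
  qed
  have Te: "T * (2 * e * real q) \<le> 1" using c3 by (simp add: T_def power2_eq_square power3_eq_cube mult_ac)
  define E where "E = exp (T + 1)"
  have E2: "2 \<le> E" unfolding E_def using exp_ge_add_one_self[of "T + 1"] T0 by linarith
  have hE: "8 * real q * E \<le> h" using c5 by (simp add: E_def T_def)
  have Pcard: "real (card P) = (\<Prod>t<q. real (card (Fr t)))" unfolding P_def by (simp add: card_PiE)
  have inner: "(\<Sum>x'\<in>P. exp (T * Y x x')) \<le> real (card P) * exp (1 / 4)" if x: "x \<in> P" for x
  proof -
    define d where "d c = \<bar>y x c - b x $ c\<bar>" for c
    define D where "D t = (\<Sum>v\<in>Fr t. d (cl t v))" for t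
    have d0: "0 \<le> d c" for c by (simp add: d_def)
    have D0: "0 \<le> D t" for t by (simp add: D_def d0 sum_nonneg)
    have Td: "T * d c \<le> 1" if "c < p" for c
      using mult_left_mono[OF yd[OF x that] T0] Te by (simp add: d_def)
    \<comment> \<open>At the column used by \<open>x\<close> the exponential is at most
      \<open>E\<close>. Elsewhere \<open>b x\<close> vanishes, only the distortion \<open>d\<close>
      is left, and \<open>exp z \<le> 1 + 2 z\<close> for \<open>z\<close> between 0 and 1.\<close>
    have trm: "exp (T * \<bar>y x (cl t v)\<bar>) \<le> 1 + 2 * T * d (cl t v) + (if v = x t then E else 0)" if t: "t < q" and v: "v \<in> Fr t" for t v
    proof -
      have cp: "cl t v < p" using cl[OF t v] by simp
      let ?z = "T * d (cl t v)"
      have z: "0 \<le> ?z" "?z \<le> 1" using T0 d0 Td[OF cp] by auto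
      show ?thesis
      proof (cases "v = x t")
        case True
        have "\<bar>y x (cl t v)\<bar> \<le> 1 + d (cl t v)" using bb[OF cp, of x] by (simp add: d_def)
        then have "T * \<bar>y x (cl t v)\<bar> \<le> T * (1 + d (cl t v))" using T0 by (rule mult_left_mono)
        then have "T * \<bar>y x (cl t v)\<bar> \<le> T + 1" using z by (simp add: distrib_left)
        then have "exp (T * \<bar>y x (cl t v)\<bar>) \<le> E" by (simp add: E_def)
        then show ?thesis using True z by simp
      next
        case False
        have "cl t v \<notin> C x"
        proof
          assume "cl t v \<in> C x"
          then obtain t' where t': "t' < q" "cl t v = cl t' (x t')" by (auto simp: C_def)
          then have "t = t' \<and> v = x t'" using inj[OF t v t'(1) xF[OF x t'(1)]] by simp
          then show False using False by simp
        qed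
        then have "\<bar>y x (cl t v)\<bar> = d (cl t v)" using bx[OF cp, of x] by (simp add: d_def)
        moreover have "exp ?z \<le> 1 + ?z + ?z\<^sup>2" using z by (rule exp_bound)
        moreover have "?z\<^sup>2 \<le> ?z" using z by (simp add: power2_eq_square mult_left_le)
        ultimately show ?thesis using False by simp
      qed
    qed
    \<comment> \<open>A group of at least \<open>h\<close> columns dilutes the single coincidence
      and the distortions; \<open>1 + z / h \<le> exp (z / h)\<close> turns the product over the
      groups into a sum of exponents.\<close>
    have grp: "(\<Sum>v\<in>Fr t. exp (T * \<bar>y x (cl t v)\<bar>)) \<le> real (card (Fr t)) * exp ((2 * T * D t + E) / h)" if t: "t < q" for t
    proof -
      let ?c = "real (card (Fr t))"
      let ?z = "2 * T * D t + E"
      have z: "0 \<le> ?z" using T0 D0[of t] E2 by simp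
      have "(\<Sum>v\<in>Fr t. exp (T * \<bar>y x (cl t v)\<bar>)) \<le> (\<Sum>v\<in>Fr t. 1 + 2 * T * d (cl t v) + (if v = x t then E else 0))"
        using trm[OF t] by (rule sum_mono)
      also have "\<dots> = ?c + ?z"
        using fin[OF t] xF[OF x t] by (simp add: sum.distrib D_def sum_distrib_left)
      also have "\<dots> \<le> ?c + ?c * (?z / h)"
      proof -
        have "h * (?z / h) \<le> ?c * (?z / h)" using hF[OF t] z h by (intro mult_right_mono) auto
        then show ?thesis using h by simp
      qed
      also have "\<dots> = ?c * (1 + ?z / h)" by (simp add: distrib_left)
      also have "\<dots> \<le> ?c * exp (?z / h)" by (intro mult_left_mono) auto
      finally show ?thesis .
    qed
    have "(\<Sum>x'\<in>P. exp (T * Y x x')) = (\<Sum>x'\<in>P. \<Prod>t<q. exp (T * \<bar>y x (cl t (x' t))\<bar>))"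
      by (simp add: Y_def sum_distrib_left exp_sum)
    also have "\<dots> = (\<Prod>t<q. \<Sum>v\<in>Fr t. exp (T * \<bar>y x (cl t v)\<bar>))"
      unfolding P_def using fin by (subst prod_sum_PiE) auto
    also have "\<dots> \<le> (\<Prod>t<q. real (card (Fr t)) * exp ((2 * T * D t + E) / h))"
      using grp by (intro prod_mono) (auto intro: sum_nonneg)
    also have "\<dots> = real (card P) * exp (\<Sum>t<q. (2 * T * D t + E) / h)"
      by (simp add: Pcard prod.distrib exp_sum)
    also have "\<dots> \<le> real (card P) * exp (1 / 4)"
    proof (intro mult_left_mono)
      \<comment> \<open>Since \<open>cl\<close> is injective over all groups, the distortions add up
        to at most the sum norm of \<open>y x - b x\<close>, at most \<open>2 e q^2\<close>; as
        \<open>T * (2 * e * real q) \<le> 1\<close>, the weight \<open>T\<close> turns this into at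
        most \<open>q\<close>.\<close>
      have "(\<Sum>t<q. D t) = (\<Sum>(t, v)\<in>(SIGMA t:{..<q}. Fr t). d (cl t v))"
        unfolding D_def using fin by (subst sum.Sigma) auto
      also have "\<dots> = (\<Sum>c\<in>(\<lambda>(t, v). cl t v) ` (SIGMA t:{..<q}. Fr t). d c)"
        using inj by (subst sum.reindex) (auto intro!: inj_onI simp: case_prod_beta)
      also have "\<dots> \<le> (\<Sum>c<p. d c)"
        using cl d0 by (intro sum_mono2) auto
      also have "\<dots> \<le> 2 * e * real q * real q" using yd1[OF x] by (simp add: d_def)
      finally have "T * (\<Sum>t<q. D t) \<le> T * (2 * e * real q * real q)" using T0 by (rule mult_left_mono)
      also have "\<dots> = T * (2 * e * real q) * real q" by simp
      also have "\<dots> \<le> 1 * real q" using Te by (rule mult_right_mono) simp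
      finally have TD: "T * (\<Sum>t<q. D t) \<le> real q" by simp
      have "(\<Sum>t<q. 2 * T * D t + E) = 2 * (T * (\<Sum>t<q. D t)) + real q * E"
        by (simp add: sum.distrib sum_distrib_left mult_ac)
      also have "\<dots> \<le> real q * 2 + real q * E" using TD by simp
      also have "\<dots> \<le> real q * E + real q * E" using E2 by (intro add_right_mono mult_left_mono) auto
      also have "\<dots> \<le> h * (1 / 4)" using hE by (simp add: mult_ac)
      finally have "(\<Sum>t<q. 2 * T * D t + E) / h \<le> 1 / 4" using h by (simp add: divide_le_eq mult.commute)
      then show "exp (\<Sum>t<q. (2 * T * D t + E) / h) \<le> exp (1 / 4)"
        unfolding sum_divide_distrib[symmetric] exp_le_cancel_iff .
    qed simp
    finally show ?thesis .
  qed
  have "(\<Sum>x\<in>P. \<Sum>x'\<in>P. ?r x x') \<le> (\<Sum>x\<in>P. \<Sum>x'\<in>P. exp (1 / 4) * exp (T * Y x x'))"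
    using ratio by (intro sum_mono) auto
  also have "\<dots> = (\<Sum>x\<in>P. exp (1 / 4) * (\<Sum>x'\<in>P. exp (T * Y x x')))" by (simp add: sum_distrib_left)
  also have "\<dots> \<le> (\<Sum>x\<in>P. exp (1 / 4) * (real (card P) * exp (1 / 4)))"
    using inner by (intro sum_mono mult_left_mono) auto
  \<comment> \<open>One factor comes from the self-overlaps through \<open>c4\<close>, the other
    from coincidences and distortions through \<open>c3\<close> and \<open>c5\<close>.\<close>
  also have "\<dots> = (exp (1 / 4) * exp (1 / 4)) * (real (card P))\<^sup>2" by (simp add: power2_eq_square)
  also have "exp (1 / 4) * exp (1 / 4) \<le> (2::real)"
  proof -
    have "exp (1 / 4) * exp (1 / 4) = exp (1 / 2 :: real)" by (simp add: exp_add[symmetric])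
    also have "\<dots> \<le> 1 + 1 / 2 + (1 / 2)\<^sup>2" by (rule exp_bound) auto
    finally show ?thesis by (simp add: power2_eq_square)
  qed
  finally show "(\<Sum>x\<in>P. \<Sum>x'\<in>P. ?r x x') \<le> 2 * (real (card P))\<^sup>2" by (simp add: mult_right_mono)
qed

section \<open>Perturbing many rows\<close>

lemma ennreal_le_diff_plus:
  assumes "0 \<le> y"
  shows "ennreal x \<le> ennreal (x - y) + ennreal y"
proof (cases "y \<le> x")
  case True
  then show ?thesis using assms by (subst ennreal_plus[symmetric]) auto
next
  case False
  then have "ennreal x \<le> ennreal y" by (intro ennreal_leI) simp
  then show ?thesis by (rule add_increasing[rotated]) simp
qed

text \<open>The perturbed rows are those below \<open>r\<close>; the next \<open>q * m\<close>
  indices are \<open>q\<close> groups of \<open>m\<close> columns, and a perturbed row has one entry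
  in each group. The ranges are disjoint, so the pattern is bipartite. \<open>rq\<close> keeps half
  of each group free and makes the rows no more numerous than the block columns, as the norm bound
  by blocks demands. The 16 in \<open>c5\<close> is twice the constant for one row, because only
  \<open>m / 2\<close> free columns are guaranteed.\<close>

locale block_design =
  fixes p r q m n :: nat and s e :: real and \<mu> :: "real vec"
  assumes q: "0 < q" and m: "0 < m" and r: "0 < r" and rp: "r + q * m \<le> p" and rq: "2 * r \<le> q * m"
    and s: "0 < s" and e: "0 < e" and eq: "64 * e * real q \<le> 1"
    and c3: "4 * real n * e ^ 3 * real q \<le> 1" and c4: "16 * real n * (real q)\<^sup>2 * e ^ 4 \<le> 1"
    and c5: "16 * real q * exp (2 * real n * e\<^sup>2 + 1) \<le> real m"
    and mu: "\<mu> \<in> carrier_vec p"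
begin

definition colm :: "nat \<Rightarrow> nat \<Rightarrow> nat" where
  "colm t v = r + t * m + v"

definition supports :: "(nat \<Rightarrow> nat) set" where
  "supports = PiE {..<q} (\<lambda>_. {..<m})"

text \<open>The cap \<open>q\<close> on the use of a column gives columns the same degree bound as
  rows; by symmetry of the matrices it is needed for membership in the class.\<close>

definition configs :: "(nat \<Rightarrow> nat \<Rightarrow> nat) set" where
  "configs = {g \<in> PiE {..<r} (\<lambda>_. supports). \<forall>t<q. \<forall>v<m. card {a \<in> {..<r}. g a t = v} \<le> q}"

definition free_cols :: "(nat \<Rightarrow> nat \<Rightarrow> nat) \<Rightarrow> nat \<Rightarrow> nat \<Rightarrow> nat set" where
  "free_cols g i t = {v \<in> {..<m}. card {a \<in> {..<r} - {i}. g a t = v} < q}"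

definition free_supports :: "(nat \<Rightarrow> nat \<Rightarrow> nat) \<Rightarrow> nat \<Rightarrow> (nat \<Rightarrow> nat) set" where
  "free_supports g i = PiE {..<q} (free_cols g i)"

definition scols :: "(nat \<Rightarrow> nat) \<Rightarrow> nat set" where
  "scols x = (\<lambda>t. colm t (x t)) ` {..<q}"

definition adj :: "nat set \<Rightarrow> (nat \<Rightarrow> nat \<Rightarrow> nat) \<Rightarrow> nat \<Rightarrow> nat \<Rightarrow> bool" where
  "adj I g a c \<longleftrightarrow> a \<in> I \<and> c \<in> scols (g a)"

definition pattern :: "nat set \<Rightarrow> (nat \<Rightarrow> nat \<Rightarrow> nat) \<Rightarrow> nat \<Rightarrow> nat \<Rightarrow> real" where
  "pattern I g i j = (if adj I g i j \<or> adj I g j i then 1 else 0)"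

text \<open>\<open>g\<close> gives a support to every row and \<open>I\<close> selects the rows that
  are present, so the set of configurations does not change with \<open>I\<close>.\<close>

definition conf :: "nat set \<Rightarrow> (nat \<Rightarrow> nat \<Rightarrow> nat) \<Rightarrow> real mat" where
  "conf I g = pert p s e (pattern I g)"

section \<open>Combinatorics of the configurations\<close>

lemma p_pos: "0 < p"
  using r rp by simp

lemma colm_less:
  assumes "t < q" "v < m"
  shows "colm t v < r + q * m"
proof -
  have "Suc t * m \<le> q * m" using assms by (intro mult_right_mono) auto
  then show ?thesis using assms by (simp add: colm_def)
qed

lemma colm_ge: "r \<le> colm t v"
  by (simp add: colm_def)

lemma colm_inj:
  assumes "v < m" "v' < m" "colm t v = colm t' v'"
  shows "t = t' \<and> v = v'"
proof -
  have eq: "t * m + v = t' * m + v'" using assms(3) by (simp add: colm_def)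
  have "(t * m + v) div m = t" "(t' * m + v') div m = t'" using assms(1,2) by simp_all
  then have "t = t'" using eq by simp
  then show ?thesis using eq by simp
qed

lemma supports_less: "x \<in> supports \<Longrightarrow> t < q \<Longrightarrow> x t < m"
  by (auto simp: supports_def PiE_def Pi_def)

lemma scols_bounds:
  assumes "x \<in> supports" "c \<in> scols x"
  shows "r \<le> c" "c < r + q * m" "c < p"
proof -
  obtain t where t: "t < q" "c = colm t (x t)" using assms(2) by (auto simp: scols_def)
  show "r \<le> c" using t colm_ge by simp
  show "c < r + q * m" using t colm_less[OF t(1) supports_less[OF assms(1) t(1)]] by simp
  then show "c < p" using rp by simp
qed

lemma card_scols:
  assumes x: "x \<in> supports"
  shows "card (scols x) = q"
proof -
  have "inj_on (\<lambda>t. colm t (x t)) {..<q}"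
  proof (rule inj_onI)
    fix t t' assume "t \<in> {..<q}" "t' \<in> {..<q}" and eq: "colm t (x t) = colm t' (x t')"
    then have "x t < m" "x t' < m" using supports_less[OF x] by auto
    then show "t = t'" using colm_inj eq by blast
  qed
  then show ?thesis by (simp add: scols_def card_image)
qed

lemma finite_configs: "finite configs"
proof -
  have "finite supports" unfolding supports_def by (intro finite_PiE) auto
  then have "finite (PiE {..<r} (\<lambda>_. supports))" by (intro finite_PiE) auto
  then show ?thesis by (rule finite_subset[rotated]) (auto simp: configs_def)
qed

text \<open>Row \<open>a\<close> takes position \<open>a div q\<close> in every group: each position
  is used by at most \<open>q\<close> consecutive rows, and \<open>r \<le> q * m\<close> keeps it
  below \<open>m\<close>.\<close>

lemma configs_nonempty: "configs \<noteq> {}"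
proof -
  define g where "g = (\<lambda>a\<in>{..<r}. \<lambda>t\<in>{..<q}. a div q)"
  have "a div q < m" if "a < r" for a
    using that rq q by (subst div_less_iff_less_mult) (auto simp: mult.commute)
  then have "g \<in> PiE {..<r} (\<lambda>_. supports)" by (auto simp: g_def supports_def)
  moreover have "card {a \<in> {..<r}. g a t = v} \<le> q" if t: "t < q" for t v
  proof -
    have "{a \<in> {..<r}. g a t = v} \<subseteq> {v * q..<v * q + q}"
    proof
      fix a assume "a \<in> {a \<in> {..<r}. g a t = v}"
      then have "a div q = v" using t by (auto simp: g_def)
      then have "v * q + a mod q = a" by (metis div_mult_mod_eq)
      moreover have "a mod q < q" using q by simp
      ultimately show "a \<in> {v * q..<v * q + q}" unfolding atLeastLessThan_iff by linarith
    qed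
    then have "card {a \<in> {..<r}. g a t = v} \<le> card {v * q..<v * q + q}" by (intro card_mono) auto
    then show ?thesis by simp
  qed
  ultimately have "g \<in> configs" by (simp add: configs_def)
  then show ?thesis by blast
qed

lemma configs_supports: "g \<in> configs \<Longrightarrow> a < r \<Longrightarrow> g a \<in> supports"
  by (auto simp: configs_def PiE_def Pi_def)

lemma adj_less:
  assumes "g \<in> configs" "I \<subseteq> {..<r}" "adj I g a c"
  shows "a < r" "r \<le> c"
  using assms configs_supports[OF assms(1)] scols_bounds(1) by (auto simp: adj_def)

lemma pattern_sym: "pattern I g i j = pattern I g j i"
  by (auto simp: pattern_def)

lemma pattern_01: "pattern I g i j = 0 \<or> pattern I g i j = 1"
  by (auto simp: pattern_def)

lemma pattern_nonneg: "0 \<le> pattern I g i j"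
  by (auto simp: pattern_def)

text \<open>The graph is bipartite. A row below \<open>r\<close> has at most the \<open>q\<close>
  neighbours in its support; an index beyond has as neighbours only rows using the one position it
  stands for, at most \<open>q\<close> by the cap.\<close>

lemma pattern_row_sum:
  assumes g: "g \<in> configs" and I: "I \<subseteq> {..<r}"
  shows "(\<Sum>j<p. pattern I g i j) \<le> real q"
proof -
  let ?S = "{j \<in> {..<p}. adj I g i j \<or> adj I g j i}"
  have "(\<Sum>j<p. pattern I g i j) = real (card ?S)"
    unfolding pattern_def by (simp add: sum.If_cases Int_def)
  also have "card ?S \<le> q"
  proof (cases "i < r")
    case True
    have "?S \<subseteq> scols (g i)"
    proof
      fix j assume "j \<in> ?S"
      moreover have "\<not> adj I g j i" using adj_less(2)[OF g I, of j i] True by auto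
      ultimately show "j \<in> scols (g i)" by (auto simp: adj_def)
    qed
    then have "card ?S \<le> card (scols (g i))" by (intro card_mono) (auto simp: scols_def)
    then show ?thesis using card_scols[OF configs_supports[OF g True]] by simp
  next
    case False
    have S: "j < r \<and> i \<in> scols (g j)" if "j \<in> ?S" for j
    proof -
      have "\<not> adj I g i j" using adj_less(1)[OF g I, of i j] False by auto
      then have "adj I g j i" using that by auto
      then show ?thesis using adj_less(1)[OF g I] by (auto simp: adj_def)
    qed
    show ?thesis
    proof (cases "?S = {}")
      case False
      then obtain j0 where j0: "j0 < r" "i \<in> scols (g j0)" using S by blast
      then obtain t where t: "t < q" "i = colm t (g j0 t)" by (auto simp: scols_def)
      have v: "g j0 t < m" using supports_less[OF configs_supports[OF g j0(1)] t(1)] .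
      have "?S \<subseteq> {a \<in> {..<r}. g a t = g j0 t}"
      proof
        fix j assume "j \<in> ?S"
        then have j: "j < r" "i \<in> scols (g j)" using S by auto
        then obtain t' where t': "t' < q" "i = colm t' (g j t')" by (auto simp: scols_def)
        have v': "g j t' < m" using supports_less[OF configs_supports[OF g j(1)] t'(1)] .
        have "colm t (g j0 t) = colm t' (g j t')" using t(2) t'(2) by (rule subst)
        from colm_inj[OF v v' this] have "g j t = g j0 t" by metis
        then show "j \<in> {a \<in> {..<r}. g a t = g j0 t}" using j by simp
      qed
      then have "card ?S \<le> card {a \<in> {..<r}. g a t = g j0 t}" by (intro card_mono) auto
      also have "\<dots> \<le> q" using g t(1) v by (simp add: configs_def)
      finally show ?thesis .
    qed (simp only: card.empty)
  qed
  finally show ?thesis by simp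
qed

lemma eq_less: "e * real q \<le> 1 / 64"
  using eq by simp

lemma spd_conf:
  assumes "g \<in> configs" "I \<subseteq> {..<r}"
  shows "symmetric_pos_def p (conf I g)"
  unfolding conf_def
  using pattern_sym pattern_nonneg pattern_row_sum[OF assms] s less_imp_le[OF e] eq_less
  by (intro spd_pert[where Q = "real q"]) auto

lemma conf_in_G0:
  assumes "g \<in> configs" "I \<subseteq> {..<r}" "real q + 1 \<le> k" "s * (1 + e * real q) \<le> M"
    "(1 + e * real q) / (1 - e * real q) \<le> M1"
  shows "conf I g \<in> G0 p M1 k M"
  unfolding conf_def
  using p_pos pattern_sym pattern_01 pattern_row_sum[OF assms(1,2)] s less_imp_le[OF e] eq_less assms(3-5)
  by (intro pert_in_G0[where Q = "real q"]) auto

lemma pattern_zero: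
  assumes "g \<in> configs" "I \<subseteq> {..<r}" "i < r" "i \<notin> I"
  shows "pattern I g i j = 0"
proof -
  have "\<not> adj I g j i" using adj_less(2)[OF assms(1,2), of j i] assms(3) by auto
  then show ?thesis using assms(4) by (auto simp: pattern_def adj_def)
qed

text \<open>Connects the design with the analysis of a single row: as \<open>i\<close> is not in
  \<open>I\<close>, row and column \<open>i\<close> of \<open>conf I g\<close> are unperturbed, and
  switching the row on adds the unit vector times the indicator of its support, symmetrised.\<close>

lemma conf_insert:
  assumes g: "g \<in> configs" and I: "I \<subseteq> {..<r}" and i: "i < r" "i \<notin> I" and x: "x \<in> supports"
  shows "conf (insert i I) (g(i := x)) =
    sym_update p (conf I g) (s * e) (unit_vec p i) (vec p (\<lambda>c. if \<exists>t<q. c = colm t (x t) then 1 else 0))"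
proof -
  have ip: "i < p" using i rp by simp
  have cx: "(\<exists>t<q. c = colm t (x t)) \<longleftrightarrow> c \<in> scols x" for c by (auto simp: scols_def)
  have ix: "i \<notin> scols x" using scols_bounds(1)[OF x, of i] i by auto
  have adj': "adj (insert i I) (g(i := x)) a c \<longleftrightarrow> (a = i \<and> c \<in> scols x) \<or> (a \<noteq> i \<and> adj I g a c)" for a c
    using i(2) by (auto simp: adj_def)
  have pat: "pattern (insert i I) (g(i := x)) a c = pattern I g a c +
      ((if a = i then 1 else 0) * (if c \<in> scols x then 1 else 0) + (if a \<in> scols x then 1 else 0) * (if c = i then 1 else 0))" for a c
  proof -
    consider "a = i" "c = i" | "a = i" "c \<noteq> i" | "a \<noteq> i" "c = i" | "a \<noteq> i" "c \<noteq> i" by blast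
    then show ?thesis
    proof cases
      case 1
      then show ?thesis using pattern_zero[OF g I i, of i] ix by (simp add: pattern_def[of "insert i I"] adj')
    next
      case 2
      have na: "\<not> adj I g c i" using adj_less(2)[OF g I, of c i] i by auto
      show ?thesis using 2 pattern_zero[OF g I i, of c] na ix by (simp add: pattern_def[of "insert i I"] adj')
    next
      case 3
      have na: "\<not> adj I g a i" using adj_less(2)[OF g I, of a i] i by auto
      show ?thesis using 3 pattern_zero[OF g I i, of a] pattern_sym[of I g a i] na ix by (simp add: pattern_def[of "insert i I"] adj')
    next
      case 4
      then show ?thesis by (simp add: pattern_def adj')
    qed
  qed
  show ?thesis
  proof (rule eq_matI)
    fix a c assume "a < dim_row (sym_update p (conf I g) (s * e) (unit_vec p i) (vec p (\<lambda>c. if \<exists>t<q. c = colm t (x t) then 1 else 0)))"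
      "c < dim_col (sym_update p (conf I g) (s * e) (unit_vec p i) (vec p (\<lambda>c. if \<exists>t<q. c = colm t (x t) then 1 else 0)))"
    then have ac: "a < p" "c < p" by (auto simp: sym_update_def)
    have ua: "unit_vec p i $ a = (if a = i then 1 else 0 :: real)" "unit_vec p i $ c = (if c = i then 1 else 0 :: real)"
      using ac ip by (auto simp: unit_vec_def)
    show "conf (insert i I) (g(i := x)) $$ (a, c) =
      sym_update p (conf I g) (s * e) (unit_vec p i) (vec p (\<lambda>c. if \<exists>t<q. c = colm t (x t) then 1 else 0)) $$ (a, c)"
      using ac unfolding sym_update_def conf_def pert_def cx
      by (simp only: index_mat index_vec ua pat case_prod_conv) (simp add: algebra_simps)
  qed (simp_all add: conf_def sym_update_def pert_def)
qed

text \<open>Every saturated position is used by at least \<open>q\<close> rows, and different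
  positions by different rows, so there are at most \<open>r / q \<le> m / 2\<close> of
  them.\<close>

lemma card_free_cols:
  assumes g: "g \<in> configs" and t: "t < q"
  shows "real m / 2 \<le> real (card (free_cols g i t))"
proof -
  let ?F = "\<lambda>v. {a \<in> {..<r} - {i}. g a t = v}"
  define sat where "sat = {v \<in> {..<m}. q \<le> card (?F v)}"
  have fin: "finite sat" by (simp add: sat_def)
  have "q * card sat = (\<Sum>v\<in>sat. q)" by simp
  also have "\<dots> \<le> (\<Sum>v\<in>sat. card (?F v))" by (rule sum_mono) (simp add: sat_def)
  also have "\<dots> = card (\<Union>v\<in>sat. ?F v)" using fin by (intro card_UN_disjoint[symmetric]) auto
  also have "\<dots> \<le> card {..<r}" by (intro card_mono) auto
  finally have "q * card sat \<le> r" by simp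
  then have "2 * (q * card sat) \<le> q * m" using rq by linarith
  then have "q * (2 * card sat) \<le> q * m" by (simp only: mult.left_commute)
  then have s2: "2 * card sat \<le> m" using q by (simp only: mult_le_cancel1)
  have "free_cols g i t = {..<m} - sat" by (auto simp: free_cols_def sat_def not_le)
  then have "card (free_cols g i t) = m - card sat"
    using fin by (simp add: card_Diff_subset sat_def Collect_mono subset_iff)
  then show ?thesis using s2 by linarith
qed

lemma free_supports_subset: "free_supports g i \<subseteq> supports"
  unfolding free_supports_def supports_def by (rule PiE_mono) (auto simp: free_cols_def)

lemma free_cols_upd: "free_cols (g(i := x)) i t = free_cols g i t"
proof -
  have "{a \<in> {..<r} - {i}. (g(i := x)) a t = v} = {a \<in> {..<r} - {i}. g a t = v}" for v by auto
  then show ?thesis by (simp add: free_cols_def)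
qed

lemma free_supports_upd: "free_supports (g(i := x)) i = free_supports g i"
  by (simp add: free_supports_def free_cols_upd cong: PiE_cong)

lemma config_row_free:
  assumes g: "g \<in> configs" and i: "i < r"
  shows "g i \<in> free_supports g i"
proof -
  have gi: "g i \<in> supports" by (rule configs_supports[OF g i])
  have "g i t \<in> free_cols g i t" if t: "t < q" for t
  proof -
    have v: "g i t < m" by (rule supports_less[OF gi t])
    have "{a \<in> {..<r}. g a t = g i t} = insert i {a \<in> {..<r} - {i}. g a t = g i t}" using i by auto
    then have "card {a \<in> {..<r}. g a t = g i t} = Suc (card {a \<in> {..<r} - {i}. g a t = g i t})" by simp
    moreover have "card {a \<in> {..<r}. g a t = g i t} \<le> q" using g t v by (simp add: configs_def)
    ultimately show ?thesis using v by (simp add: free_cols_def)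
  qed
  then show ?thesis using gi by (auto simp: free_supports_def supports_def PiE_def Pi_def extensional_def)
qed

lemma config_upd:
  assumes g: "g \<in> configs" and i: "i < r" and x: "x \<in> free_supports g i"
  shows "g(i := x) \<in> configs"
proof -
  have xs: "x \<in> supports" using x free_supports_subset by blast
  have "g(i := x) \<in> PiE {..<r} (\<lambda>_. supports)"
    using g xs i by (auto simp: configs_def PiE_def Pi_def extensional_def)
  moreover have "card {a \<in> {..<r}. (g(i := x)) a t = v} \<le> q" if t: "t < q" and v: "v < m" for t v
  proof (cases "x t = v")
    case True
    have "x t \<in> free_cols g i t" using x t by (auto simp: free_supports_def PiE_def Pi_def)
    then have lt: "card {a \<in> {..<r} - {i}. g a t = v} < q" using True by (simp add: free_cols_def)
    have "{a \<in> {..<r}. (g(i := x)) a t = v} \<subseteq> insert i {a \<in> {..<r} - {i}. g a t = v}" by auto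
    then have "card {a \<in> {..<r}. (g(i := x)) a t = v} \<le> card (insert i {a \<in> {..<r} - {i}. g a t = v})" by (intro card_mono) auto
    also have "\<dots> = Suc (card {a \<in> {..<r} - {i}. g a t = v})" by simp
    finally show ?thesis using lt by simp
  next
    case False
    have "{a \<in> {..<r}. (g(i := x)) a t = v} \<subseteq> {a \<in> {..<r}. g a t = v}" using False by auto
    then have "card {a \<in> {..<r}. (g(i := x)) a t = v} \<le> card {a \<in> {..<r}. g a t = v}" by (intro card_mono) auto
    also have "\<dots> \<le> q" using g t v by (simp add: configs_def)
    finally show ?thesis .
  qed
  ultimately show ?thesis by (simp add: configs_def)
qed

lemma finite_free_supports: "finite (free_supports g i)"
  unfolding free_supports_def by (intro finite_PiE) (auto simp: free_cols_def)

text \<open>Resampling row \<open>i\<close> given the other rows preserves the uniform distribution on configurations: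
  the pairs of a configuration and a new row are permuted by exchanging the old and the new row.\<close>

lemma sum_configs_resample:
  fixes H :: "(nat \<Rightarrow> nat \<Rightarrow> nat) \<Rightarrow> ennreal"
  assumes i: "i < r"
  shows "(\<Sum>g\<in>configs. H g) =
    (\<Sum>g\<in>configs. ennreal (1 / real (card (free_supports g i))) * (\<Sum>x\<in>free_supports g i. H (g(i := x))))"
proof -
  define w where "w g = ennreal (1 / real (card (free_supports g i)))" for g
  let ?S = "SIGMA g:configs. free_supports g i"
  have w1: "(\<Sum>x\<in>free_supports g i. w g * H g) = H g" if g: "g \<in> configs" for g
  proof -
    have "card (free_supports g i) \<noteq> 0"
      using config_row_free[OF g i] finite_free_supports[of g i] by auto
    then have "w g * of_nat (card (free_supports g i)) = 1"
      unfolding w_def ennreal_of_nat_eq_real_of_nat by (subst ennreal_mult[symmetric]) auto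
    then have "of_nat (card (free_supports g i)) * (w g * H g) = H g"
      by (metis mult.assoc mult.commute mult_1)
    then show ?thesis by simp
  qed
  have wupd: "w (g(i := x)) = w g" for g x by (simp add: w_def free_supports_upd)
  have "(\<Sum>g\<in>configs. H g) = (\<Sum>g\<in>configs. \<Sum>x\<in>free_supports g i. w g * H g)" using w1 by simp
  also have "\<dots> = (\<Sum>(g, x)\<in>?S. w g * H g)"
    using finite_configs finite_free_supports by (intro sum.Sigma) auto
  also have "\<dots> = (\<Sum>(g, x)\<in>?S. w g * H (g(i := x)))"
  proof (rule sum.reindex_bij_witness[of _ "\<lambda>(g, x). (g(i := x), g i)" "\<lambda>(g, x). (g(i := x), g i)"])
    fix a assume a: "a \<in> ?S"
    then obtain g x where gx: "a = (g, x)" "g \<in> configs" "x \<in> free_supports g i" by auto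
    show "(\<lambda>(g, x). (g(i := x), g i)) ((\<lambda>(g, x). (g(i := x), g i)) a) = a" using gx by simp
    then show "(\<lambda>(g, x). (g(i := x), g i)) ((\<lambda>(g, x). (g(i := x), g i)) a) = a" .
    show "(\<lambda>(g, x). (g(i := x), g i)) a \<in> ?S"
      using gx config_upd[OF gx(2) i gx(3)] config_row_free[OF gx(2) i] by (simp add: free_supports_upd)
    then show "(\<lambda>(g, x). (g(i := x), g i)) a \<in> ?S" .
    show "(case (\<lambda>(g, x). (g(i := x), g i)) a of (g, x) \<Rightarrow> w g * H (g(i := x))) = (case a of (g, x) \<Rightarrow> w g * H g)"
      using gx wupd by simp
  qed
  also have "\<dots> = (\<Sum>g\<in>configs. \<Sum>x\<in>free_supports g i. w g * H (g(i := x)))"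
    using finite_configs finite_free_supports by (intro sum.Sigma[symmetric]) auto
  finally show ?thesis by (simp add: w_def sum_distrib_left)
qed

section \<open>Row statistics and averaging over all designs\<close>

definition row_signal :: real where
  "row_signal = s * e * real q"

text \<open>Summing over the whole block forgets which columns are used: the target value is
  \<open>row_signal\<close> or 0 and does not depend on \<open>g\<close>.\<close>

definition row_stat :: "((nat \<Rightarrow> nat \<Rightarrow> real) \<Rightarrow> real mat) \<Rightarrow> nat \<Rightarrow> (nat \<Rightarrow> nat \<Rightarrow> real) \<Rightarrow> real" where
  "row_stat T i X = (\<Sum>c\<in>{r..<r + q * m}. T X $$ (i, c))"

text \<open>An absolute error, because the lower bound for the matrix norm is linear in the row
  sums.\<close>

definition row_loss :: "((nat \<Rightarrow> nat \<Rightarrow> real) \<Rightarrow> real mat) \<Rightarrow> nat set \<Rightarrow> (nat \<Rightarrow> nat \<Rightarrow> nat) \<Rightarrow> nat \<Rightarrow> ennreal" where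
  "row_loss T I g i = (\<integral>\<^sup>+X. ennreal \<bar>row_stat T i X - (if i \<in> I then row_signal else 0)\<bar> \<partial>sample_law n p \<mu> (mat_inv (conf I g)))"

lemma row_signal_pos: "0 < row_signal"
  using s e q by (simp add: row_signal_def)

lemma measurable_row_stat:
  assumes "T \<in> estimators n p" "i < r"
  shows "row_stat T i \<in> borel_measurable (sample_space n p)"
  unfolding row_stat_def using assms rp by (intro borel_measurable_sum measurable_estimator) auto

text \<open>Null and alternatives share all rows other than \<open>i\<close>; the alternatives draw
  row \<open>i\<close> uniformly from its free supports. The two targets of \<open>row_stat\<close>
  differ by \<open>row_signal\<close>, so the two absolute errors add up to at least that
  much.\<close>

lemma row_le_cam:
  assumes T: "T \<in> estimators n p" and i: "i < r" "i \<notin> I" and I: "I \<subseteq> {..<r}" and g: "g \<in> configs"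
  shows "ennreal (row_signal / 2) \<le> row_loss T I g i +
    ennreal (1 / real (card (free_supports g i))) * (\<Sum>x\<in>free_supports g i. row_loss T (insert i I) (g(i := x)) i)"
proof -
  let ?Z = "conf I g" and ?b = "\<lambda>x. vec p (\<lambda>c. if \<exists>t<q. c = colm t (x t) then 1 else 0 :: real)"
  let ?A = "\<lambda>x. conf (insert i I) (g(i := x))"
  have ip: "i < p" using i rp by simp
  have eqA: "?A x = sym_update p ?Z (s * e) (unit_vec p i) (?b x)" if "x \<in> free_supports g i" for x
    using conf_insert[OF g I i, of x] that free_supports_subset by blast
  have II: "insert i I \<subseteq> {..<r}" using I i by simp
  have spd: "symmetric_pos_def p (?A x)" if "x \<in> free_supports g i" for x
    by (rule spd_conf[OF config_upd[OF g i(1) that] II])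
  have Fin: "finite (free_cols g i t)" for t by (simp add: free_cols_def)
  have c5': "8 * real q * exp (2 * real n * e\<^sup>2 + 1) \<le> real m / 2" using c5 by simp
  have m2: "0 < real m / 2" using m by simp
  have col: "colm t v < p \<and> colm t v \<noteq> i" if "t < q" "v \<in> free_cols g i t" for t v
    using colm_less[OF that(1), of v] colm_ge[of t v] that(2) i rp by (auto simp: free_cols_def)
  have inj: "t = t' \<and> v = v'" if "t < q" "v \<in> free_cols g i t" "t' < q" "v' \<in> free_cols g i t'" "colm t v = colm t' v'" for t v t' v'
    using colm_inj[of v v' t t'] that by (auto simp: free_cols_def)
  note chi = row_chi_square_bound[of p "pattern I g" q i s e "free_cols g i" "real m / 2" colm n, OF _ pattern_nonneg pattern_row_sum[OF g I] ip
      pattern_zero[OF g I i] s e q eq Fin m2 card_free_cols[OF g] col inj c3 c4 c5', folded conf_def free_supports_def]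
  have B: "symmetric_pos_def p (?A x + ?A x' - ?Z)" if x: "x \<in> free_supports g i" and x': "x' \<in> free_supports g i" for x x'
    unfolding eqA[OF x] eqA[OF x'] by (rule chi(1)) (use x x' pattern_sym in auto)
  have chi2: "(\<Sum>x\<in>free_supports g i. \<Sum>x'\<in>free_supports g i. sqrt (Determinant.det (?A x) * Determinant.det (?A x') / (Determinant.det ?Z * Determinant.det (?A x + ?A x' - ?Z))) ^ n)
     \<le> 2 * (real (card (free_supports g i)))\<^sup>2"
  proof -
    have "(\<Sum>x\<in>free_supports g i. \<Sum>x'\<in>free_supports g i. sqrt (Determinant.det (?A x) * Determinant.det (?A x') / (Determinant.det ?Z * Determinant.det (?A x + ?A x' - ?Z))) ^ n) =
      (\<Sum>x\<in>free_supports g i. \<Sum>x'\<in>free_supports g i. sqrt (Determinant.det (sym_update p ?Z (s * e) (unit_vec p i) (?b x)) * Determinant.det (sym_update p ?Z (s * e) (unit_vec p i) (?b x')) /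
        (Determinant.det ?Z * Determinant.det (sym_update p ?Z (s * e) (unit_vec p i) (?b x) + sym_update p ?Z (s * e) (unit_vec p i) (?b x') - ?Z))) ^ n)"
    proof (intro sum.cong refl)
      fix x x' assume x: "x \<in> free_supports g i" and x': "x' \<in> free_supports g i"
      show "sqrt (Determinant.det (?A x) * Determinant.det (?A x') / (Determinant.det ?Z * Determinant.det (?A x + ?A x' - ?Z))) ^ n =
        sqrt (Determinant.det (sym_update p ?Z (s * e) (unit_vec p i) (?b x)) * Determinant.det (sym_update p ?Z (s * e) (unit_vec p i) (?b x')) /
        (Determinant.det ?Z * Determinant.det (sym_update p ?Z (s * e) (unit_vec p i) (?b x) + sym_update p ?Z (s * e) (unit_vec p i) (?b x') - ?Z))) ^ n"
        unfolding eqA[OF x] eqA[OF x'] by (rule refl)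
    qed
    also have "\<dots> \<le> 2 * (real (card (free_supports g i)))\<^sup>2"
      by (rule chi(2)) (rule pattern_sym)
    finally show ?thesis .
  qed
  have ne: "free_supports g i \<noteq> {}" using config_row_free[OF g i(1)] by blast
  have tm: "row_stat T i \<in> borel_measurable (sample_space n p)" by (rule measurable_row_stat[OF T i(1)])
  have "ennreal (row_signal / 2) \<le> (\<integral>\<^sup>+X. ennreal \<bar>row_stat T i X\<bar> \<partial>sample_law n p \<mu> (mat_inv ?Z)) +
     ennreal (1 / real (card (free_supports g i))) * (\<Sum>x\<in>free_supports g i. \<integral>\<^sup>+X. ennreal \<bar>row_stat T i X - row_signal\<bar> \<partial>sample_law n p \<mu> (mat_inv (?A x)))"
  proof (rule le_cam_mixture[OF finite_free_supports ne mu spd_conf[OF g I] spd B chi2])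
    show "(\<lambda>X. \<bar>row_stat T i X\<bar>) \<in> borel_measurable (sample_space n p)" using tm by simp
    show "(\<lambda>X. \<bar>row_stat T i X - row_signal\<bar>) \<in> borel_measurable (sample_space n p)" using tm by simp
    show "row_signal \<le> \<bar>row_stat T i X\<bar> + \<bar>row_stat T i X - row_signal\<bar>" for X by linarith
    show "0 \<le> row_signal" using row_signal_pos by simp
  qed simp_all
  then show ?thesis using i(2) by (simp add: row_loss_def)
qed

text \<open>An Assouad-type pairing of the sets without \<open>i\<close> and with \<open>i\<close>.
  The alternatives average over free supports, which \<open>sum_configs_resample\<close> turns into
  the sum over configurations; there are \<open>2 ^ (r - 1)\<close> pairs, each with at least
  \<open>row_signal / 2\<close> per configuration.\<close>

lemma sum_row_loss:
  assumes T: "T \<in> estimators n p" and i: "i < r"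
  shows "ennreal (2 ^ r * real (card configs) * (row_signal / 4)) \<le> (\<Sum>I\<in>Pow {..<r}. \<Sum>g\<in>configs. row_loss T I g i)"
proof -
  let ?R = "{..<r} - {i}"
  have one: "(\<Sum>g\<in>configs. ennreal (row_signal / 2)) \<le> (\<Sum>g\<in>configs. row_loss T I g i) + (\<Sum>g\<in>configs. row_loss T (insert i I) g i)"
    if I: "I \<subseteq> ?R" for I
  proof -
    have "(\<Sum>g\<in>configs. ennreal (row_signal / 2)) \<le> (\<Sum>g\<in>configs. row_loss T I g i +
      ennreal (1 / real (card (free_supports g i))) * (\<Sum>x\<in>free_supports g i. row_loss T (insert i I) (g(i := x)) i))"
      using I i by (intro sum_mono row_le_cam[OF T]) auto
    also have "\<dots> = (\<Sum>g\<in>configs. row_loss T I g i) + (\<Sum>g\<in>configs. row_loss T (insert i I) g i)"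
      unfolding sum.distrib by (subst sum_configs_resample[OF i, of "\<lambda>g. row_loss T (insert i I) g i"]) (rule refl)
    finally show ?thesis .
  qed
  have R: "{..<r} = insert i ?R" using i by auto
  have cR: "card ?R = r - 1" using i by simp
  have "ennreal (2 ^ r * real (card configs) * (row_signal / 4)) = (\<Sum>I\<in>Pow ?R. \<Sum>g\<in>configs. ennreal (row_signal / 2))"
  proof -
    have "(\<Sum>I\<in>Pow ?R. \<Sum>g\<in>configs. row_signal / 2) = 2 ^ (r - 1) * real (card configs) * (row_signal / 2)"
      by (simp add: card_Pow cR del: card_Diff_insert)
    also have "\<dots> = 2 ^ r * real (card configs) * (row_signal / 4)" using r by (cases r) auto
    finally have eq: "(\<Sum>I\<in>Pow ?R. \<Sum>g\<in>configs. row_signal / 2) = 2 ^ r * real (card configs) * (row_signal / 4)" .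
    have "ennreal (2 ^ r * real (card configs) * (row_signal / 4)) = ennreal (\<Sum>I\<in>Pow ?R. \<Sum>g\<in>configs. row_signal / 2)"
      by (simp only: eq)
    also have "\<dots> = (\<Sum>I\<in>Pow ?R. ennreal (\<Sum>g\<in>configs. row_signal / 2))"
      using row_signal_pos by (intro sum_ennreal[symmetric] sum_nonneg) auto
    also have "\<dots> = (\<Sum>I\<in>Pow ?R. \<Sum>g\<in>configs. ennreal (row_signal / 2))"
      using row_signal_pos by (intro sum.cong refl sum_ennreal[symmetric]) auto
    finally show ?thesis .
  qed
  also have "\<dots> \<le> (\<Sum>I\<in>Pow ?R. (\<Sum>g\<in>configs. row_loss T I g i) + (\<Sum>g\<in>configs. row_loss T (insert i I) g i))"
    using one by (intro sum_mono) auto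
  also have "\<dots> = (\<Sum>I\<in>Pow ?R. \<Sum>g\<in>configs. row_loss T I g i) + (\<Sum>I\<in>insert i ` Pow ?R. \<Sum>g\<in>configs. row_loss T I g i)"
  proof -
    have "inj_on (insert i) (Pow ?R)" by (rule inj_onI) blast
    then show ?thesis by (simp add: sum.distrib sum.reindex)
  qed
  also have "\<dots> = (\<Sum>I\<in>Pow {..<r}. \<Sum>g\<in>configs. row_loss T I g i)"
    by (subst R, subst Pow_insert, subst sum.union_disjoint) auto
  finally show ?thesis .
qed

lemma conf_row_sum:
  assumes g: "g \<in> configs" and I: "I \<subseteq> {..<r}" and i: "i < r"
  shows "(\<Sum>c\<in>{r..<r + q * m}. conf I g $$ (i, c)) = (if i \<in> I then row_signal else 0)"
proof -
  have ent: "conf I g $$ (i, c) = (if i \<in> I \<and> c \<in> scols (g i) then s * e else 0)" if c: "c \<in> {r..<r + q * m}" for c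
  proof -
    have "\<not> adj I g c i" using adj_less(1)[OF g I, of c i] c by auto
    moreover have "i \<noteq> c" "i < p" "c < p" using i c rp by auto
    ultimately have "conf I g $$ (i, c) = (if adj I g i c then s * e else 0)"
      by (simp add: conf_def pert_def pattern_def)
    then show ?thesis by (simp add: adj_def)
  qed
  have sub: "scols (g i) \<subseteq> {r..<r + q * m}" using scols_bounds[OF configs_supports[OF g i]] by auto
  have "(\<Sum>c\<in>{r..<r + q * m}. conf I g $$ (i, c)) = (\<Sum>c\<in>{r..<r + q * m}. if i \<in> I \<and> c \<in> scols (g i) then s * e else 0)"
    using ent by (intro sum.cong) auto
  also have "\<dots> = (if i \<in> I then (\<Sum>c\<in>scols (g i). s * e) else 0)"
    using sub by (auto simp: sum.inter_restrict[symmetric] Int_absorb1)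
  also have "\<dots> = (if i \<in> I then row_signal else 0)"
    using card_scols[OF configs_supports[OF g i]] by (simp add: row_signal_def)
  finally show ?thesis .
qed

text \<open>The supremum is at least the average over all \<open>I\<close> and \<open>g\<close>. The
  squared norm is linearised by \<open>x^2 \<ge> 2 a x - a^2\<close>, so that the first moments of
  the row errors suffice.\<close>

lemma minimax_risk_lower_block:
  assumes w: "1 \<le> w" and k: "real q + 1 \<le> k" and M: "s * (1 + e * real q) \<le> M"
    and M1: "(1 + e * real q) / (1 - e * real q) \<le> M1"
  shows "ennreal ((real r / real (q * m) * (row_signal / 4))\<^sup>2) \<le> minimax_risk w n p \<mu> (G0 p M1 k M)"
proof -
  define d where "d = real (q * m)"
  have d: "0 < d" using q m by (simp add: d_def)
  \<comment> \<open>The lower bound for the average norm, and thus the best point for the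
    linearisation: it gives \<open>2 a^2 - a^2\<close>.\<close>
  define a where "a = real r / d * (row_signal / 4)"
  have a: "0 < a" using r d row_signal_pos by (simp add: a_def)
  let ?G = "G0 p M1 k M"
  have "ennreal (a\<^sup>2) \<le> (SUP A\<in>?G. risk w n p \<mu> T A)" if T: "T \<in> estimators n p" for T
  proof -
    let ?S = "SUP A\<in>?G. risk w n p \<mu> T A"
    have each: "ennreal (2 * a / d) * (\<Sum>i<r. row_loss T I g i) \<le> ?S + ennreal (a\<^sup>2)"
      if I: "I \<subseteq> {..<r}" and g: "g \<in> configs" for I g
    proof -
      let ?P = "sample_law n p \<mu> (mat_inv (conf I g))"
      interpret prob_space ?P by (rule prob_space_sample_law[OF spd_conf[OF g I] mu])
      let ?t = "\<lambda>i X. \<bar>row_stat T i X - (if i \<in> I then row_signal else 0)\<bar>"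
      let ?x = "\<lambda>X. 2 * a / d * (\<Sum>i<r. ?t i X)"
      have sets: "sets ?P = sets (sample_space n p)" by (simp add: sample_law_density[OF spd_conf[OF g I] mu])
      have tm: "?t i \<in> borel_measurable ?P" if "i < r" for i
      proof -
        have "?t i \<in> borel_measurable (sample_space n p)" using measurable_row_stat[OF T that] by simp
        then show ?thesis by (simp only: measurable_cong_sets[OF sets refl])
      qed
      have loss: "?x X - a\<^sup>2 \<le> (lw_mat_norm w (T X - conf I g))\<^sup>2" for X
      proof -
        have Tc: "T X \<in> carrier_mat p p" using T by (simp add: estimators_def)
        have cc: "conf I g \<in> carrier_mat p p" by (simp add: conf_def)
        have c: "T X - conf I g \<in> carrier_mat p p" using cc by (rule minus_carrier_mat)
        have D: "{r..<r + q * m} \<subseteq> {..<p}" "{r..<r + q * m} \<noteq> {}" "{..<r} \<subseteq> {..<p}" using rp q m by auto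
        have cr: "card {..<r} \<le> card {r..<r + q * m}" using rq by simp
        let ?N = "lw_mat_norm w (T X - conf I g)"
        have "(\<Sum>i<r. \<bar>\<Sum>j\<in>{r..<r + q * m}. (T X - conf I g) $$ (i, j)\<bar>) / real (card {r..<r + q * m}) \<le> ?N"
          by (rule lw_mat_norm_ge_block[OF c p_pos w D(3,1,2) cr])
        also have "(\<Sum>i<r. \<bar>\<Sum>j\<in>{r..<r + q * m}. (T X - conf I g) $$ (i, j)\<bar>) = (\<Sum>i<r. ?t i X)"
        proof (intro sum.cong refl)
          fix i assume "i \<in> {..<r}"
          then have i: "i < r" by simp
          have "(\<Sum>j\<in>{r..<r + q * m}. (T X - conf I g) $$ (i, j)) = (\<Sum>j\<in>{r..<r + q * m}. T X $$ (i, j) - conf I g $$ (i, j))"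
            using i Tc cc rp by (intro sum.cong) auto
          then show "\<bar>\<Sum>j\<in>{r..<r + q * m}. (T X - conf I g) $$ (i, j)\<bar> = ?t i X"
            unfolding row_stat_def conf_row_sum[OF g I i, symmetric] sum_subtractf[symmetric] by simp
        qed
        finally have N: "(\<Sum>i<r. ?t i X) / d \<le> ?N" by (simp add: d_def)
        have "?x X = 2 * a * ((\<Sum>i<r. ?t i X) / d)" by simp
        also have "\<dots> \<le> 2 * a * ?N" using N a by (intro mult_left_mono) auto
        also have "\<dots> \<le> ?N\<^sup>2 + a\<^sup>2" using sum_squares_bound[of a ?N] by simp
        finally show ?thesis by simp
      qed
      have x0: "0 \<le> ?x X" for X using a d by (intro mult_nonneg_nonneg sum_nonneg) auto
      have "ennreal (2 * a / d) * (\<Sum>i<r. row_loss T I g i) = (\<integral>\<^sup>+X. ennreal (?x X) \<partial>?P)"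
      proof -
        have "ennreal (?x X) = ennreal (2 * a / d) * (\<Sum>i<r. ennreal (?t i X))" for X
        proof -
          have "(\<Sum>i<r. ennreal (?t i X)) = ennreal (\<Sum>i<r. ?t i X)" by (intro sum_ennreal) auto
          moreover have "ennreal (?x X) = ennreal (2 * a / d) * ennreal (\<Sum>i<r. ?t i X)"
            using a d by (intro ennreal_mult sum_nonneg) auto
          ultimately show ?thesis by simp
        qed
        then have "(\<integral>\<^sup>+X. ennreal (?x X) \<partial>?P) = (\<integral>\<^sup>+X. ennreal (2 * a / d) * (\<Sum>i<r. ennreal (?t i X)) \<partial>?P)"
          by (rule nn_integral_cong)
        also have "\<dots> = ennreal (2 * a / d) * (\<integral>\<^sup>+X. (\<Sum>i<r. ennreal (?t i X)) \<partial>?P)"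
          using tm by (intro nn_integral_cmult borel_measurable_sum measurable_compose[OF _ measurable_ennreal]) auto
        also have "(\<integral>\<^sup>+X. (\<Sum>i<r. ennreal (?t i X)) \<partial>?P) = (\<Sum>i<r. row_loss T I g i)"
          unfolding row_loss_def using tm by (intro nn_integral_sum measurable_compose[OF _ measurable_ennreal]) auto
        finally show ?thesis by simp
      qed
      also have "\<dots> \<le> (\<integral>\<^sup>+X. ennreal (?x X - a\<^sup>2) + ennreal (a\<^sup>2) \<partial>?P)"
        by (rule nn_integral_mono) (rule ennreal_le_diff_plus, simp)
      also have "\<dots> = (\<integral>\<^sup>+X. ennreal (?x X - a\<^sup>2) \<partial>?P) + ennreal (a\<^sup>2)"
      proof -
        have "(\<lambda>X. ennreal (?x X - a\<^sup>2)) \<in> borel_measurable ?P"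
          using tm by (intro measurable_compose[OF _ measurable_ennreal] borel_measurable_diff borel_measurable_times borel_measurable_sum borel_measurable_const) auto
        then show ?thesis by (subst nn_integral_add) (simp_all add: emeasure_space_1)
      qed
      also have "(\<integral>\<^sup>+X. ennreal (?x X - a\<^sup>2) \<partial>?P) + ennreal (a\<^sup>2) \<le> ?S + ennreal (a\<^sup>2)"
      proof (rule add_right_mono)
        have "(\<integral>\<^sup>+X. ennreal (?x X - a\<^sup>2) \<partial>?P) \<le> risk w n p \<mu> T (conf I g)"
          unfolding risk_def by (intro nn_integral_mono ennreal_leI loss)
        also have "\<dots> \<le> ?S" using conf_in_G0[OF g I k M M1] by (rule SUP_upper)
        finally show "(\<integral>\<^sup>+X. ennreal (?x X - a\<^sup>2) \<partial>?P) \<le> ?S" .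
      qed
      finally show ?thesis .
    qed
    define N where "N = 2 ^ r * real (card configs)"
    have N: "0 < N" using finite_configs configs_nonempty by (simp add: N_def card_gt_0_iff)
    have "ennreal N * ennreal (2 * a\<^sup>2) = ennreal (2 * a / d) * (\<Sum>i<r. ennreal (N * (row_signal / 4)))"
    proof -
      have "(\<Sum>i<r. ennreal (N * (row_signal / 4))) = ennreal (\<Sum>i<r. N * (row_signal / 4))"
        using N row_signal_pos by (intro sum_ennreal) auto
      also have "(\<Sum>i<r. N * (row_signal / 4)) = real r * (N * (row_signal / 4))" by simp
      finally have 1: "(\<Sum>i<r. ennreal (N * (row_signal / 4))) = ennreal (real r * (N * (row_signal / 4)))" .
      have "ennreal (2 * a / d) * (\<Sum>i<r. ennreal (N * (row_signal / 4))) = ennreal (2 * a / d * (real r * (N * (row_signal / 4))))"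
        unfolding 1 using a d N row_signal_pos by (intro ennreal_mult[symmetric]) auto
      also have "2 * a / d * (real r * (N * (row_signal / 4))) = N * (2 * a\<^sup>2)"
        by (simp add: a_def power2_eq_square)
      finally show ?thesis using N by (simp add: ennreal_mult)
    qed
    also have "\<dots> \<le> ennreal (2 * a / d) * (\<Sum>i<r. \<Sum>I\<in>Pow {..<r}. \<Sum>g\<in>configs. row_loss T I g i)"
      using sum_row_loss[OF T] by (intro mult_left_mono sum_mono) (auto simp: N_def)
    also have "(\<Sum>i<r. \<Sum>I\<in>Pow {..<r}. \<Sum>g\<in>configs. row_loss T I g i) = (\<Sum>I\<in>Pow {..<r}. \<Sum>g\<in>configs. \<Sum>i<r. row_loss T I g i)"
      by (subst sum.swap) (intro sum.cong refl sum.swap)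
    also have "ennreal (2 * a / d) * \<dots> = (\<Sum>I\<in>Pow {..<r}. \<Sum>g\<in>configs. ennreal (2 * a / d) * (\<Sum>i<r. row_loss T I g i))"
      by (simp only: sum_distrib_left)
    also have "\<dots> \<le> (\<Sum>I\<in>Pow {..<r}. \<Sum>g\<in>configs. ?S + ennreal (a\<^sup>2))"
      using each by (intro sum_mono) auto
    also have "\<dots> = ennreal N * (?S + ennreal (a\<^sup>2))"
    proof -
      have "of_nat (2 ^ r * card configs) = ennreal N"
        by (simp only: ennreal_of_nat_eq_real_of_nat N_def of_nat_mult of_nat_power of_nat_numeral)
      then show ?thesis by (simp add: card_Pow mult.assoc[symmetric])
    qed
    finally have "ennreal N * ennreal (2 * a\<^sup>2) \<le> ennreal N * (?S + ennreal (a\<^sup>2))" .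
    then have "ennreal (2 * a\<^sup>2) \<le> ?S + ennreal (a\<^sup>2)"
      using N by (subst (asm) ennreal_mult_le_mult_iff) auto
    then show ?thesis using ennreal_half_le[of "2 * a\<^sup>2" ?S] by simp
  qed
  then show ?thesis unfolding minimax_risk_def a_def d_def by (rule INF_greatest)
qed

end

section \<open>Rates\<close>

text \<open>With \<open>r^2 = 8 (M1 + 20) L / n\<close> the failure term is \<open>p ^ (- 4)\<close>
  for each of \<open>p^2\<close> entries. The total \<open>p ^ (- 2)\<close> is at most
  \<open>1 / (c1 n)\<close> and is dominated by the rate, as \<open>k\<close> and \<open>L\<close>
  are at least 1. The smallness condition is \<open>8 * k * r \<le> 1\<close> squared.\<close>

lemma minimax_risk_upper_large:
  fixes p n :: nat and M1 k M c1 :: real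
  defines "L \<equiv> ln (real p)"
  assumes p: "0 < p" and L: "1 \<le> L" and n: "0 < n" and w: "1 \<le> w" and m: "\<mu> \<in> carrier_vec p" and M: "0 < M" and M1: "0 \<le> M1"
    and k: "1 \<le> k" and c1: "0 < c1" "c1 * real n \<le> real p"
    and small: "512 * (M1 + 20) * (k\<^sup>2 * L) \<le> real n"
  shows "minimax_risk w n p \<mu> (G0 p M1 k M) \<le>
    ennreal ((2048 * (M1 + 20) + 8 / c1) * (M\<^sup>2 * k\<^sup>2 * (L / real n)))"
proof -
  define W where "W = M1 + 20"
  have W: "20 \<le> W" using M1 by (simp add: W_def)
  define r where "r = sqrt (8 * W * L / real n)"
  have arg: "0 < 8 * W * L / real n" using W L n by simp
  have r2: "r\<^sup>2 = 8 * W * L / real n" using arg by (simp add: r_def)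
  have r0: "0 < r" using arg by (simp add: r_def)
  have "(8 * k * r)\<^sup>2 = 512 * W * (k\<^sup>2 * L) / real n"
    by (simp add: power_mult_distrib r2)
  also have "\<dots> \<le> 1" using small n by (simp add: W_def)
  finally have "(8 * k * r)\<^sup>2 \<le> 1\<^sup>2" by simp
  then have kr: "8 * k * r \<le> 1" by (rule power2_le_imp_le) simp
  have "1 * r \<le> 8 * k * r" using k r0 by (intro mult_right_mono) auto
  then have r1: "r \<le> 1" using kr by linarith
  have "minimax_risk w n p \<mu> (G0 p M1 k M) \<le>
    ennreal ((16 * k * M * r)\<^sup>2 + 4 * M\<^sup>2 * (real p)\<^sup>2 * (2 * exp (- real n * r\<^sup>2 / (2 * (M1 + 20)))))"
    using k by (intro minimax_risk_upper[OF p w n m M M1 r0 r1 kr]) auto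
  also have "\<dots> \<le> ennreal ((2048 * (M1 + 20) + 8 / c1) * (M\<^sup>2 * k\<^sup>2 * (L / real n)))"
  proof (rule ennreal_leI)
    have e1: "(16 * k * M * r)\<^sup>2 = 2048 * W * (M\<^sup>2 * k\<^sup>2 * (L / real n))"
      by (simp add: power_mult_distrib r2)
    have "- real n * r\<^sup>2 / (2 * W) = - (4 * L)" using W n by (simp add: r2)
    then have "exp (- real n * r\<^sup>2 / (2 * W)) = 1 / exp L ^ 4"
      by (simp add: exp_minus inverse_eq_divide exp_of_nat_mult[symmetric])
    also have "exp L = real p" using p by (simp add: L_def)
    finally have ex: "exp (- real n * r\<^sup>2 / (2 * W)) = 1 / real p ^ 4" .
    have p1: "1 \<le> real p" using p by simp
    have "4 * M\<^sup>2 * (real p)\<^sup>2 * (2 * (1 / real p ^ 4)) = 8 * M\<^sup>2 * (1 / (real p)\<^sup>2)"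
      using p by (simp add: power2_eq_square power4_eq_xxxx)
    also have "\<dots> \<le> 8 * M\<^sup>2 * (1 / (c1 * real n))"
    proof (intro mult_left_mono divide_left_mono)
      have "real p * 1 \<le> real p * real p" using p1 by (intro mult_left_mono) auto
      then show "c1 * real n \<le> (real p)\<^sup>2" using c1 by (simp add: power2_eq_square)
    qed (use c1 n p in auto)
    also have "\<dots> = 8 / c1 * (M\<^sup>2 * (1 / real n))" by simp
    also have "\<dots> \<le> 8 / c1 * (M\<^sup>2 * (k\<^sup>2 * L / real n))"
    proof (intro mult_left_mono divide_right_mono)
      have "1 \<le> k\<^sup>2" using k by (simp add: one_le_power)
      then show "1 \<le> k\<^sup>2 * L" using L by (metis mult_mono mult_1 zero_le_one order_trans)
    qed (use c1 in auto)
    finally have e2: "4 * M\<^sup>2 * (real p)\<^sup>2 * (2 * (1 / real p ^ 4)) \<le> 8 / c1 * (M\<^sup>2 * k\<^sup>2 * (L / real n))" by simp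
    show "(16 * k * M * r)\<^sup>2 + 4 * M\<^sup>2 * (real p)\<^sup>2 * (2 * exp (- real n * r\<^sup>2 / (2 * (M1 + 20))))
      \<le> (2048 * (M1 + 20) + 8 / c1) * (M\<^sup>2 * k\<^sup>2 * (L / real n))"
      unfolding W_def[symmetric] ex e1 distrib_right using e2 by linarith
  qed
  finally show ?thesis .
qed

text \<open>The choice \<open>e^2 = \<kappa> L / n\<close> keeps \<open>n e^2 / 2\<close> below
  \<open>L\<close>, and \<open>L \<le> \<gamma> n\<close> turns the conditions on
  \<open>\<kappa> * \<gamma>\<close> into \<open>e \<le> 1\<close> and
  \<open>1 + e \<le> M1\<close>. The factor \<open>k^2\<close> is missing, which does no harm where
  \<open>k\<close> is bounded.\<close>

lemma minimax_risk_lower_log: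
  fixes p n :: nat and M1 k M \<gamma> :: real
  defines "L \<equiv> ln (real p)"
  assumes p: "2 \<le> p" and n: "0 < n" and w: "1 \<le> w" and m: "\<mu> \<in> carrier_vec p" and M: "0 < M" and k: "1 \<le> k"
    and g: "0 < \<gamma>" "L \<le> \<gamma> * real n" and \<kappa>: "0 < \<kappa>" "\<kappa> \<le> 1" "\<kappa> * \<gamma> \<le> 1" "\<kappa> * \<gamma> \<le> (M1 - 1)\<^sup>2" and M1: "1 < M1"
  shows "ennreal (\<kappa> / 32 * (M\<^sup>2 * (L / real n))) \<le> minimax_risk w n p \<mu> (G0 p M1 k M)"
proof -
  have L: "0 < L" using p by (simp add: L_def)
  define e where "e = sqrt (\<kappa> * L / real n)"
  have e2: "e\<^sup>2 = \<kappa> * L / real n" using \<kappa> L n by (simp add: e_def)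
  have e0: "0 \<le> e" using \<kappa> L by (simp add: e_def)
  have "L / real n \<le> \<gamma>" using g n by (simp add: divide_le_eq)
  then have "\<kappa> * (L / real n) \<le> \<kappa> * \<gamma>" using \<kappa> by (intro mult_left_mono) auto
  then have eg: "e\<^sup>2 \<le> \<kappa> * \<gamma>" by (simp add: e2)
  have "e\<^sup>2 \<le> 1\<^sup>2" using eg \<kappa> by simp
  then have e1: "e \<le> 1" by (rule power2_le_imp_le) simp
  have "e\<^sup>2 \<le> (M1 - 1)\<^sup>2" using eg \<kappa> by linarith
  then have eM: "e \<le> M1 - 1" by (rule power2_le_imp_le) (use M1 in simp)
  have "\<kappa> * L \<le> 1 * L" using \<kappa> L by (intro mult_right_mono) auto
  then have "real n * e\<^sup>2 / 2 \<le> L" using n L by (simp add: e2)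
  then have "exp (real n * e\<^sup>2 / 2) \<le> exp L" by simp
  also have "exp L = real p" using p by (simp add: L_def)
  finally have "ennreal (M\<^sup>2 * e\<^sup>2 / 32) \<le> minimax_risk w n p \<mu> (G0 p M1 k M)"
    using p eM by (intro minimax_risk_lower_diag[OF _ w m M k e0 e1]) auto
  moreover have "M\<^sup>2 * e\<^sup>2 / 32 = \<kappa> / 32 * (M\<^sup>2 * (L / real n))" by (simp add: e2 mult_ac)
  ultimately show ?thesis by simp
qed

text \<open>The block design with \<open>s = M / 2\<close> and \<open>e = c sqrt (L / n)\<close>.
  Its conditions on \<open>e q\<close>, \<open>n q^2 e^4\<close> and \<open>n e^3 q\<close> amount
  to bounds on \<open>k^2 L / n\<close>, \<open>k^2 L^2 / n\<close> and \<open>k^2 L^3 / n\<close>,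
  all implied by \<open>small\<close>; the number of columns is supplied by
  \<open>big\<close>.\<close>

lemma minimax_risk_lower_large:
  fixes p n :: nat and M1 k M \<tau> c :: real
  defines "L \<equiv> ln (real p)"
  assumes p: "0 < p" and L: "1 \<le> L" and n: "0 < n" and w: "1 \<le> w" and m: "\<mu> \<in> carrier_vec p" and M: "0 < M" and k: "2 \<le> k"
    and c: "0 < c" "c \<le> 1" and \<tau>: "0 < \<tau>" "\<tau> \<le> 1 / 64" "\<tau> \<le> (M1 - 1) / (M1 + 1)" and M1: "1 < M1"
    and small: "k\<^sup>2 * L ^ 3 \<le> \<tau>\<^sup>2 * real n" and big: "64 * exp 1 * real n * real p powr (2 * c\<^sup>2) \<le> real p"
  shows "ennreal (c\<^sup>2 / 9216 * (M\<^sup>2 * k\<^sup>2 * (L / real n))) \<le> minimax_risk w n p \<mu> (G0 p M1 k M)"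
proof -
  define q where "q = nat \<lfloor>k\<rfloor> - 1"
  have fl: "2 \<le> \<lfloor>k\<rfloor>" using k by (simp add: le_floor_iff)
  have qi: "int q = \<lfloor>k\<rfloor> - 1" using fl unfolding q_def by linarith
  then have qk: "real q = of_int \<lfloor>k\<rfloor> - 1" by (metis of_int_1 of_int_diff of_int_of_nat_eq)
  have q: "0 < q" "1 \<le> real q" using fl qi by linarith+
  have qk1: "real q + 1 \<le> k" unfolding qk by simp
  \<comment> \<open>Tightest for \<open>k\<close> just below 3, where \<open>q = 1\<close>.\<close>
  have k3: "k / 3 \<le> real q" unfolding qk using fl by linarith
  have q2k2: "(real q)\<^sup>2 \<le> k\<^sup>2" using qk1 by (intro power_mono) auto
  define e where "e = c * sqrt (L / real n)"
  have e0: "0 < e" using c L n by (simp add: e_def)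
  have e2: "e\<^sup>2 = c\<^sup>2 * (L / real n)" using L n by (simp add: e_def power_mult_distrib)
  have cp: "c ^ j \<le> 1" for j using c by (simp add: power_le_one)
  have \<tau>2: "\<tau>\<^sup>2 \<le> (1 / 64)\<^sup>2" using \<tau> by (intro power_mono) auto
  have q2L: "(real q)\<^sup>2 * L ^ 3 \<le> \<tau>\<^sup>2 * real n"
    by (rule order_trans[OF mult_right_mono[OF q2k2] small]) (use L in simp)
  have Lp: "L \<le> L ^ 3" "L\<^sup>2 \<le> L ^ 3" using L by (auto intro: power_increasing[of 2 3 L, simplified] power_increasing[of 1 3 L, simplified])
  have q2L1: "(real q)\<^sup>2 * L / real n \<le> \<tau>\<^sup>2" "(real q)\<^sup>2 * L\<^sup>2 / real n \<le> \<tau>\<^sup>2" "(real q)\<^sup>2 * L ^ 3 / real n \<le> \<tau>\<^sup>2"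
    using q2L mult_left_mono[OF Lp(1), of "(real q)\<^sup>2"] mult_left_mono[OF Lp(2), of "(real q)\<^sup>2"] n
    by (auto simp: divide_le_eq)
  have "(e * real q)\<^sup>2 = c\<^sup>2 * ((real q)\<^sup>2 * L / real n)" by (simp add: power_mult_distrib e2)
  also have "\<dots> \<le> 1 * ((real q)\<^sup>2 * L / real n)" using cp L by (intro mult_right_mono) auto
  also have "\<dots> \<le> \<tau>\<^sup>2" using q2L1(1) by simp
  finally have eqt: "e * real q \<le> \<tau>" by (rule power2_le_imp_le) (use \<tau> in simp)
  have eq: "64 * e * real q \<le> 1" using eqt \<tau> by simp
  have e6: "e ^ 6 = c ^ 6 * (L ^ 3 / real n ^ 3)"
  proof -
    have "e ^ 6 = (e\<^sup>2) ^ 3" by (simp add: power_mult[symmetric])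
    also have "\<dots> = (c\<^sup>2) ^ 3 * (L / real n) ^ 3" unfolding e2 by (rule power_mult_distrib)
    finally show ?thesis by (simp add: power_mult[symmetric] power_divide)
  qed
  have e4: "e ^ 4 = c ^ 4 * (L\<^sup>2 / (real n)\<^sup>2)"
  proof -
    have "e ^ 4 = (e\<^sup>2)\<^sup>2" by (simp add: power_mult[symmetric])
    also have "\<dots> = (c\<^sup>2)\<^sup>2 * (L / real n)\<^sup>2" unfolding e2 by (rule power_mult_distrib)
    finally show ?thesis by (simp add: power_mult[symmetric] power_divide)
  qed
  have c3: "4 * real n * e ^ 3 * real q \<le> 1"
  proof -
    have "(4 * real n * e ^ 3 * real q)\<^sup>2 = 16 * (real n)\<^sup>2 * e ^ 6 * (real q)\<^sup>2"
      by (simp add: power_mult_distrib power_mult[symmetric])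
    also have "\<dots> = 16 * c ^ 6 * ((real q)\<^sup>2 * L ^ 3 / real n)"
      unfolding e6 using n by (simp add: power2_eq_square power3_eq_cube)
    also have "\<dots> \<le> 16 * 1 * \<tau>\<^sup>2"
      using q2L1(3) cp[of 6] c L by (intro mult_mono) auto
    also have "\<dots> \<le> 1\<^sup>2" using \<tau>2 by (simp add: power2_eq_square)
    finally show ?thesis by (rule power2_le_imp_le) simp
  qed
  have c4: "16 * real n * (real q)\<^sup>2 * e ^ 4 \<le> 1"
  proof -
    have "16 * real n * (real q)\<^sup>2 * e ^ 4 = 16 * c ^ 4 * ((real q)\<^sup>2 * L\<^sup>2 / real n)"
      unfolding e4 using n by (simp add: power2_eq_square)
    also have "\<dots> \<le> 16 * 1 * \<tau>\<^sup>2"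
      using q2L1(2) cp[of 4] c L by (intro mult_mono) auto
    also have "\<dots> \<le> 1" using \<tau>2 by (simp add: power2_eq_square)
    finally show ?thesis .
  qed
  \<comment> \<open>The block takes at most half of the indices; the perturbed rows, half as many as
    its columns, are found outside it.\<close>
  define m where "m = p div (2 * q)"
  define E where "E = exp (2 * real n * e\<^sup>2 + 1)"
  have E: "E = exp 1 * real p powr (2 * c\<^sup>2)"
    using n p by (simp add: E_def e2 exp_add powr_def L_def mult_ac)
  have E1: "2 \<le> E" unfolding E_def using exp_ge_add_one_self[of "2 * real n * e\<^sup>2 + 1"] by (smt (verit) mult_nonneg_nonneg of_nat_0_le_iff zero_le_power2)
  have "(real q)\<^sup>2 * 1 \<le> (real q)\<^sup>2 * L ^ 3" using L by (intro mult_left_mono) (auto simp: one_le_power)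
  also have "\<dots> \<le> \<tau>\<^sup>2 * real n" by (rule q2L)
  also have "\<dots> \<le> 1 * real n" using \<tau>2 by (intro mult_right_mono) (auto simp: power2_eq_square)
  finally have q2n: "(real q)\<^sup>2 \<le> real n" by simp
  have qp: "64 * (real q)\<^sup>2 * E \<le> real p"
  proof -
    have "64 * (real q)\<^sup>2 * E \<le> 64 * real n * E" using q2n E1 by (intro mult_right_mono mult_left_mono) auto
    moreover have "64 * real n * E \<le> real p" using big by (simp add: E mult_ac)
    ultimately show ?thesis by linarith
  qed
  have c5: "16 * real q * E \<le> real m"
  proof -
    have "real q * 1 \<le> real q * real q" using q by (intro mult_left_mono) auto
    then have "64 * real q * 2 \<le> 64 * (real q)\<^sup>2 * E" using E1 by (intro mult_mono) (auto simp: power2_eq_square)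
    then have p4: "4 * real q \<le> real p" using qp q by linarith
    have "p < 2 * q + 2 * q * m"
      unfolding m_def by (rule dividend_less_times_div) (use q in simp)
    then have "real p < real (2 * q + 2 * q * m)" by (simp only: of_nat_less_iff)
    also have "\<dots> = real (2 * q) * (real m + 1)" by (simp add: algebra_simps)
    also have "real (2 * q) = 2 * real q" by simp
    finally have "64 * (real q)\<^sup>2 * E < 2 * real q * (real m + 1)" using qp by linarith
    then have "(2 * real q) * (32 * real q * E) < (2 * real q) * (real m + 1)" by (simp add: power2_eq_square mult_ac)
    then have "32 * real q * E < real m + 1" using q by (simp only: mult_less_cancel_left_pos)
    moreover have "16 * 1 * 2 \<le> 16 * real q * E" using q E1 by (intro mult_mono) auto
    ultimately show ?thesis by linarith
  qed
  have m32: "32 \<le> real m"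
  proof -
    have "16 * 1 * 2 \<le> 16 * real q * E" using q E1 by (intro mult_mono) auto
    then show ?thesis using c5 by linarith
  qed
  have qm2: "2 * (q * m) \<le> p" using times_div_less_eq_dividend[of "2 * q" p] by (simp add: m_def mult.assoc)
  define r where "r = (q * m) div 2"
  have qm: "32 \<le> q * m"
  proof -
    have "1 * 32 \<le> q * m" using q m32 by (intro mult_mono) auto
    then show ?thesis by simp
  qed
  have r: "0 < r" "2 * r \<le> q * m" "r + q * m \<le> p" using qm qm2 by (auto simp: r_def)
  interpret block_design p r q m n "M / 2" e \<mu>
  proof
    show "0 < q" "0 < r" "r + q * m \<le> p" "2 * r \<le> q * m" "0 < e" "64 * e * real q \<le> 1" "4 * real n * e ^ 3 * real q \<le> 1"
      "16 * real n * (real q)\<^sup>2 * e ^ 4 \<le> 1" by fact+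
    show "0 < m" using m32 by (cases m) auto
    show "0 < M / 2" using M by simp
    show "16 * real q * exp (2 * real n * e\<^sup>2 + 1) \<le> real m" using c5 by (simp add: E_def)
    show "\<mu> \<in> carrier_vec p" by fact
  qed
  have lower: "ennreal ((real r / real (q * m) * (row_signal / 4))\<^sup>2) \<le> minimax_risk w n p \<mu> (G0 p M1 k M)"
  proof (rule minimax_risk_lower_block[OF w qk1])
    have "1 + e * real q \<le> 2" using eqt \<tau> by linarith
    then have "M / 2 * (1 + e * real q) \<le> M / 2 * 2" using M by (intro mult_left_mono) auto
    then show "M / 2 * (1 + e * real q) \<le> M" by simp
    have "e * real q \<le> (M1 - 1) / (M1 + 1)" using eqt \<tau> by linarith
    then have "e * real q * (M1 + 1) \<le> M1 - 1" using M1 by (simp add: le_divide_eq)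
    moreover have "e * real q < 1" using eqt \<tau> by linarith
    ultimately show "(1 + e * real q) / (1 - e * real q) \<le> M1" by (simp add: divide_le_eq algebra_simps)
  qed
  have ratio: "1 / 4 \<le> real r / real (q * m)"
  proof -
    have "q * m \<le> 4 * r" using qm by (simp add: r_def)
    then have "real (q * m) \<le> 4 * real r" by (simp only: of_nat_le_iff[symmetric, where 'a = real] of_nat_mult of_nat_numeral)
    moreover have "0 < real (q * m)" using qm by linarith
    ultimately show ?thesis by (simp only: le_divide_eq) simp
  qed
  \<comment> \<open>96 is 4 * 2 * 3 * 4: the share of rows \<open>r / (q m)\<close>, the scale
    \<open>M / 2\<close>, the bound \<open>k / 3 \<le> q\<close> and the quarter of the row
    signal.\<close>
  have "M * e * k / 96 = 1 / 4 * (M / 2 * e * (k / 3) / 4)" by simp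
  also have "\<dots> \<le> real r / real (q * m) * (row_signal / 4)"
  proof (rule mult_mono[OF ratio])
    have "M / 2 * e * (k / 3) \<le> M / 2 * e * real q" using k3 M e0 by (intro mult_left_mono) auto
    then show "M / 2 * e * (k / 3) / 4 \<le> row_signal / 4" by (simp add: row_signal_def)
  qed (use M e0 k in auto)
  finally have "(M * e * k / 96)\<^sup>2 \<le> (real r / real (q * m) * (row_signal / 4))\<^sup>2"
    using M e0 k by (intro power_mono) auto
  moreover have "(M * e * k / 96)\<^sup>2 = c\<^sup>2 / 9216 * (M\<^sup>2 * k\<^sup>2 * (L / real n))"
    by (simp add: power_mult_distrib power_divide e2 mult_ac)
  ultimately have "ennreal (c\<^sup>2 / 9216 * (M\<^sup>2 * k\<^sup>2 * (L / real n))) \<le> ennreal ((real r / real (q * m) * (row_signal / 4))\<^sup>2)"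
    by (intro ennreal_leI) simp
  then show ?thesis using lower by (rule order_trans)
qed

section \<open>From the two bounds to the order of the minimax risk\<close>

lemma ennreal_ratio_bounds:
  assumes b: "0 < b" and c: "0 \<le> c" "ennreal (c * b) \<le> a" and C: "0 \<le> C" "a \<le> ennreal (C * b)"
  shows "ennreal c \<le> a / ennreal b" "a / ennreal b \<le> ennreal C"
proof -
  have d: "ennreal (x * b) / ennreal b = ennreal x" if "0 \<le> x" for x
    using that b by (simp add: divide_ennreal)
  show "ennreal c \<le> a / ennreal b" using divide_right_mono_ennreal[OF c(2), of "ennreal b"] d[OF c(1)] by simp
  show "a / ennreal b \<le> ennreal C" using divide_right_mono_ennreal[OF C(2), of "ennreal b"] d[OF C(1)] by simp
qed

text \<open>Squaring the little-o bound gives the condition on \<open>k\<close>. For the last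
  conjunct put \<open>\<theta> = 1 - 2 * c\<^sup>2\<close>: it asks that
  \<open>p powr \<theta>\<close> exceed a multiple of \<open>n\<close>, and the value of
  \<open>c\<^sup>2\<close> makes \<open>\<beta> * \<theta> = (\<beta> + 1) / 2\<close>, strictly
  above 1.\<close>

lemma eventually_sparse:
  fixes p :: "nat \<Rightarrow> nat" and k :: "nat \<Rightarrow> real"
  assumes \<beta>: "1 < \<beta>" and c1: "0 < c1" and pl: "\<And>n. 1 \<le> n \<Longrightarrow> c1 * real n powr \<beta> \<le> real (p n)"
    and k1: "\<And>n. 1 \<le> n \<Longrightarrow> 1 \<le> k n"
    and ko: "k \<in> o(\<lambda>n. real n powr (1/2) * ln (real (p n)) powr (- 3/2))"
    and \<tau>: "0 < \<tau>" and c: "c\<^sup>2 = (1 - 1 / \<beta>) / 4"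
  shows "eventually (\<lambda>n. 1 \<le> ln (real (p n)) \<and> (k n)\<^sup>2 * ln (real (p n)) ^ 3 \<le> \<tau>\<^sup>2 * real n \<and>
    64 * exp 1 * real n * real (p n) powr (2 * c\<^sup>2) \<le> real (p n)) at_top"
proof -
  define \<theta> where "\<theta> = 1 - 2 * c\<^sup>2"
  have \<theta>: "0 < \<theta>" "\<beta> * \<theta> = (\<beta> + 1) / 2" using \<beta> by (simp_all add: \<theta>_def c field_simps)
  have ev: "eventually (\<lambda>n. z \<le> real n) at_top" for z
    using filterlim_real_sequentially by (simp add: filterlim_at_top)
  define z where "z = 64 * exp 1 / c1 powr \<theta>"
  define \<delta> where "\<delta> = (\<beta> - 1) / 2"
  have z: "0 < z" and \<delta>: "0 < \<delta>" using c1 \<beta> by (simp_all add: z_def \<delta>_def)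
  have "z \<le> real n powr \<delta>" if "z powr (1 / \<delta>) \<le> real n" for n
  proof -
    have "z = (z powr (1 / \<delta>)) powr \<delta>" using z \<delta> by (simp add: powr_powr)
    also have "\<dots> \<le> real n powr \<delta>" using that \<delta> by (intro powr_mono2) auto
    finally show ?thesis .
  qed
  then have ev1: "eventually (\<lambda>n. 64 * exp 1 / c1 powr \<theta> \<le> real n powr ((\<beta> - 1) / 2)) at_top"
    unfolding z_def[symmetric] \<delta>_def[symmetric] using ev[of "z powr (1 / \<delta>)"] by (rule eventually_mono[rotated])
  have ev2: "eventually (\<lambda>n. exp 1 / c1 \<le> real n) at_top" by (rule ev)
  have ev3: "eventually (\<lambda>n. norm (k n) \<le> \<tau> * norm (real n powr (1/2) * ln (real (p n)) powr (- 3/2))) at_top"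
    using landau_o.smallD[OF ko \<tau>] .
  show ?thesis
    using ev1 ev2 ev3 eventually_ge_at_top[of 1]
  proof eventually_elim
    case (elim n)
    have n: "1 \<le> n" "1 \<le> real n" using elim by auto
    let ?p = "real (p n)"
    let ?L = "ln ?p"
    have "c1 * real n \<le> c1 * real n powr \<beta>"
      using c1 n \<beta> powr_mono[of 1 \<beta> "real n"] by (intro mult_left_mono) auto
    then have pn: "c1 * real n \<le> ?p" using pl[OF n(1)] by linarith
    have "exp 1 \<le> c1 * real n" using elim(2) c1 by (simp add: divide_le_eq mult.commute)
    then have pe: "exp 1 \<le> ?p" using pn by linarith
    have p0: "0 < ?p" using pe exp_gt_zero[of "1::real"] by linarith
    have L: "1 \<le> ?L" using pe p0 by (simp add: ln_ge_iff)
    have kb: "k n \<le> \<tau> * (real n powr (1/2) * ?L powr (- 3/2))" using elim(3) L n by simp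
    have "(k n)\<^sup>2 \<le> (\<tau> * (real n powr (1/2) * ?L powr (- 3/2)))\<^sup>2"
      using kb k1[OF n(1)] by (intro power_mono) auto
    also have "\<dots> = \<tau>\<^sup>2 * (real n * ?L powr (- 3))"
      using n L by (simp add: power_mult_distrib powr_power)
    finally have "(k n)\<^sup>2 * ?L ^ 3 \<le> \<tau>\<^sup>2 * (real n * ?L powr (- 3)) * ?L ^ 3"
      using L by (intro mult_right_mono) auto
    also have "\<dots> = \<tau>\<^sup>2 * real n * (?L powr (- 3) * ?L ^ 3)" by (simp only: mult.assoc)
    also have "?L powr (- 3) * ?L ^ 3 = 1"
    proof -
      have "?L powr 3 = ?L ^ 3" using L by (intro powr_numeral) auto
      then have "?L powr (- 3) * ?L ^ 3 = ?L powr (- 3 + 3)" by (simp only: powr_add)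
      then show ?thesis using L by simp
    qed
    finally have sm: "(k n)\<^sup>2 * ?L ^ 3 \<le> \<tau>\<^sup>2 * real n" by simp
    have "64 * exp 1 * real n = c1 powr \<theta> * (64 * exp 1 / c1 powr \<theta>) * real n" using c1 by simp
    also have "\<dots> \<le> c1 powr \<theta> * (real n powr ((\<beta> - 1) / 2)) * real n"
      using elim(1) by (intro mult_right_mono mult_left_mono) auto
    also have "\<dots> = c1 powr \<theta> * real n powr ((\<beta> - 1) / 2 + 1)" using n by (simp add: powr_add)
    also have "(\<beta> - 1) / 2 + 1 = \<beta> * \<theta>" by (simp add: \<theta>(2) field_simps)
    also have "c1 powr \<theta> * real n powr (\<beta> * \<theta>) = (c1 * real n powr \<beta>) powr \<theta>"
      using c1 n by (simp add: powr_mult powr_powr)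
    also have "\<dots> \<le> ?p powr \<theta>" using pl[OF n(1)] c1 \<theta> by (intro powr_mono2) auto
    finally have "64 * exp 1 * real n * ?p powr (2 * c\<^sup>2) \<le> ?p powr \<theta> * ?p powr (2 * c\<^sup>2)"
      by (intro mult_right_mono) auto
    also have "\<dots> = ?p" using p0 by (simp add: powr_add[symmetric] \<theta>_def)
    finally show ?case using L sm by blast
  qed
qed

theorem theorem1:
  fixes p :: "nat \<Rightarrow> nat" and k M :: "nat \<Rightarrow> real" and \<mu> :: "nat \<Rightarrow> real vec"
    and M1 \<beta> c1 \<gamma> \<epsilon> :: real and w :: ereal
  assumes "1 < M1"
    and "1 < \<beta>" and "0 < c1" and "0 < \<gamma>"
    and "\<And>n. 1 \<le> n \<Longrightarrow> c1 * real n powr \<beta> \<le> real (p n)"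
    and "\<And>n. 1 \<le> n \<Longrightarrow> real (p n) \<le> exp (\<gamma> * real n)"
    and "0 < \<epsilon>" and "\<And>n. 1 \<le> n \<Longrightarrow> \<epsilon> \<le> M n"
    and "\<And>n. 1 \<le> n \<Longrightarrow> 1 \<le> k n"
    and "k \<in> o(\<lambda>n. real n powr (1/2) * ln (real (p n)) powr (- 3/2))"
    and "\<And>n. 1 \<le> n \<Longrightarrow> \<mu> n \<in> carrier_vec (p n)"
    and "1 \<le> w"
  shows "same_order_on {n. 1 \<le> n \<and> 2 \<le> p n}
    (\<lambda>n. minimax_risk w n (p n) (\<mu> n) (G0 (p n) M1 (k n) (M n)))
    (\<lambda>n. (M n)\<^sup>2 * (k n)\<^sup>2 * (ln (real (p n)) / real n))"
proof -
  define W where "W = M1 + 20"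
  have W: "21 < W" using assms(1) by (simp add: W_def)
  \<comment> \<open>The first two bounds keep the block design well conditioned and inside the
    class; the third makes \<open>\<tau>\<^sup>2\<close> small enough for the deviations in the
    upper bound.\<close>
  define \<tau> where "\<tau> = min (min (1 / 64) ((M1 - 1) / (M1 + 1))) (1 / (512 * W))"
  have \<tau>: "0 < \<tau>" "\<tau> \<le> 1 / 64" "\<tau> \<le> (M1 - 1) / (M1 + 1)" "\<tau> \<le> 1 / (512 * W)"
    
  proof -
    show "0 < \<tau>" using assms(1) W by (simp add: \<tau>_def)
    show "\<tau> \<le> 1 / 64" unfolding \<tau>_def by (rule order_trans[OF min.cobounded1 min.cobounded1])
    show "\<tau> \<le> (M1 - 1) / (M1 + 1)" unfolding \<tau>_def by (rule order_trans[OF min.cobounded1 min.cobounded2])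
    show "\<tau> \<le> 1 / (512 * W)" unfolding \<tau>_def by (rule min.cobounded2)
  qed
  define c where "c = sqrt ((1 - 1 / \<beta>) / 4)"
  have b1: "0 < 1 - 1 / \<beta>" "1 - 1 / \<beta> < 1" using assms(2) by auto
  have c2: "c\<^sup>2 = (1 - 1 / \<beta>) / 4" using b1 by (simp add: c_def)
  have c: "0 < c" using b1 by (simp add: c_def)
  have "(1 - 1 / \<beta>) / 4 < 1 / 4" using b1(2) by (intro divide_strict_right_mono) auto
  then have "c\<^sup>2 \<le> 1\<^sup>2" unfolding c2 power_one by linarith
  then have c_le: "c \<le> 1" by (rule power2_le_imp_le) simp
  obtain N0 where N0: "\<And>n. N0 \<le> n \<Longrightarrow> 1 \<le> ln (real (p n)) \<and> (k n)\<^sup>2 * ln (real (p n)) ^ 3 \<le> \<tau>\<^sup>2 * real n \<and>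
    64 * exp 1 * real n * real (p n) powr (2 * c\<^sup>2) \<le> real (p n)"
    using eventually_sparse[OF assms(2,3,5,9,10) \<tau>(1) c2] unfolding eventually_at_top_linorder by blast
  define K where "K = 2 + (\<Sum>n<N0. \<bar>k n\<bar>)"
  have K2: "2 \<le> K" by (simp add: K_def sum_nonneg)
  have Kk: "k n \<le> K" if "n < N0" for n
  proof -
    have "\<bar>k n\<bar> \<le> (\<Sum>n<N0. \<bar>k n\<bar>)" using that by (intro member_le_sum) auto
    then show ?thesis by (simp add: K_def)
  qed
  define \<kappa> where "\<kappa> = min 1 (min (1 / \<gamma>) ((M1 - 1)\<^sup>2 / \<gamma>))"
  have \<kappa>: "0 < \<kappa>" "\<kappa> \<le> 1" "\<kappa> * \<gamma> \<le> 1" "\<kappa> * \<gamma> \<le> (M1 - 1)\<^sup>2"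
  proof -
    show "0 < \<kappa>" "\<kappa> \<le> 1" using assms(1,4) by (auto simp: \<kappa>_def)
    have "\<kappa> \<le> 1 / \<gamma>" "\<kappa> \<le> (M1 - 1)\<^sup>2 / \<gamma>" by (auto simp: \<kappa>_def)
    then show "\<kappa> * \<gamma> \<le> 1" "\<kappa> * \<gamma> \<le> (M1 - 1)\<^sup>2" using assms(4) by (auto simp: le_divide_eq)
  qed
  define lo where "lo = min (c\<^sup>2 / 9216) (\<kappa> / 32 / K\<^sup>2)"
  \<comment> \<open>The second term is for \<open>n < N0\<close>: then \<open>N0 / n\<close> and
    \<open>k^2 ln p / ln 2\<close> are at least 1, which lifts \<open>4 M^2\<close> to a multiple of
    the rate.\<close>
  define hi where "hi = max (2048 * W + 8 / c1) (4 * real N0 / ln 2)"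
  have lo0: "0 < lo" using c \<kappa>(1) K2 by (simp add: lo_def)
  have hi0: "0 < hi" using W assms(3) by (simp add: hi_def less_max_iff_disj add_pos_pos)
  define b where "b n = (M n)\<^sup>2 * (k n)\<^sup>2 * (ln (real (p n)) / real n)" for n
  define a where "a n = minimax_risk w n (p n) (\<mu> n) (G0 (p n) M1 (k n) (M n))" for n
  have main: "0 < b n \<and> ennreal lo \<le> a n / ennreal (b n) \<and> a n / ennreal (b n) \<le> ennreal hi" if n1: "1 \<le> n" and p2: "2 \<le> p n" for n
  proof -
    let ?L = "ln (real (p n))"
    have n: "0 < n" "0 < real n" using n1 by auto
    have M: "0 < M n" using assms(7) assms(8)[OF n1] by linarith
    have k: "1 \<le> k n" by (rule assms(9)[OF n1])
    have L2: "ln 2 \<le> ?L" using p2 by simp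
    have L: "0 < ?L" using p2 by simp
    have mu: "\<mu> n \<in> carrier_vec (p n)" by (rule assms(11)[OF n1])
    have p0: "0 < p n" using p2 by simp
    have b: "0 < b n" using M k L n by (simp add: b_def)
    have Lg: "?L \<le> \<gamma> * real n"
      using assms(6)[OF n1] p0 by (metis ln_exp ln_le_cancel_iff exp_gt_zero of_nat_0_less_iff)
    have npow: "c1 * real n \<le> real (p n)"
    proof -
      have "c1 * real n \<le> c1 * real n powr \<beta>"
        using assms(2,3) n1 powr_mono[of 1 \<beta> "real n"] by (intro mult_left_mono) auto
      then show ?thesis using assms(5)[OF n1] by linarith
    qed
    have lower: "ennreal (lo * b n) \<le> a n"
    proof (cases "N0 \<le> n \<and> 2 \<le> k n")
      case True
      note N = N0[of n]
      have "lo * b n \<le> c\<^sup>2 / 9216 * b n" using b by (intro mult_right_mono) (auto simp: lo_def)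
      then have "ennreal (lo * b n) \<le> ennreal (c\<^sup>2 / 9216 * b n)" by (rule ennreal_leI)
      also have "\<dots> \<le> a n"
        unfolding a_def b_def using True N
        by (intro minimax_risk_lower_large[OF p0 _ n(1) assms(12) mu M _ c c_le \<tau>(1,2,3) assms(1)]) auto
      finally show ?thesis .
    next
      case False
      have kK: "k n \<le> K"
      proof (cases "N0 \<le> n")
        case True
        then show ?thesis using False K2 by linarith
      next
        case False
        then show ?thesis using Kk by simp
      qed
      have "(k n)\<^sup>2 \<le> K\<^sup>2" using kK k by (intro power_mono) auto
      then have "(k n)\<^sup>2 / K\<^sup>2 \<le> 1" using K2 by (simp add: divide_le_eq)
      then have "\<kappa> / 32 * (M n)\<^sup>2 * (?L / real n) * ((k n)\<^sup>2 / K\<^sup>2) \<le> \<kappa> / 32 * (M n)\<^sup>2 * (?L / real n) * 1"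
        using \<kappa>(1) L n by (intro mult_left_mono) auto
      moreover have "\<kappa> / 32 / K\<^sup>2 * b n = \<kappa> / 32 * (M n)\<^sup>2 * (?L / real n) * ((k n)\<^sup>2 / K\<^sup>2)"
        by (simp add: b_def mult_ac)
      moreover have "lo * b n \<le> \<kappa> / 32 / K\<^sup>2 * b n" using b by (intro mult_right_mono) (auto simp: lo_def)
      ultimately have "lo * b n \<le> \<kappa> / 32 * ((M n)\<^sup>2 * (?L / real n))" by (simp only: mult.assoc mult_1_right)
      then have "ennreal (lo * b n) \<le> ennreal (\<kappa> / 32 * ((M n)\<^sup>2 * (?L / real n)))" by (rule ennreal_leI)
      also have "\<dots> \<le> a n"
        unfolding a_def by (rule minimax_risk_lower_log[OF p2 n(1) assms(12) mu M k assms(4) Lg \<kappa> assms(1)])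
      finally show ?thesis .
    qed
    have upper: "a n \<le> ennreal (hi * b n)"
    proof (cases "N0 \<le> n")
      case True
      note N = N0[OF True]
      have "512 * (M1 + 20) * ((k n)\<^sup>2 * ?L) \<le> real n"
      proof -
        have "?L \<le> ?L ^ 3" using N power_increasing[of 1 3 ?L] by simp
        then have "(k n)\<^sup>2 * ?L \<le> (k n)\<^sup>2 * ?L ^ 3" by (intro mult_left_mono) auto
        also have "\<dots> \<le> \<tau>\<^sup>2 * real n" using N by simp
        also have "\<dots> \<le> 1 / (512 * W) * real n"
        proof (intro mult_right_mono)
          have "\<tau> * \<tau> \<le> 1 * (1 / (512 * W))" using \<tau> by (intro mult_mono) auto
          then show "\<tau>\<^sup>2 \<le> 1 / (512 * W)" by (simp add: power2_eq_square)
        qed simp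
        finally have "512 * W * ((k n)\<^sup>2 * ?L) \<le> 512 * W * (1 / (512 * W) * real n)" using W by (intro mult_left_mono) auto
        then show ?thesis using W by (simp add: W_def)
      qed
      then have "a n \<le> ennreal ((2048 * (M1 + 20) + 8 / c1) * b n)"
        unfolding a_def b_def using N assms(1)
        by (intro minimax_risk_upper_large[OF p0 _ n(1) assms(12) mu M _ k assms(3) npow]) auto
      also have "\<dots> \<le> ennreal (hi * b n)"
        using b by (intro ennreal_leI mult_right_mono) (auto simp: hi_def W_def)
      finally show ?thesis .
    next
      case False
      have "a n \<le> ennreal (4 * (M n)\<^sup>2)"
        unfolding a_def by (rule minimax_risk_trivial_upper[OF p0 assms(12) mu M])
      also have "\<dots> \<le> ennreal (hi * b n)"
      proof (rule ennreal_leI)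
        have "1 * ln 2 \<le> (k n)\<^sup>2 * ?L" using k L2 by (intro mult_mono) (auto simp: one_le_power)
        then have "1 \<le> (k n)\<^sup>2 * ?L / ln 2" by (simp add: le_divide_eq)
        also have "\<dots> \<le> real N0 / real n * ((k n)\<^sup>2 * ?L / ln 2)"
        proof -
          have "1 \<le> real N0 / real n" using False n by simp
          then have "1 * ((k n)\<^sup>2 * ?L / ln 2) \<le> real N0 / real n * ((k n)\<^sup>2 * ?L / ln 2)"
            using L by (intro mult_right_mono) auto
          then show ?thesis by simp
        qed
        finally have "4 * (M n)\<^sup>2 * 1 \<le> 4 * (M n)\<^sup>2 * (real N0 / real n * ((k n)\<^sup>2 * ?L / ln 2))"
          by (intro mult_left_mono) auto
        also have "\<dots> = 4 * real N0 / ln 2 * b n" by (simp add: b_def mult_ac)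
        also have "\<dots> \<le> hi * b n" using b by (intro mult_right_mono) (auto simp: hi_def)
        finally show "4 * (M n)\<^sup>2 \<le> hi * b n" by simp
      qed
      finally show ?thesis .
    qed
    show ?thesis using b ennreal_ratio_bounds[OF b less_imp_le[OF lo0] lower less_imp_le[OF hi0] upper] by blast
  qed
  then have "\<forall>n\<in>{n. 1 \<le> n \<and> 2 \<le> p n}. 0 < b n"
    "\<forall>n\<in>{n. 1 \<le> n \<and> 2 \<le> p n}. ennreal lo \<le> a n / ennreal (b n) \<and> a n / ennreal (b n) \<le> ennreal hi"
    by blast+
  then show ?thesis unfolding same_order_on_def a_def[symmetric] b_def[symmetric] using lo0 hi0 by blast
qed

end
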